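(* Let $B$ denote a standard Brownian bridge on $[0,1]$ and consider the Borel measure $\mu$ on $[0,1]$ given by $$\mu(a,b) := \int_{a}^{b}\frac{1}{x(1-x)}\,dx\quad\text{for all open intervals }(a,b)\subset[0,1].$$ Then there exists a family of orthogonal polynomials $\{e_{k}\}_{k\geq 1}$ with $\deg(e_{k}) = k+1$ and $$\int_{0}^{1}e_{i}\,e_{j}\,d\mu = \delta_{ij}\qquad (i,j\ge 1),$$ where $\delta_{ij}$ is the Kronecker delta, such that $B$ admits the representation $$B = \sum_{k=1}^{\infty}I_{k}e_{k},$$ where $\{I_{k}\}_{k\ge1}$ is the collection of independent centered Gaussian random variables with $$I_{k} := \int_{0}^{1}B_{t}\cdot\frac{e_{k}(t)}{t(1-t)}\,dt\qquad\text{and}\qquad \operatorname{Var}(I_{k}) = \frac{1}{k(k+1)}.$$ Furthermore, $\{e_{k}\}$ is an optimal orthonormal basis of $L^{2}([0,1],\mu)$ for approximating $B$ by truncated series expansions with respect to the weighted norm $$\|X\|_{L^{2}_{\mu}(\mathbb{P})} := \sqrt{\mathbb{E}\left[\int_{0}^{1}(X_{s})^{2}\,d\mu(s)\right]}$$ (for square $\mu$-integrable processes $X$); that is, $\{e_k\}$ is an orthonormal basis of $L^2([0,1],\mu)$ and, for every orthonormal basis $\{f_k\}_{k\ge1}$ of $L^{2}([0,1],\mu)$, with $J_k:=\int_0^1 B_t f_k(t)\,d\mu(t)$, and for every $n\ge1$, $$\Big\|B-\sum_{k=1}^{n}I_ke_k\Big\|_{L^2_\mu(\mathbb{P})}\l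e\Big\|B-\sum_{k=1}^{n}J_kf_k\Big\|_{L^2_\mu(\mathbb{P})}.$$
   Context: The standard Brownian bridge on $[0,1]$ is the centered Gaussian process (with continuous paths) with covariance $K_{B}(s,t)=\min(s,t)-st$. A process $X$ is square $\mu$-integrable if $\mathbb{E}[\int_0^1 X_s^2\,d\mu(s)]<\infty$. The series representation of $B$ is understood as: for every $t\in[0,1]$, $\sum_{k=1}^{N}I_ke_k(t)\to B_t$ in $L^2(\mathbb{P})$ as $N\to\infty$. *)

theory Defs
  imports "HOL-Probability.Probability"
begin

text \<open>Degenerate (almost surely constant) variables count as Gaussian; this is needed for linear
  combinations of a Gaussian process, e.g. for a bridge at its end points.\<close>

definition gaussian_rv :: "'a measure \<Rightarrow> ('a \<Rightarrow> real) \<Rightarrow> bool" where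
  "gaussian_rv M X \<longleftrightarrow> X \<in> borel_measurable M \<and>
     (\<exists>m. (AE \<omega> in M. X \<omega> = m) \<or> (\<exists>\<sigma>>0. distributed M lborel X (normal_density m \<sigma>)))"

definition covariance :: "'a measure \<Rightarrow> ('a \<Rightarrow> real) \<Rightarrow> ('a \<Rightarrow> real) \<Rightarrow> real" where
  "covariance M X Y =
     (\<integral>\<omega>. (X \<omega> - (\<integral>\<omega>'. X \<omega>' \<partial>M)) * (Y \<omega> - (\<integral>\<omega>'. Y \<omega>' \<partial>M)) \<partial>M)"

text \<open>A process on \<open>[0,1]\<close> is a total function of time; its values outside \<open>[0,1]\<close> are irrelevant
  everywhere below.\<close>

definition gaussian_process :: "'a measure \<Rightarrow> (real \<Rightarrow> 'a \<Rightarrow> real) \<Rightarrow> bool" where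
  "gaussian_process M X \<longleftrightarrow>
     (\<forall>T c. finite T \<longrightarrow> T \<subseteq> {0..1} \<longrightarrow> gaussian_rv M (\<lambda>\<omega>. \<Sum>t\<in>T. c t * X t \<omega>))"

definition standard_brownian_bridge :: "'a measure \<Rightarrow> (real \<Rightarrow> 'a \<Rightarrow> real) \<Rightarrow> bool" where
  "standard_brownian_bridge M B \<longleftrightarrow>
     prob_space M \<and>
     gaussian_process M B \<and>
     (\<forall>t\<in>{0..1}. (\<integral>\<omega>. B t \<omega> \<partial>M) = 0) \<and>
     (\<forall>s\<in>{0..1}. \<forall>t\<in>{0..1}. covariance M (B s) (B t) = min s t - s * t) \<and>
     (\<forall>\<omega>\<in>space M. continuous_on {0..1} (\<lambda>t. B t \<omega>))"

text \<open>The end points, where the density is \<open>1 / 0 = 0\<close>, form a null set.\<close>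

definition bridge_measure :: "real measure" where
  "bridge_measure =
     density (restrict_space lborel {0..1}) (\<lambda>x. ennreal (1 / (x * (1 - x))))"

lemma emeasure_bridge_measure_interval:
  assumes "0 \<le> a" "b \<le> 1"
  shows "emeasure bridge_measure {a<..<b} =
           (\<integral>\<^sup>+x\<in>{a<..<b}. ennreal (1 / (x * (1 - x))) \<partial>lborel)"
proof -
  have sub: "{a<..<b} \<subseteq> {0..1}"
    using assms by auto
  have m: "(\<lambda>x::real. ennreal (1 / (x * (1 - x)))) \<in> borel_measurable (restrict_space lborel {0..1})"
    by (intro measurable_restrict_space1) measurable
  have "{a<..<b} \<in> sets (restrict_space lborel {0..1})"
    using sub by (auto simp: sets_restrict_space_iff)
  then have "emeasure bridge_measure {a<..<b} =
      (\<integral>\<^sup>+x\<in>{a<..<b}. ennreal (1 / (x * (1 - x))) \<partial>restrict_space lborel {0..1})"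
    unfolding bridge_measure_def by (rule emeasure_density[OF m])
  also have "\<dots> = (\<integral>\<^sup>+x. ennreal (1 / (x * (1 - x))) * indicator {a<..<b} x * indicator {0..1} x \<partial>lborel)"
    by (subst nn_integral_restrict_space) auto
  also have "\<dots> = (\<integral>\<^sup>+x\<in>{a<..<b}. ennreal (1 / (x * (1 - x))) \<partial>lborel)"
    using sub by (intro nn_integral_cong) (auto simp: indicator_def)
  finally show ?thesis .
qed

definition square_integrable :: "'b measure \<Rightarrow> ('b \<Rightarrow> real) \<Rightarrow> bool" where
  "square_integrable N f \<longleftrightarrow> f \<in> borel_measurable N \<and> integrable N (\<lambda>x. (f x)\<^sup>2)"

text \<open>An orthonormal basis of \<open>L\<^sup>2(N)\<close>, given by representatives \<open>f 1, f 2, \<dots>\<close>: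
  an orthonormal sequence with dense linear span. The value \<open>f 0\<close> is not used.\<close>

definition orthonormal_basis :: "'b measure \<Rightarrow> (nat \<Rightarrow> 'b \<Rightarrow> real) \<Rightarrow> bool" where
  "orthonormal_basis N f \<longleftrightarrow>
     (\<forall>k\<ge>1. square_integrable N (f k)) \<and>
     (\<forall>i\<ge>1. \<forall>j\<ge>1. (\<integral>x. f i x * f j x \<partial>N) = (if i = j then 1 else 0)) \<and>
     (\<forall>g. square_integrable N g \<longrightarrow>
        (\<forall>\<epsilon>>0. \<exists>n c. (\<integral>x. (g x - (\<Sum>k=1..n. c k * f k x))\<^sup>2 \<partial>N) < \<epsilon>))"

definition square_mu_integrable :: "'a measure \<Rightarrow> (real \<Rightarrow> 'a \<Rightarrow> real) \<Rightarrow> bool" where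
  "square_mu_integrable M X \<longleftrightarrow>
     (\<lambda>(\<omega>, s). X s \<omega>) \<in> borel_measurable (M \<Otimes>\<^sub>M bridge_measure) \<and>
     (\<integral>\<^sup>+\<omega>. (\<integral>\<^sup>+s. ennreal ((X s \<omega>)\<^sup>2) \<partial>bridge_measure) \<partial>M) < \<infinity>"

text \<open>Only meaningful for processes satisfying \<^const>\<open>square_mu_integrable\<close>, since the integral of a
  non-integrable function is \<open>0\<close> by convention.\<close>

definition mu_norm :: "'a measure \<Rightarrow> (real \<Rightarrow> 'a \<Rightarrow> real) \<Rightarrow> real" where
  "mu_norm M X = sqrt (\<integral>\<omega>. (\<integral>s. (X s \<omega>)\<^sup>2 \<partial>bridge_measure) \<partial>M)"

definition poly_coeff :: "(real \<Rightarrow> 'a \<Rightarrow> real) \<Rightarrow> real poly \<Rightarrow> 'a \<Rightarrow> real" where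
  "poly_coeff B p \<omega> = (LBINT t:{0..1}. B t \<omega> * (poly p t / (t * (1 - t))))"

definition mu_coeff :: "(real \<Rightarrow> 'a \<Rightarrow> real) \<Rightarrow> (real \<Rightarrow> real) \<Rightarrow> 'a \<Rightarrow> real" where
  "mu_coeff B f \<omega> = (\<integral>t. B t \<omega> * f t \<partial>bridge_measure)"

definition converges_in_L2 :: "'a measure \<Rightarrow> (nat \<Rightarrow> 'a \<Rightarrow> real) \<Rightarrow> ('a \<Rightarrow> real) \<Rightarrow> bool" where
  "converges_in_L2 M Y Z \<longleftrightarrow>
     (\<lambda>N. \<integral>\<^sup>+\<omega>. ennreal ((Y N \<omega> - Z \<omega>)\<^sup>2) \<partial>M) \<longlonglongrightarrow> 0"

end

theory Submission
  imports Defs "HOL-Real_Asymp.Real_Asymp"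
begin

text \<open>
  Write \<open>w(t) = t (1 - t)\<close> and \<open>K(s, t) = min s t - s t\<close>, so that \<open>d\<mu> = dt / w\<close> and \<open>K\<close> is the Green
  function of \<open>- d\<^sup>2/dt\<^sup>2\<close> with zero boundary values. The covariance operator of \<open>B\<close> on \<open>L\<^sup>2(\<mu>)\<close> maps
  \<open>w q\<close> to \<open>\<integral> K(s, \<cdot>) q(s) ds\<close>, hence \<open>e = w q\<close> is an eigenfunction for \<open>\<lambda>\<close> as soon as
  \<open>(w q)'' = - q / \<lambda>\<close>. On polynomials \<open>q \<mapsto> (w q)''\<close> is triangular with diagonal entries
  \<open>- k (k + 1)\<close>, which gives one polynomial eigenfunction \<open>e\<^sub>k\<close> of degree \<open>k + 1\<close> for every
  \<open>\<lambda>\<^sub>k = 1 / (k (k + 1))\<close> (\<open>pderiv_pderiv_eigenpoly\<close>, \<open>eigenpoly_kernel_integral\<close>). Distinct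
  eigenvalues make the \<open>e\<^sub>k\<close> orthogonal. They span \<open>w\<close> times all polynomials, and polynomials are
  dense in \<open>L\<^sup>2(w dt)\<close> (\<open>polynomials_dense\<close>), so they form an orthonormal basis of \<open>L\<^sup>2(\<mu>)\<close>.

  The coefficient \<open>I\<^sub>k = \<integral> B\<^sub>t q\<^sub>k(t) dt\<close>, with \<open>q\<^sub>k = e\<^sub>k / w\<close> a polynomial, satisfies
  \<open>E[B\<^sub>t I\<^sub>k] = \<lambda>\<^sub>k e\<^sub>k(t)\<close> and \<open>E[I\<^sub>j I\<^sub>k] = \<lambda>\<^sub>k \<delta>\<^sub>j\<^sub>k\<close> by Fubini. Finite linear combinations of the \<open>I\<^sub>k\<close>
  are pathwise limits of Riemann sums of the Gaussian process, so their characteristic functions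
  are Gaussian (\<open>char_weighted_integral\<close>), and the joint characteristic function of finitely many
  \<open>I\<^sub>k\<close> is the product of the individual ones. Independence follows by changing the measure one
  variable at a time and using uniqueness of one-dimensional characteristic functions
  (\<open>indep_vars_if_char_product\<close>).

  For the series, the mean square error \<open>R\<^sub>N(t) = w(t) - \<Sum>\<^bsub>k\<le>N\<^esub> \<lambda>\<^sub>k e\<^sub>k(t)\<^sup>2\<close> is the second moment of a
  remainder. Its \<open>\<mu>\<close>-integral is \<open>1 - \<Sum>\<^bsub>k\<le>N\<^esub> \<lambda>\<^sub>k = 1 / (N + 1)\<close>, since the eigenvalues telescope, and
  removing a projection cannot increase the increments of \<open>B\<close>, whence
  \<open>R\<^sub>N(t) \<le> 2 R\<^sub>N(s) + 2 \<bar>t - s\<bar>\<close>. Averaging over \<open>s\<close> near \<open>t\<close> gives \<open>R\<^sub>N(t) \<le> 4 / sqrt (N + 1)\<close>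
  (\<open>mean_square_error_bound\<close>).

  For optimality, Bessel's identity along the paths turns the squared error of an orthonormal
  family \<open>f\<^sub>1, \<dots>, f\<^sub>n\<close> into \<open>1 - \<Sum>\<^bsub>k\<le>n\<^esub> E[J\<^sub>k\<^sup>2]\<close> (\<open>truncation_error\<close>). It remains to see that
  \<open>\<Sum>\<^bsub>k\<le>n\<^esub> E[J\<^sub>k\<^sup>2] \<le> \<Sum>\<^bsub>k\<le>n\<^esub> \<lambda>\<^sub>k\<close>, which is Ky Fan's maximum principle: up to an error that vanishes with
  the remainder of the series, the left-hand side is \<open>\<Sum>\<^sub>j a\<^sub>j \<lambda>\<^sub>j\<close> with weights \<open>0 \<le> a\<^sub>j \<le> 1\<close> of total mass
  at most \<open>n\<close>, and such a sum is largest when the mass sits on the \<open>n\<close> largest eigenvalues.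
\<close>

section \<open>Square-integrable functions and Bessel's identity\<close>

lemma square_integrable_mult:
  assumes "square_integrable N f" "square_integrable N g"
  shows "integrable N (\<lambda>x. f x * g x)"
proof (rule Bochner_Integration.integrable_bound)
  show "integrable N (\<lambda>x. (f x)\<^sup>2 + (g x)\<^sup>2)"
    using assms by (auto simp: square_integrable_def)
  show "(\<lambda>x. f x * g x) \<in> borel_measurable N"
    using assms by (auto simp: square_integrable_def)
  have "\<bar>f x * g x\<bar> \<le> (f x)\<^sup>2 + (g x)\<^sup>2" for x
  proof -
    have "2 * \<bar>f x\<bar> * \<bar>g x\<bar> \<le> (f x)\<^sup>2 + (g x)\<^sup>2"
      using sum_squares_bound[of "\<bar>f x\<bar>" "\<bar>g x\<bar>"] by simp
    moreover have "0 \<le> \<bar>f x\<bar> * \<bar>g x\<bar>" by simp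
    ultimately show ?thesis unfolding abs_mult by linarith
  qed
  then show "AE x in N. norm (f x * g x) \<le> norm ((f x)\<^sup>2 + (g x)\<^sup>2)"
    by (intro AE_I2) simp
qed

lemma square_integrable_cmult:
  "square_integrable N f \<Longrightarrow> square_integrable N (\<lambda>x. c * f x)"
  by (auto simp: square_integrable_def power_mult_distrib)

lemma square_integrable_add:
  assumes "square_integrable N f" "square_integrable N g"
  shows "square_integrable N (\<lambda>x. f x + g x)"
  using assms square_integrable_mult[OF assms]
  by (auto simp: square_integrable_def power2_sum mult.assoc)

lemma square_integrable_diff:
  assumes "square_integrable N f" "square_integrable N g"
  shows "square_integrable N (\<lambda>x. f x - g x)"
  using square_integrable_add[OF assms(1) square_integrable_cmult[OF assms(2), of "-1"]] by simp

lemma square_integrable_sum: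
  assumes "\<And>k. k \<in> I \<Longrightarrow> square_integrable N (f k)"
  shows "square_integrable N (\<lambda>x. \<Sum>k\<in>I. f k x)"
  using assms
  by (induction I rule: infinite_finite_induct)
     (simp_all add: square_integrable_add, simp_all add: square_integrable_def)

lemma square_integrable_bound:
  assumes f: "square_integrable N f" and h: "h \<in> borel_measurable N"
    and le: "AE x in N. \<bar>h x\<bar> \<le> \<bar>f x\<bar>"
  shows "square_integrable N h"
  unfolding square_integrable_def
proof
  show "integrable N (\<lambda>x. (h x)\<^sup>2)"
  proof (rule Bochner_Integration.integrable_bound)
    show "integrable N (\<lambda>x. (f x)\<^sup>2)" using f by (simp add: square_integrable_def)
    show "(\<lambda>x. (h x)\<^sup>2) \<in> borel_measurable N" by (rule borel_measurable_power[OF h])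
    show "AE x in N. norm ((h x)\<^sup>2) \<le> norm ((f x)\<^sup>2)"
      using le by eventually_elim (simp add: abs_le_square_iff)
  qed
qed (rule h)

text \<open>
  A form of Minkowski's inequality for squared norms, sharp enough wherever only smallness matters.
\<close>

lemma square_integral_add_le:
  assumes "square_integrable N f" "square_integrable N g"
  shows "(\<integral>x. (f x + g x)\<^sup>2 \<partial>N) \<le> 2 * (\<integral>x. (f x)\<^sup>2 \<partial>N) + 2 * (\<integral>x. (g x)\<^sup>2 \<partial>N)"
proof -
  have i: "integrable N (\<lambda>x. (f x)\<^sup>2)" "integrable N (\<lambda>x. (g x)\<^sup>2)"
    using assms by (auto simp: square_integrable_def)
  have "(\<integral>x. (f x + g x)\<^sup>2 \<partial>N) \<le> (\<integral>x. 2 * (f x)\<^sup>2 + 2 * (g x)\<^sup>2 \<partial>N)"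
  proof (rule integral_mono)
    show "integrable N (\<lambda>x. (f x + g x)\<^sup>2)"
      using square_integrable_add[OF assms] by (simp add: square_integrable_def)
    show "(f x + g x)\<^sup>2 \<le> 2 * (f x)\<^sup>2 + 2 * (g x)\<^sup>2" for x
      using zero_le_power2[of "f x - g x"] by (simp add: power2_eq_square algebra_simps)
  qed (use i in simp)
  then show ?thesis using i by simp
qed

text \<open>
  The index set is a parameter because Bessel's identity is used for finite families, for single
  unit vectors and for the whole system of eigenfunctions.
\<close>

definition orthonormal_on :: "'b measure \<Rightarrow> nat set \<Rightarrow> (nat \<Rightarrow> 'b \<Rightarrow> real) \<Rightarrow> bool" where
  "orthonormal_on N I f \<longleftrightarrow> (\<forall>k\<in>I. square_integrable N (f k)) \<and>
     (\<forall>i\<in>I. \<forall>j\<in>I. (\<integral>x. f i x * f j x \<partial>N) = (if i = j then 1 else 0))"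

lemma orthonormal_basis_imp_orthonormal_on:
  "orthonormal_basis N f \<Longrightarrow> I \<subseteq> {1..} \<Longrightarrow> orthonormal_on N I f"
  by (auto simp: orthonormal_basis_def orthonormal_on_def subset_iff)

text \<open>
  Expanding the square, the cross terms contribute \<open>- 2 \<Sum> c\<^sub>k\<^sup>2\<close> and, by orthonormality, the double sum
  contributes \<open>\<Sum> c\<^sub>k\<^sup>2\<close>.
\<close>

lemma Bessel_identity:
  assumes I: "finite I" "orthonormal_on N I f" and g: "square_integrable N g"
  shows "(\<integral>x. (g x - (\<Sum>k\<in>I. (\<integral>y. g y * f k y \<partial>N) * f k x))\<^sup>2 \<partial>N)
     = (\<integral>x. (g x)\<^sup>2 \<partial>N) - (\<Sum>k\<in>I. (\<integral>y. g y * f k y \<partial>N)\<^sup>2)"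
proof -
  define c where "c k = (\<integral>y. g y * f k y \<partial>N)" for k
  have f: "square_integrable N (f k)" if "k \<in> I" for k
    using I that by (auto simp: orthonormal_on_def)
  have gf: "integrable N (\<lambda>x. g x * f k x)" if "k \<in> I" for k
    by (rule square_integrable_mult[OF g f[OF that]])
  have ff: "integrable N (\<lambda>x. f k x * f j x)" if "k \<in> I" "j \<in> I" for k j
    by (rule square_integrable_mult[OF f f]) (use that in auto)
  have gg: "integrable N (\<lambda>x. (g x)\<^sup>2)"
    using g by (simp add: square_integrable_def)
  have "(\<integral>x. (g x - (\<Sum>k\<in>I. c k * f k x))\<^sup>2 \<partial>N)
    = (\<integral>x. (g x)\<^sup>2 - 2 * (\<Sum>k\<in>I. c k * (g x * f k x))
          + (\<Sum>k\<in>I. \<Sum>j\<in>I. c k * c j * (f k x * f j x)) \<partial>N)"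
    by (intro Bochner_Integration.integral_cong refl)
       (simp add: power2_diff power2_eq_square sum_product sum_distrib_left sum_distrib_right algebra_simps)
  also have "\<dots> = (\<integral>x. (g x)\<^sup>2 \<partial>N) - 2 * (\<Sum>k\<in>I. c k * c k)
      + (\<Sum>k\<in>I. \<Sum>j\<in>I. c k * c j * (\<integral>x. f k x * f j x \<partial>N))"
    using gf ff gg by (simp add: c_def)
  also have "(\<Sum>k\<in>I. \<Sum>j\<in>I. c k * c j * (\<integral>x. f k x * f j x \<partial>N)) = (\<Sum>k\<in>I. c k * c k)"
  proof (rule sum.cong[OF refl])
    fix k assume k: "k \<in> I"
    have "(\<Sum>j\<in>I. c k * c j * (\<integral>x. f k x * f j x \<partial>N)) = (\<Sum>j\<in>I. if k = j then c k * c j else 0)"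
      using I k by (intro sum.cong refl) (auto simp: orthonormal_on_def)
    then show "(\<Sum>j\<in>I. c k * c j * (\<integral>x. f k x * f j x \<partial>N)) = c k * c k"
      using I k by simp
  qed
  finally show ?thesis by (simp add: c_def power2_eq_square)
qed

lemma Bessel_inequality:
  assumes "finite I" "orthonormal_on N I f" and "square_integrable N g"
  shows "(\<Sum>k\<in>I. (\<integral>y. g y * f k y \<partial>N)\<^sup>2) \<le> (\<integral>x. (g x)\<^sup>2 \<partial>N)"
proof -
  have "0 \<le> (\<integral>x. (g x - (\<Sum>k\<in>I. (\<integral>y. g y * f k y \<partial>N) * f k x))\<^sup>2 \<partial>N)"
    by (rule Bochner_Integration.integral_nonneg) simp
  then show ?thesis unfolding Bessel_identity[OF assms] by simp
qed

section \<open>Integration against the bridge measure\<close>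

text \<open>
  Integrals of paths against polynomials live here rather than on \<open>bridge_measure\<close>, which has
  infinite mass near the end points and does not integrate all continuous functions.
\<close>

abbreviation unit_lebesgue :: "real measure" where
  "unit_lebesgue \<equiv> restrict_space lborel {0..1}"

lemma prob_space_unit_lebesgue: "prob_space unit_lebesgue"
  by (rule prob_spaceI) (simp add: emeasure_restrict_space space_restrict_space)

interpretation unit_lebesgue: prob_space unit_lebesgue
  by (rule prob_space_unit_lebesgue)

lemma space_unit_lebesgue: "space unit_lebesgue = {0..1}"
  by (simp add: space_restrict_space)

lemma borel_measurable_unit_lebesgueI:
  "f \<in> borel_measurable borel \<Longrightarrow> f \<in> borel_measurable unit_lebesgue"
  by (rule measurable_restrict_space1) simp

lemma continuous_on_measurable_unit_lebesgue:
  "continuous_on {0..1} (f :: real \<Rightarrow> real) \<Longrightarrow> f \<in> borel_measurable unit_lebesgue"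
  using borel_measurable_continuous_on_restrict[of "{0..1}" f]
  by (simp cong: measurable_cong_sets add: sets_restrict_space)

lemma continuous_on_integrable_unit_lebesgue:
  fixes f :: "real \<Rightarrow> real"
  assumes "continuous_on {0..1} f"
  shows "integrable unit_lebesgue f"
proof -
  have "bounded (f ` {0..1})"
    by (rule compact_imp_bounded[OF compact_continuous_image[OF assms]]) simp
  then obtain C where "\<And>x. x \<in> {0..1} \<Longrightarrow> norm (f x) \<le> C"
    unfolding bounded_iff by blast
  then show ?thesis
    by (intro unit_lebesgue.integrable_const_bound[of _ C] AE_I2
        continuous_on_measurable_unit_lebesgue assms) (auto simp: space_unit_lebesgue)
qed

lemma poly_bounded_unit: "\<exists>C. \<forall>t\<in>{0..1}. \<bar>poly r t\<bar> \<le> C" for r :: "real poly"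
proof -
  have "bounded (poly r ` {0..1})"
    by (rule compact_imp_bounded[OF compact_continuous_image]) (auto intro!: continuous_intros)
  then show ?thesis unfolding bounded_iff by auto
qed

lemma AE_unit_lebesgue_interior: "AE x in unit_lebesgue. 0 < x \<and> x < 1"
proof -
  have "AE x in lborel. x \<noteq> (0::real) \<and> x \<noteq> 1"
    using AE_lborel_singleton[of "0::real"] AE_lborel_singleton[of "1::real"] by eventually_elim auto
  then have "AE x in lborel. x \<in> {0..1::real} \<longrightarrow> 0 < x \<and> x < 1"
    by eventually_elim (auto simp: less_le)
  then show ?thesis by (subst AE_restrict_space_iff) simp_all
qed

lemma integral_unit_lebesgue: "(\<integral>x. f x \<partial>unit_lebesgue) = (\<integral>x. f x * indicator {0..1} x \<partial>lborel)"
  for f :: "real \<Rightarrow> real"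
  by (subst integral_restrict_space) (auto simp: mult.commute)

lemma space_bridge_measure: "space bridge_measure = {0..1}"
  by (simp add: bridge_measure_def space_restrict_space)

lemma measurable_bridge_measure: "f \<in> borel_measurable bridge_measure \<longleftrightarrow> f \<in> borel_measurable unit_lebesgue"
  unfolding bridge_measure_def by simp

lemma bridge_density_measurable:
  "(\<lambda>x::real. 1 / (x * (1 - x))) \<in> borel_measurable unit_lebesgue"
  by (rule borel_measurable_unit_lebesgueI) measurable

lemma integral_bridge_measure:
  fixes h :: "real \<Rightarrow> real"
  assumes "h \<in> borel_measurable unit_lebesgue"
  shows "(\<integral>x. h x \<partial>bridge_measure) = (\<integral>x. h x / (x * (1 - x)) \<partial>unit_lebesgue)"
    and "integrable bridge_measure h \<longleftrightarrow> integrable unit_lebesgue (\<lambda>x. h x / (x * (1 - x)))"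
proof -
  have 1: "AE x in unit_lebesgue. 0 \<le> 1 / (x * (1 - x))"
    by (rule AE_I2) (auto simp: space_unit_lebesgue)
  show "(\<integral>x. h x \<partial>bridge_measure) = (\<integral>x. h x / (x * (1 - x)) \<partial>unit_lebesgue)"
    unfolding bridge_measure_def
    by (subst integral_density[OF assms bridge_density_measurable 1]) simp
  show "integrable bridge_measure h \<longleftrightarrow> integrable unit_lebesgue (\<lambda>x. h x / (x * (1 - x)))"
    unfolding bridge_measure_def
    by (subst integrable_density[OF assms bridge_density_measurable 1]) simp
qed

text \<open>
  The weight cancels the density. Division by zero spoils the cancellation at the end points, hence
  the equality of integrands holds only almost everywhere.
\<close>

lemma integral_bridge_measure_weight:
  fixes h :: "real \<Rightarrow> real"
  assumes h: "h \<in> borel_measurable unit_lebesgue"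
  shows "(\<integral>x. x * (1 - x) * h x \<partial>bridge_measure) = (\<integral>x. h x \<partial>unit_lebesgue)"
    and "integrable bridge_measure (\<lambda>x. x * (1 - x) * h x) \<longleftrightarrow> integrable unit_lebesgue h"
proof -
  have m: "(\<lambda>x. x * (1 - x) * h x) \<in> borel_measurable unit_lebesgue"
    by (intro borel_measurable_times h borel_measurable_unit_lebesgueI) measurable
  have ae: "AE x in unit_lebesgue. x * (1 - x) * h x / (x * (1 - x)) = h x"
    using AE_unit_lebesgue_interior by eventually_elim auto
  have m2: "(\<lambda>x. x * (1 - x) * h x / (x * (1 - x))) \<in> borel_measurable unit_lebesgue"
    using m bridge_density_measurable borel_measurable_times by (fastforce simp: divide_inverse)
  show "(\<integral>x. x * (1 - x) * h x \<partial>bridge_measure) = (\<integral>x. h x \<partial>unit_lebesgue)"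
    unfolding integral_bridge_measure(1)[OF m] by (rule integral_cong_AE[OF m2 h ae])
  show "integrable bridge_measure (\<lambda>x. x * (1 - x) * h x) \<longleftrightarrow> integrable unit_lebesgue h"
    unfolding integral_bridge_measure(2)[OF m] by (rule integrable_cong_AE[OF m2 h ae])
qed

lemma sigma_finite_bridge_measure: "sigma_finite_measure bridge_measure"
proof -
  have m: "(\<lambda>x::real. ennreal (1 / (x * (1 - x)))) \<in> borel_measurable unit_lebesgue"
    using bridge_density_measurable by simp
  have "sigma_finite_measure unit_lebesgue"
    by (rule finite_measure.axioms) (rule unit_lebesgue.finite_measure_axioms)
  then show ?thesis unfolding bridge_measure_def
    by (subst sigma_finite_measure.sigma_finite_iff_density_finite[OF _ m]) auto
qed

interpretation bridge_measure: sigma_finite_measure bridge_measure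
  by (rule sigma_finite_bridge_measure)

section \<open>The polynomial eigenfunctions\<close>

definition bridge_kernel :: "real \<Rightarrow> real \<Rightarrow> real" where
  "bridge_kernel s t = min s t - s * t"

definition bridge_weight :: "real poly" where
  "bridge_weight = [:0, 1, -1:]"

lemma poly_bridge_weight [simp]: "poly bridge_weight x = x * (1 - x)"
  by (simp add: bridge_weight_def algebra_simps)

definition eigenvalue :: "nat \<Rightarrow> real" where
  "eigenvalue k = 1 / (real k * (real k + 1))"

lemma eigenvalue_pos: "k \<ge> 1 \<Longrightarrow> 0 < eigenvalue k"
  by (simp add: eigenvalue_def)

lemma eigenvalue_antimono: "1 \<le> i \<Longrightarrow> i \<le> j \<Longrightarrow> eigenvalue j \<le> eigenvalue i"
  unfolding eigenvalue_def by (intro divide_left_mono mult_mono) auto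

lemma eigenvalue_inj:
  assumes "1 \<le> i" "1 \<le> j" "eigenvalue i = eigenvalue j"
  shows "i = j"
proof -
  have "real i * (real i + 1) = real j * (real j + 1)"
    using assms by (simp add: eigenvalue_def field_simps)
  then have "(real i - real j) * (real i + real j + 1) = 0" by (simp add: algebra_simps)
  moreover have "real i + real j + 1 \<noteq> 0" by linarith
  ultimately show ?thesis by simp
qed

text \<open>
  Telescoping with \<open>1 / (k (k + 1)) = 1 / k - 1 / (k + 1)\<close>. The limit 1 is the trace of the covariance
  operator, see \<open>expectation_path_norm\<close>.
\<close>

lemma sum_eigenvalue: "(\<Sum>k=1..n. eigenvalue k) = 1 - 1 / (real n + 1)"
proof (induction n)
  case (Suc n)
  have "eigenvalue (Suc n) = 1 / (real n + 1) - 1 / (real n + 2)"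
    by (simp add: eigenvalue_def field_simps)
  then show ?case using Suc by (simp add: add_ac)
qed simp

text \<open>
  Comparing coefficients of \<open>t\<^sup>m\<close> in \<open>(t (1 - t) q)'' = - k (k + 1) q\<close> gives
  \<open>(m + 1) (m + 2) (c\<^sub>m\<^sub>+\<^sub>1 - c\<^sub>m) = - k (k + 1) c\<^sub>m\<close>. The solution with \<open>c\<^sub>0 = 1\<close> breaks off exactly after
  \<open>m = k - 1\<close>. The resulting polynomials are multiples of shifted Jacobi polynomials with both
  parameters equal to 1.
\<close>

fun eigenpoly_coeff :: "nat \<Rightarrow> nat \<Rightarrow> real" where
  "eigenpoly_coeff k 0 = 1"
| "eigenpoly_coeff k (Suc m) =
     eigenpoly_coeff k m * (1 - real k * (real k + 1) / ((real m + 1) * (real m + 2)))"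

lemma eigenpoly_coeff_nonzero: "m < k \<Longrightarrow> eigenpoly_coeff k m \<noteq> 0"
proof (induction m)
  case (Suc m)
  have "(real m + 1) * (real m + 2) < real k * (real k + 1)"
    using Suc.prems by (intro mult_strict_mono) auto
  then have "1 - real k * (real k + 1) / ((real m + 1) * (real m + 2)) \<noteq> 0"
    by (simp add: field_simps)
  then show ?case using Suc by simp
qed simp

lemma eigenpoly_coeff_eq_0:
  assumes "1 \<le> k" "k \<le> m" shows "eigenpoly_coeff k m = 0"
  using assms(2)
proof (induction rule: dec_induct)
  case base
  obtain l where l: "k = Suc l" using assms(1) by (cases k) auto
  have "1 - real k * (real k + 1) / ((real l + 1) * (real l + 2)) = 0"
    unfolding l by (simp add: add.commute)
  then have "eigenpoly_coeff k (Suc l) = 0" by (simp only: eigenpoly_coeff.simps mult_zero_right)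
  then show ?case by (simp add: l)
qed simp

definition eigenpoly :: "nat \<Rightarrow> real poly" where
  "eigenpoly k = Poly (map (eigenpoly_coeff k) [0..<k])"

lemma coeff_eigenpoly: "1 \<le> k \<Longrightarrow> coeff (eigenpoly k) m = eigenpoly_coeff k m"
  by (auto simp: eigenpoly_def coeff_Poly_eq nth_default_def eigenpoly_coeff_eq_0)

lemma degree_eigenpoly:
  assumes "1 \<le> k" shows "degree (eigenpoly k) = k - 1"
proof (rule antisym)
  show "degree (eigenpoly k) \<le> k - 1"
    by (rule degree_le) (use assms in \<open>auto simp: coeff_eigenpoly eigenpoly_coeff_eq_0\<close>)
  show "k - 1 \<le> degree (eigenpoly k)"
    by (rule le_degree) (use assms in \<open>auto simp: coeff_eigenpoly eigenpoly_coeff_nonzero\<close>)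
qed

lemma eigenpoly_nonzero: "1 \<le> k \<Longrightarrow> eigenpoly k \<noteq> 0"
  using coeff_eigenpoly[of k 0] by (metis coeff_0 eigenpoly_coeff.simps(1) zero_neq_one)

text \<open>
  This is the coefficient recursion read backwards; it also covers the coefficients beyond the
  degree, since they vanish from index \<open>k\<close> on.
\<close>

lemma pderiv_pderiv_eigenpoly:
  assumes k: "1 \<le> k"
  shows "pderiv (pderiv (bridge_weight * eigenpoly k)) = smult (- (real k * (real k + 1))) (eigenpoly k)"
proof (rule poly_eqI)
  fix m
  let ?c = "eigenpoly_coeff k"
  have w: "bridge_weight * q = pCons 0 q - pCons 0 (pCons 0 q)" for q :: "real poly"
    by (simp add: bridge_weight_def)
  have "coeff (pderiv (pderiv (bridge_weight * eigenpoly k))) m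
      = (real m + 1) * (real m + 2) * (?c (Suc m) - ?c m)"
    by (simp add: w coeff_pderiv coeff_eigenpoly[OF k] algebra_simps del: eigenpoly_coeff.simps)
  also have "\<dots> = - (real k * (real k + 1)) * ?c m"
  proof -
    have "(real m + 1) * (real m + 2) \<noteq> 0" by (metis add_pos_pos mult_pos_pos of_nat_0_le_iff add_nonneg_pos zero_less_one zero_less_numeral less_irrefl)
    moreover have "A * (c * (1 - K / A) - c) = - K * c" if "A \<noteq> 0" for A c K :: real
      using that by (simp add: field_simps)
    ultimately show ?thesis unfolding eigenpoly_coeff.simps by blast
  qed
  finally show "coeff (pderiv (pderiv (bridge_weight * eigenpoly k))) m
      = coeff (smult (- (real k * (real k + 1))) (eigenpoly k)) m"
    by (simp add: coeff_eigenpoly[OF k])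
qed

lemma eigenpoly_eq_second_derivative:
  assumes k: "1 \<le> k"
  shows "poly (eigenpoly k) x
    = - eigenvalue k * poly (pderiv (pderiv (bridge_weight * eigenpoly k))) x"
  using k by (simp add: pderiv_pderiv_eigenpoly eigenvalue_def)

lemma borel_measurable_poly [measurable]: "poly p \<in> borel_measurable borel" for p :: "real poly"
  by (intro borel_measurable_continuous_onI continuous_intros)

lemma integral_pderiv:
  fixes p :: "real poly" assumes "a \<le> b"
  shows "(\<integral>x. poly (pderiv p) x * indicator {a..b} x \<partial>lborel) = poly p b - poly p a"
  by (rule integral_FTC_Icc_real[OF assms]) auto

lemma poly_integrable_interval:
  "integrable lborel (\<lambda>x. poly p x * indicator {a..b} x)" for p :: "real poly"
  using borel_integrable_atLeastAtMost'[of a b "poly p"]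
  by (simp add: set_integrable_def mult.commute continuous_on_poly)

text \<open>
  The kernel is the Green function of \<open>- d\<^sup>2/ds\<^sup>2\<close> with zero boundary values. Explicitly, with
  \<open>q = - \<lambda> e''\<close>, the integrand has the antiderivatives \<open>- \<lambda> (1 - t) (s e' - e)\<close> on \<open>[0, t]\<close> and
  \<open>- \<lambda> t ((1 - s) e' + e)\<close> on \<open>[t, 1]\<close>; the terms with \<open>e'(t)\<close> cancel and \<open>e\<close> vanishes at 0 and 1.
\<close>

lemma eigenpoly_kernel_integral:
  assumes k: "1 \<le> k" and t: "t \<in> {0..1}"
  shows "(\<integral>s. bridge_kernel s t * poly (eigenpoly k) s \<partial>unit_lebesgue)
    = eigenvalue k * (t * (1 - t) * poly (eigenpoly k) t)"
proof -
  define e where "e = bridge_weight * eigenpoly k"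
  define A where "A = smult (- eigenvalue k * (1 - t)) ([:0, 1:] * pderiv e - e)"
  define C where "C = smult (- eigenvalue k * t) ([:1, -1:] * pderiv e + e)"
  have q: "poly (eigenpoly k) s = - eigenvalue k * poly (pderiv (pderiv e)) s" for s
    unfolding e_def by (rule eigenpoly_eq_second_derivative[OF k])
  have dA: "poly (pderiv A) s = s * (1 - t) * poly (eigenpoly k) s" for s
    unfolding A_def q pderiv_smult pderiv_diff pderiv_mult
    by (simp add: pderiv_pCons algebra_simps)
  have dC: "poly (pderiv C) s = (1 - s) * t * poly (eigenpoly k) s" for s
    unfolding C_def q pderiv_smult pderiv_add pderiv_mult
    by (simp add: pderiv_pCons algebra_simps)
  have "(\<integral>s. bridge_kernel s t * poly (eigenpoly k) s \<partial>unit_lebesgue)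
     = (\<integral>s. poly (pderiv A) s * indicator {0..t} s + poly (pderiv C) s * indicator {t..1} s \<partial>lborel)"
    unfolding integral_unit_lebesgue
  proof (rule integral_cong_AE)
    show "(\<lambda>s. bridge_kernel s t * poly (eigenpoly k) s * indicator {0..1} s) \<in> borel_measurable lborel"
      unfolding bridge_kernel_def by measurable
    show "AE s in lborel. bridge_kernel s t * poly (eigenpoly k) s * indicator {0..1} s
       = poly (pderiv A) s * indicator {0..t} s + poly (pderiv C) s * indicator {t..1} s"
      using AE_lborel_singleton[of t]
    proof eventually_elim
      case (elim s)
      then show ?case using t unfolding dA dC
        by (auto simp: bridge_kernel_def indicator_def min_def algebra_simps)
    qed
  qed measurable
  also have "\<dots> = poly A t - poly A 0 + (poly C 1 - poly C t)"
    using t by (simp add: poly_integrable_interval integral_pderiv)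
  also have "\<dots> = eigenvalue k * poly e t"
    by (simp add: A_def C_def e_def algebra_simps)
  finally show ?thesis by (simp add: e_def)
qed

text \<open>
  Self-adjointness of the second derivative: the Wronskian of the two eigenfunctions vanishes at
  both end points, and its derivative is the integrand times the difference of the inverse
  eigenvalues.
\<close>

lemma eigenpoly_orthogonal:
  assumes i: "1 \<le> i" and j: "1 \<le> j" and ij: "i \<noteq> j"
  shows "(\<integral>x. x * (1 - x) * poly (eigenpoly i) x * poly (eigenpoly j) x \<partial>unit_lebesgue) = 0"
proof -
  define d where "d k = bridge_weight * eigenpoly k" for k
  \<comment> \<open>the Wronskian\<close>
  define W where "W = d i * pderiv (d j) - d j * pderiv (d i)"
  define c where "c = real i * (real i + 1) - real j * (real j + 1)"
  have c: "c \<noteq> 0"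
    using eigenvalue_inj[OF i j] ij by (auto simp: c_def eigenvalue_def)
  have dd: "poly (pderiv (pderiv (d k))) x = - (real k * (real k + 1)) * poly (eigenpoly k) x"
    if "1 \<le> k" for k x
    using that by (simp add: d_def pderiv_pderiv_eigenpoly)
  have dW: "poly (pderiv W) x = c * (x * (1 - x) * poly (eigenpoly i) x * poly (eigenpoly j) x)" for x
  proof -
    have "poly (pderiv W) x
      = poly (d i) x * poly (pderiv (pderiv (d j))) x - poly (d j) x * poly (pderiv (pderiv (d i))) x"
      unfolding W_def pderiv_diff pderiv_mult by (simp add: algebra_simps)
    also have "\<dots> = c * (x * (1 - x) * poly (eigenpoly i) x * poly (eigenpoly j) x)"
      unfolding dd[OF i] dd[OF j] by (simp add: d_def c_def algebra_simps)
    finally show ?thesis .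
  qed
  have "c * (\<integral>x. x * (1 - x) * poly (eigenpoly i) x * poly (eigenpoly j) x \<partial>unit_lebesgue)
     = (\<integral>x. poly (pderiv W) x * indicator {0..1} x \<partial>lborel)"
    unfolding dW integral_unit_lebesgue by (simp add: mult.assoc)
  also have "\<dots> = 0" by (simp add: integral_pderiv) (simp add: W_def d_def)
  finally show ?thesis using c by simp
qed

lemma eigenpoly_norm_pos:
  assumes k: "1 \<le> k"
  shows "0 < (\<integral>x. x * (1 - x) * (poly (eigenpoly k) x)\<^sup>2 \<partial>unit_lebesgue)"
proof -
  let ?h = "\<lambda>x. x * (1 - x) * (poly (eigenpoly k) x)\<^sup>2"
  have int: "integrable unit_lebesgue ?h"
    by (rule continuous_on_integrable_unit_lebesgue) (intro continuous_intros)
  have nn: "AE x in unit_lebesgue. 0 \<le> ?h x"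
    by (rule AE_I2) (auto simp: space_unit_lebesgue)
  have "finite {x. poly (eigenpoly k) x = 0}"
    by (rule poly_roots_finite[OF eigenpoly_nonzero[OF k]])
  then have "AE x in lborel. x \<notin> {x. poly (eigenpoly k) x = 0}"
    by (intro AE_not_in finite_imp_null_set_lborel)
  then have "AE x in lborel. poly (eigenpoly k) x \<noteq> 0" by simp
  then have ne: "AE x in unit_lebesgue. poly (eigenpoly k) x \<noteq> 0"
    by (subst AE_restrict_space_iff) auto
  have "(\<integral>x. ?h x \<partial>unit_lebesgue) \<noteq> 0"
  proof
    assume "(\<integral>x. ?h x \<partial>unit_lebesgue) = 0"
    then have "AE x in unit_lebesgue. ?h x = 0"
      by (subst (asm) integral_nonneg_eq_0_iff_AE[OF int nn])
    then have "AE x in unit_lebesgue. False"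
      using ne AE_unit_lebesgue_interior by eventually_elim auto
    then show False using unit_lebesgue.AE_False by simp
  qed
  moreover have "0 \<le> (\<integral>x. ?h x \<partial>unit_lebesgue)"
    by (rule integral_nonneg_AE[OF nn])
  ultimately show ?thesis by linarith
qed

definition normed_eigenpoly :: "nat \<Rightarrow> real poly" where
  "normed_eigenpoly k = smult (1 / sqrt (\<integral>x. x * (1 - x) * (poly (eigenpoly k) x)\<^sup>2 \<partial>unit_lebesgue)) (eigenpoly k)"

definition eigenfunction :: "nat \<Rightarrow> real poly" where
  "eigenfunction k = bridge_weight * normed_eigenpoly k"

lemma poly_eigenfunction:
  "poly (eigenfunction k) t = t * (1 - t) * poly (normed_eigenpoly k) t"
  by (simp add: eigenfunction_def)

lemma degree_normed_eigenpoly: "1 \<le> k \<Longrightarrow> degree (normed_eigenpoly k) = k - 1"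
  using eigenpoly_norm_pos[of k] by (simp add: normed_eigenpoly_def degree_eigenpoly)

lemma normed_eigenpoly_nonzero: "1 \<le> k \<Longrightarrow> normed_eigenpoly k \<noteq> 0"
  using eigenpoly_norm_pos[of k] by (simp add: normed_eigenpoly_def eigenpoly_nonzero)

lemma degree_eigenfunction:
  assumes "1 \<le> k" shows "degree (eigenfunction k) = k + 1"
  unfolding eigenfunction_def using assms
  by (subst degree_mult_eq) (auto simp: normed_eigenpoly_nonzero degree_normed_eigenpoly bridge_weight_def)

lemma normed_eigenpoly_kernel_integral:
  assumes k: "1 \<le> k" and t: "t \<in> {0..1}"
  shows "(\<integral>s. bridge_kernel s t * poly (normed_eigenpoly k) s \<partial>unit_lebesgue)
    = eigenvalue k * poly (eigenfunction k) t"
proof -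
  define c where "c = 1 / sqrt (\<integral>x. x * (1 - x) * (poly (eigenpoly k) x)\<^sup>2 \<partial>unit_lebesgue)"
  have "(\<integral>s. bridge_kernel s t * poly (normed_eigenpoly k) s \<partial>unit_lebesgue)
    = (\<integral>s. c * (bridge_kernel s t * poly (eigenpoly k) s) \<partial>unit_lebesgue)"
    by (simp add: normed_eigenpoly_def c_def mult.left_commute)
  also have "\<dots> = c * (eigenvalue k * (t * (1 - t) * poly (eigenpoly k) t))"
    unfolding eigenpoly_kernel_integral[OF assms, symmetric] by (rule integral_mult_right_zero)
  also have "\<dots> = eigenvalue k * poly (eigenfunction k) t"
    by (simp add: normed_eigenpoly_def eigenfunction_def flip: c_def)
  finally show ?thesis .
qed

lemma integral_eigenfunction_normed_eigenpoly:
  assumes i: "1 \<le> i" and j: "1 \<le> j"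
  shows "(\<integral>x. poly (eigenfunction i) x * poly (normed_eigenpoly j) x \<partial>unit_lebesgue)
     = (if i = j then 1 else 0)"
proof -
  define n where "n k = (\<integral>x. x * (1 - x) * (poly (eigenpoly k) x)\<^sup>2 \<partial>unit_lebesgue)" for k
  have "(\<integral>x. poly (eigenfunction i) x * poly (normed_eigenpoly j) x \<partial>unit_lebesgue)
    = (\<integral>x. 1 / sqrt (n i) * (1 / sqrt (n j)) *
         (x * (1 - x) * poly (eigenpoly i) x * poly (eigenpoly j) x) \<partial>unit_lebesgue)"
    by (intro Bochner_Integration.integral_cong refl)
       (simp add: eigenfunction_def normed_eigenpoly_def n_def)
  also have "\<dots> = 1 / sqrt (n i) * (1 / sqrt (n j)) *
       (\<integral>x. x * (1 - x) * poly (eigenpoly i) x * poly (eigenpoly j) x \<partial>unit_lebesgue)"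
    by (rule integral_mult_right_zero)
  also have "\<dots> = (if i = j then 1 else 0)"
    using eigenpoly_orthogonal[OF i j] eigenpoly_norm_pos[OF i]
    by (auto simp: n_def power2_eq_square mult.assoc)
  finally show ?thesis .
qed

lemma orthonormal_eigenfunction:
  "orthonormal_on bridge_measure {1..} (\<lambda>k. poly (eigenfunction k))"
  unfolding orthonormal_on_def
proof (intro conjI ballI)
  have eq: "poly (eigenfunction i) x * poly (eigenfunction j) x
    = x * (1 - x) * (poly (eigenfunction i) x * poly (normed_eigenpoly j) x)" for i j x
    by (simp add: eigenfunction_def)
  have c: "continuous_on {0..1} (\<lambda>x. poly (eigenfunction i) x * poly (normed_eigenpoly j) x)" for i j
    by (intro continuous_intros)
  have m: "(\<lambda>x. poly (eigenfunction i) x * poly (normed_eigenpoly j) x) \<in> borel_measurable unit_lebesgue" for i j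
    by (rule continuous_on_measurable_unit_lebesgue[OF c])
  show "square_integrable bridge_measure (poly (eigenfunction k))" for k
    unfolding square_integrable_def measurable_bridge_measure power2_eq_square eq
      integral_bridge_measure_weight(2)[OF m]
    by (intro conjI continuous_on_measurable_unit_lebesgue continuous_on_integrable_unit_lebesgue c continuous_intros)
  show "(\<integral>x. poly (eigenfunction i) x * poly (eigenfunction j) x \<partial>bridge_measure)
     = (if i = j then 1 else 0)" if "i \<in> {1..}" "j \<in> {1..}" for i j
    unfolding eq integral_bridge_measure_weight(1)[OF m]
    using that by (intro integral_eigenfunction_normed_eigenpoly) auto
qed

section \<open>Density of polynomials\<close>

definition poly_approximable :: "real measure \<Rightarrow> (real \<Rightarrow> real) \<Rightarrow> bool" where
  "poly_approximable N f \<longleftrightarrow> square_integrable N f \<and>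
     (\<forall>\<epsilon>>0. \<exists>p. (\<integral>x. (f x - poly p x)\<^sup>2 \<partial>N) < \<epsilon>)"

locale finite_unit_interval_measure = finite_measure N for N :: "real measure" +
  assumes sets_eq [measurable_cong, simp]: "sets N = sets borel"
    and AE_unit: "AE x in N. x \<in> {0..1}"
begin

lemma square_integrable_bounded:
  assumes [measurable]: "f \<in> borel_measurable borel" and "\<And>x. x \<in> {0..1} \<Longrightarrow> \<bar>f x\<bar> \<le> C"
  shows "square_integrable N f"
  unfolding square_integrable_def
proof
  show "integrable N (\<lambda>x. (f x)\<^sup>2)"
  proof (rule integrable_const_bound)
    show "AE x in N. norm ((f x)\<^sup>2) \<le> C\<^sup>2"
      using AE_unit
    proof eventually_elim
      case (elim x)
      then show ?case using power_mono[OF assms(2)[OF elim], of 2] by simp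
    qed
  qed measurable
qed measurable

lemma square_integrable_poly: "square_integrable N (poly p)"
proof -
  obtain C where "\<forall>t\<in>{0..1}. \<bar>poly p t\<bar> \<le> C" using poly_bounded_unit by blast
  then show ?thesis by (intro square_integrable_bounded[of _ C]) auto
qed

lemma poly_approximable_limit:
  assumes f: "square_integrable N f" and g: "\<And>i. poly_approximable N (g i)"
    and lim: "(\<lambda>i. \<integral>x. (f x - g i x)\<^sup>2 \<partial>N) \<longlonglongrightarrow> 0"
  shows "poly_approximable N f"
  unfolding poly_approximable_def
proof (intro conjI allI impI f)
  fix \<epsilon> :: real assume e: "0 < \<epsilon>"
  then have "\<forall>\<^sub>F i in sequentially. (\<integral>x. (f x - g i x)\<^sup>2 \<partial>N) < \<epsilon> / 4"
    by (intro order_tendstoD(2)[OF lim]) simp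
  then obtain i where i: "(\<integral>x. (f x - g i x)\<^sup>2 \<partial>N) < \<epsilon> / 4"
    by (auto simp: eventually_sequentially)
  obtain p where p: "(\<integral>x. (g i x - poly p x)\<^sup>2 \<partial>N) < \<epsilon> / 4"
    using g[of i] e unfolding poly_approximable_def by (metis divide_pos_pos zero_less_numeral)
  have g': "square_integrable N (g i)" using g by (simp add: poly_approximable_def)
  have "(\<integral>x. (f x - poly p x)\<^sup>2 \<partial>N) = (\<integral>x. ((f x - g i x) + (g i x - poly p x))\<^sup>2 \<partial>N)" by simp
  also have "\<dots> \<le> 2 * (\<integral>x. (f x - g i x)\<^sup>2 \<partial>N) + 2 * (\<integral>x. (g i x - poly p x)\<^sup>2 \<partial>N)"
    by (intro square_integral_add_le square_integrable_diff f g' square_integrable_poly)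
  also have "\<dots> < \<epsilon>" using i p by simp
  finally show "\<exists>p. (\<integral>x. (f x - poly p x)\<^sup>2 \<partial>N) < \<epsilon>" by blast
qed

text \<open>
  Uniform approximation of continuous functions, half-lines and disjoint unions in the Dynkin system,
  and monotone approximation all reduce to this form of dominated convergence.
\<close>

lemma poly_approximable_dominated:
  assumes f: "square_integrable N f" and g: "\<And>i. poly_approximable N (g i)"
    and w: "square_integrable N w" and lim: "AE x in N. (\<lambda>i. g i x) \<longlonglongrightarrow> f x"
    and dom: "\<And>i. AE x in N. \<bar>f x - g i x\<bar> \<le> w x"
  shows "poly_approximable N f"
proof (rule poly_approximable_limit[OF f g])
  have g': "square_integrable N (g i)" for i using g by (simp add: poly_approximable_def)
  have "(\<lambda>i. \<integral>x. (f x - g i x)\<^sup>2 \<partial>N) \<longlonglongrightarrow> (\<integral>x. 0 \<partial>N)"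
  proof (rule integral_dominated_convergence)
    show "integrable N (\<lambda>x. (w x)\<^sup>2)" using w by (simp add: square_integrable_def)
    show "(\<lambda>x. (f x - g i x)\<^sup>2) \<in> borel_measurable N" for i
      using square_integrable_diff[OF f g'[of i]]
      unfolding square_integrable_def by (intro borel_measurable_power) simp
    show "AE x in N. (\<lambda>i. (f x - g i x)\<^sup>2) \<longlonglongrightarrow> 0"
      using lim by eventually_elim (auto intro!: tendsto_eq_intros)
    show "AE x in N. norm ((f x - g i x)\<^sup>2) \<le> (w x)\<^sup>2" for i
      using dom[of i] by eventually_elim (simp add: abs_le_square_iff[symmetric])
  qed simp
  then show "(\<lambda>i. \<integral>x. (f x - g i x)\<^sup>2 \<partial>N) \<longlonglongrightarrow> 0" by simp
qed

lemma poly_approximable_add: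
  assumes "poly_approximable N f" "poly_approximable N g"
  shows "poly_approximable N (\<lambda>x. f x + g x)"
  unfolding poly_approximable_def
proof (intro conjI allI impI)
  have f: "square_integrable N f" and g: "square_integrable N g"
    using assms by (auto simp: poly_approximable_def)
  show "square_integrable N (\<lambda>x. f x + g x)" by (rule square_integrable_add[OF f g])
  fix \<epsilon> :: real assume e: "0 < \<epsilon>"
  obtain p where p: "(\<integral>x. (f x - poly p x)\<^sup>2 \<partial>N) < \<epsilon> / 4"
    using assms(1) e unfolding poly_approximable_def by (metis divide_pos_pos zero_less_numeral)
  obtain q where q: "(\<integral>x. (g x - poly q x)\<^sup>2 \<partial>N) < \<epsilon> / 4"
    using assms(2) e unfolding poly_approximable_def by (metis divide_pos_pos zero_less_numeral)
  have "(\<integral>x. (f x + g x - poly (p + q) x)\<^sup>2 \<partial>N)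
    = (\<integral>x. ((f x - poly p x) + (g x - poly q x))\<^sup>2 \<partial>N)" by (simp add: algebra_simps)
  also have "\<dots> \<le> 2 * (\<integral>x. (f x - poly p x)\<^sup>2 \<partial>N) + 2 * (\<integral>x. (g x - poly q x)\<^sup>2 \<partial>N)"
    by (intro square_integral_add_le square_integrable_diff f g square_integrable_poly)
  also have "\<dots> < \<epsilon>" using p q by simp
  finally show "\<exists>p. (\<integral>x. (f x + g x - poly p x)\<^sup>2 \<partial>N) < \<epsilon>" by blast
qed

lemma poly_approximable_cmult:
  assumes "poly_approximable N f"
  shows "poly_approximable N (\<lambda>x. c * f x)"
proof (cases "c = 0")
  case True
  then show ?thesis
    by (auto simp: poly_approximable_def square_integrable_def intro!: exI[of _ 0])
next
  case False
  have f: "square_integrable N f" using assms by (simp add: poly_approximable_def)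
  show ?thesis unfolding poly_approximable_def
  proof (intro conjI allI impI square_integrable_cmult f)
    fix \<epsilon> :: real assume e: "0 < \<epsilon>"
    obtain p where p: "(\<integral>x. (f x - poly p x)\<^sup>2 \<partial>N) < \<epsilon> / c\<^sup>2"
      using assms e False unfolding poly_approximable_def
      by (metis divide_pos_pos zero_less_power2)
    have "(\<integral>x. (c * f x - poly (smult c p) x)\<^sup>2 \<partial>N) = (\<integral>x. c\<^sup>2 * (f x - poly p x)\<^sup>2 \<partial>N)"
      by (simp add: power_mult_distrib flip: right_diff_distrib)
    also have "\<dots> < \<epsilon>" using p False by (simp add: field_simps)
    finally show "\<exists>p. (\<integral>x. (c * f x - poly p x)\<^sup>2 \<partial>N) < \<epsilon>" by blast
  qed
qed

lemma poly_approximable_poly: "poly_approximable N (poly p)"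
  by (auto simp: poly_approximable_def square_integrable_poly intro!: exI[of _ p])

lemma poly_approximable_zero: "poly_approximable N (\<lambda>_. 0)"
proof -
  have "poly 0 = (\<lambda>_. 0 :: real)" by auto
  then show ?thesis using poly_approximable_poly[of 0] by simp
qed

lemma poly_approximable_diff:
  assumes "poly_approximable N f" "poly_approximable N g"
  shows "poly_approximable N (\<lambda>x. f x - g x)"
  using poly_approximable_add[OF assms(1) poly_approximable_cmult[OF assms(2), of "-1"]] by simp

text \<open>
  By the Stone-Weierstrass theorem and finiteness of the measure, uniform approximation on the unit
  interval implies approximation in mean square.
\<close>

lemma poly_approximable_continuous:
  assumes f: "continuous_on UNIV f"
  shows "poly_approximable N f"
proof -
  have [measurable]: "f \<in> borel_measurable borel" by (rule borel_measurable_continuous_onI[OF f])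
  have fc: "continuous_on {0..1} f" using f continuous_on_subset by blast
  have "bounded (f ` {0..1})"
    by (rule compact_imp_bounded[OF compact_continuous_image[OF fc]]) simp
  then obtain C where C: "\<forall>y\<in>f ` {0..1}. norm y \<le> C" unfolding bounded_iff by blast
  then have sf: "square_integrable N f" by (intro square_integrable_bounded[of _ C]) auto
  have "\<exists>p. \<forall>x\<in>{0..1}. \<bar>f x - poly p x\<bar> < e" if e: "0 < e" for e
  proof -
    obtain g where g: "real_polynomial_function g" "\<And>x. x \<in> {0..1} \<Longrightarrow> \<bar>f x - g x\<bar> < e"
      using Stone_Weierstrass_real_polynomial_function[OF _ fc e] by blast
    then obtain a n where "g = (\<lambda>x. \<Sum>i\<le>n. a i * x ^ i)"
      using real_polynomial_function_iff_sum by blast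
    then have "g = poly (\<Sum>i\<le>n. monom (a i) i)" by (auto simp: poly_sum poly_monom)
    then show ?thesis using g by blast
  qed
  then have "\<forall>n. \<exists>p. \<forall>x\<in>{0..1}. \<bar>f x - poly p x\<bar> < 1 / real (Suc n)" by simp
  then obtain p where p: "\<And>n x. x \<in> {0..1} \<Longrightarrow> \<bar>f x - poly (p n) x\<bar> < 1 / real (Suc n)" by metis
  show ?thesis
  proof (rule poly_approximable_dominated[OF sf, of "\<lambda>n. poly (p n)" "\<lambda>_. 1"])
    show "AE x in N. (\<lambda>n. poly (p n) x) \<longlonglongrightarrow> f x"
      using AE_unit
    proof eventually_elim
      case (elim x)
      have "(\<lambda>n. f x - poly (p n) x) \<longlonglongrightarrow> 0"
        by (rule Lim_null_comparison[OF _ LIMSEQ_Suc[OF lim_1_over_n]])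
           (use p[OF elim] in \<open>auto intro!: always_eventually less_imp_le simp del: of_nat_Suc\<close>)
      from tendsto_diff[OF tendsto_const[of "f x"] this] show ?case by simp
    qed
    show "AE x in N. \<bar>f x - poly (p i) x\<bar> \<le> 1" for i
      using AE_unit
    proof eventually_elim
      case (elim x)
      have "1 / real (Suc i) \<le> 1" by simp
      then show ?case using p[OF elim, of i] by linarith
    qed
    show "square_integrable N (\<lambda>_. 1)" by (rule square_integrable_bounded[of _ 1]) auto
  qed (rule poly_approximable_poly)
qed

text \<open>
  The approximable sets form a Dynkin system. It contains the half-lines, because their indicators
  are bounded pointwise limits of continuous piecewise linear functions.
\<close>

lemma poly_approximable_indicator:
  assumes "A \<in> sets borel"
  shows "poly_approximable N (indicator A)"
proof -
  have si: "square_integrable N (indicator A)" if "A \<in> sets borel" for A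
    using that by (intro square_integrable_bounded[of _ 1]) (auto simp: indicator_def)
  have one: "square_integrable N (\<lambda>_. c)" for c :: real
    by (rule square_integrable_bounded[of _ "\<bar>c\<bar>"]) auto
  have "Int_stable (range (\<lambda>a::real. {..a}))" by (auto simp: Int_stable_def)
  moreover have "range (\<lambda>a::real. {..a}) \<subseteq> Pow UNIV" by simp
  moreover have "A \<in> sigma_sets UNIV (range (\<lambda>a::real. {..a}))"
    using assms unfolding borel_eq_atMost by simp
  ultimately show ?thesis
  proof (induction rule: sigma_sets_induct_disjoint)
    case (basic A)
    then obtain a where A: "A = {..a}" by auto
    \<comment> \<open>1 up to \<open>a\<close>, then descending linearly to 0 within length \<open>1 / n\<close>\<close>
    define g where "g n x = max 0 (min 1 (1 - real n * (x - a)))" for n x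
    show ?case
    proof (rule poly_approximable_dominated[of _ g "\<lambda>_. 1"])
      show "poly_approximable N (g i)" for i
        unfolding g_def by (rule poly_approximable_continuous) (intro continuous_intros)
      show "AE x in N. (\<lambda>n. g n x) \<longlonglongrightarrow> indicator A x"
      proof (rule AE_I2)
        fix x
        show "(\<lambda>n. g n x) \<longlonglongrightarrow> indicator A x"
        proof (cases "x \<le> a")
          case True
          then have "g n x = 1" for n
            using mult_nonneg_nonpos[of "real n" "x - a"] by (simp add: g_def)
          then show ?thesis using True by (simp add: A)
        next
          case False
          obtain m where m: "1 < real m * (x - a)"
            using reals_Archimedean3[of "x - a"] False by auto
          have "g n x = 0" if "m \<le> n" for n
          proof -
            have "real m * (x - a) \<le> real n * (x - a)" using that False by (intro mult_right_mono) auto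
            then show ?thesis using m by (simp add: g_def)
          qed
          then have "\<forall>\<^sub>F n in sequentially. g n x = 0" by (auto simp: eventually_sequentially)
          then show ?thesis using False by (simp add: A tendsto_eventually)
        qed
      qed
      show "AE x in N. \<bar>indicator A x - g i x\<bar> \<le> 1" for i
        by (rule AE_I2) (auto simp: indicator_def g_def)
    qed (use A in \<open>auto intro!: si one\<close>)
  next
    case empty
    show ?case using poly_approximable_zero by simp
  next
    case (compl A)
    have "indicator (UNIV - A) x = poly 1 x - indicator A x" for x :: real by (auto simp: indicator_def)
    then show ?case using poly_approximable_diff[OF poly_approximable_poly[of 1] compl.IH] by (simp add: fun_eq_iff)
  next
    case (union A)
    have A: "A i \<in> sets borel" for i
      using union.hyps unfolding borel_eq_atMost by auto
    have fin: "poly_approximable N (\<lambda>x. \<Sum>i<n. indicator (A i) x)" for n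
    proof (induction n)
      case 0
      show ?case using poly_approximable_zero by simp
    next
      case (Suc n)
      show ?case using poly_approximable_add[OF Suc union.IH[of n]] by simp
    qed
    show ?case
    proof (rule poly_approximable_dominated[OF _ fin, of _ "\<lambda>_. 1"])
      have sums: "(\<lambda>i. indicator (A i) x :: real) sums indicator (\<Union>i. A i) x" for x
        using union.hyps by (intro indicator_sums) (auto simp: disjoint_family_on_def)
      show "AE x in N. (\<lambda>n. \<Sum>i<n. indicator (A i) x :: real) \<longlonglongrightarrow> indicator (\<Union>i. A i) x"
        using sums by (auto simp: sums_def)
      show "AE x in N. \<bar>indicator (\<Union>i. A i) x - (\<Sum>i<n. indicator (A i) x)\<bar> \<le> (1::real)" for n
      proof (rule AE_I2)
        fix x
        have "(\<Sum>i<n. indicator (A i) x :: real) \<le> indicator (\<Union>i. A i) x"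
          using sum_le_suminf[of "\<lambda>i. indicator (A i) x :: real" "{..<n}"] sums[of x]
          by (simp add: sums_iff)
        moreover have "0 \<le> (\<Sum>i<n. indicator (A i) x :: real)" by (rule sum_nonneg) simp
        moreover have "indicator (\<Union>i. A i) x \<le> (1::real)" by (simp add: indicator_def)
        ultimately show "\<bar>indicator (\<Union>i. A i) x - (\<Sum>i<n. indicator (A i) x)\<bar> \<le> (1::real)"
          by linarith
      qed
    qed (use A in \<open>auto intro!: si one\<close>)
  qed
qed

lemma poly_approximable_nonneg:
  assumes "f \<in> borel_measurable N" "\<And>x. 0 \<le> f x" "square_integrable N f"
  shows "poly_approximable N f"
  using assms
proof (induction rule: borel_measurable_induct_real)
  case (set A)
  then show ?case by (intro poly_approximable_indicator) simp
next
  case (mult u c)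
  show ?case
  proof (cases "c = 0")
    case True
    then show ?thesis using poly_approximable_zero by simp
  next
    case False
    have "square_integrable N (\<lambda>x. (1 / c) * (c * u x))" by (rule square_integrable_cmult[OF mult.prems])
    then have "square_integrable N u" using False by simp
    then show ?thesis by (intro poly_approximable_cmult mult.IH)
  qed
next
  case (add u v)
  have "square_integrable N u"
    by (rule square_integrable_bound[OF add.prems add.hyps(1)]) (use add.hyps in simp)
  moreover have "square_integrable N v"
    by (rule square_integrable_bound[OF add.prems add.hyps(3)]) (use add.hyps in simp)
  ultimately show ?case by (intro poly_approximable_add add.IH)
next
  case (seq U)
  have le: "U i x \<le> f x" if "x \<in> space N" for i x
    using seq.hyps that by (intro incseq_le[of "\<lambda>i. U i x"]) (auto simp: incseq_def le_fun_def)
  have "square_integrable N (U i)" for i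
    by (rule square_integrable_bound[OF seq.prems seq.hyps(1)])
       (auto simp: seq.hyps intro!: AE_I2 order_trans[OF le abs_ge_self])
  then have U: "poly_approximable N (U i)" for i by (rule seq.IH)
  show ?case
  proof (rule poly_approximable_dominated[OF seq.prems U seq.prems])
    show "AE x in N. (\<lambda>i. U i x) \<longlonglongrightarrow> f x" using seq.hyps by auto
    show "AE x in N. \<bar>f x - U i x\<bar> \<le> f x" for i
      using le seq.hyps by (intro AE_I2) (auto simp: abs_le_iff)
  qed
qed

text \<open>
  Indicators generate the nonnegative functions through sums and increasing limits; positive and
  negative part are then treated separately.
\<close>

theorem polynomials_dense:
  assumes f: "square_integrable N f" and e: "0 < \<epsilon>"
  shows "\<exists>p. (\<integral>x. (f x - poly p x)\<^sup>2 \<partial>N) < \<epsilon>"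
proof -
  have [measurable]: "f \<in> borel_measurable N" and i: "integrable N (\<lambda>x. (f x)\<^sup>2)"
    using f by (auto simp: square_integrable_def)
  have "poly_approximable N (\<lambda>x. max 0 (c * f x))" if c: "\<bar>c\<bar> = 1" for c
  proof (rule poly_approximable_nonneg)
    have "\<bar>max 0 (c * f x)\<bar> \<le> \<bar>f x\<bar>" for x
    proof -
      have "\<bar>max 0 (c * f x)\<bar> \<le> \<bar>c * f x\<bar>" by linarith
      then show ?thesis using c by (simp add: abs_mult)
    qed
    then show "square_integrable N (\<lambda>x. max 0 (c * f x))"
      by (intro square_integrable_bound[OF f]) auto
  qed auto
  note part = this
  have "poly_approximable N (\<lambda>x. max 0 (1 * f x) - max 0 (-1 * f x))"
    by (rule poly_approximable_diff[OF part part]) simp_all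
  moreover have "max 0 (1 * f x) - max 0 (-1 * f x) = f x" for x by simp
  ultimately have "poly_approximable N f" by (simp only:)
  then show ?thesis using e by (simp add: poly_approximable_def)
qed

end

section \<open>The eigenfunctions form an orthonormal basis\<close>

text \<open>
  The \<open>k\<close>-th polynomial has degree exactly \<open>k - 1\<close>, so the leading coefficient can be removed step by
  step. The hypothesis is stated through coefficients so that \<open>n = 0\<close> means the zero polynomial.
\<close>

lemma normed_eigenpoly_span:
  assumes "\<And>i. n \<le> i \<Longrightarrow> coeff p i = 0"
  shows "\<exists>c. p = (\<Sum>k=1..n. smult (c k) (normed_eigenpoly k))"
  using assms
proof (induction n arbitrary: p)
  case 0
  then have "p = 0" by (intro poly_eqI) simp
  then show ?case by simp
next
  case (Suc n)
  let ?q = "normed_eigenpoly (Suc n)"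
  define a where "a = coeff p n / coeff ?q n"
  have deg: "degree ?q = n" by (simp add: degree_normed_eigenpoly)
  have nz: "coeff ?q n \<noteq> 0"
    using leading_coeff_neq_0[OF normed_eigenpoly_nonzero[of "Suc n"]] deg by simp
  have "coeff (p - smult a ?q) i = 0" if "n \<le> i" for i
  proof (cases "i = n")
    case False
    then have "degree ?q < i" "Suc n \<le> i" using that deg by auto
    then show ?thesis using Suc.prems[of i] coeff_eq_0[of ?q i] by simp
  qed (simp add: a_def nz)
  then obtain c where c: "p - smult a ?q = (\<Sum>k=1..n. smult (c k) (normed_eigenpoly k))"
    using Suc.IH by blast
  have "p = (\<Sum>k=1..Suc n. smult ((c(Suc n := a)) k) (normed_eigenpoly k))"
    using c by (simp add: algebra_simps)
  then show ?case by blast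
qed

text \<open>
  The map \<open>h \<mapsto> w h\<close> is an isometry from \<open>L\<^sup>2\<close> of this measure onto \<open>L\<^sup>2(\<mu>)\<close>. It carries polynomials to the
  span of the eigenfunctions, and unlike \<open>\<mu>\<close> the measure is finite.
\<close>

definition bridge_weight_measure :: "real measure" where
  "bridge_weight_measure = density lborel (\<lambda>x. ennreal (indicator {0..1} x * (x * (1 - x))))"

lemma integral_bridge_weight_measure:
  assumes [measurable]: "f \<in> borel_measurable borel"
  shows "(\<integral>x. f x \<partial>bridge_weight_measure) = (\<integral>x. x * (1 - x) * f x \<partial>unit_lebesgue)" (is ?eq)
    and "integrable bridge_weight_measure f \<longleftrightarrow> integrable unit_lebesgue (\<lambda>x. x * (1 - x) * f x)" (is ?int)
proof -
  have nn: "AE x in lborel. 0 \<le> indicator {0..1} x * (x * (1 - x) :: real)"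
    by (rule AE_I2) (auto simp: indicator_def)
  have eq: "indicator {0..1} x * (x * (1 - x)) *\<^sub>R f x = x * (1 - x) * f x * indicator {0..1} x" for x
    by simp
  show ?eq
    unfolding bridge_weight_measure_def integral_unit_lebesgue
    by (subst integral_density) (use nn in \<open>auto simp: mult_ac\<close>)
  show ?int
    unfolding bridge_weight_measure_def
    by (subst integrable_density)
       (use nn in \<open>auto simp: mult_ac integrable_restrict_space\<close>)
qed

lemma finite_bridge_weight_measure: "finite_unit_interval_measure bridge_weight_measure"
proof (intro finite_unit_interval_measure.intro finite_unit_interval_measure_axioms.intro finite_measureI)
  show "sets bridge_weight_measure = sets borel" by (simp add: bridge_weight_measure_def)
  have "integrable unit_lebesgue (\<lambda>x. x * (1 - x) * indicator UNIV x)"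
    by (rule continuous_on_integrable_unit_lebesgue) (auto intro!: continuous_intros)
  then have "integrable bridge_weight_measure (indicator UNIV :: real \<Rightarrow> real)"
    by (subst integral_bridge_weight_measure(2)) auto
  then show "emeasure bridge_weight_measure (space bridge_weight_measure) \<noteq> \<infinity>"
    unfolding integrable_indicator_iff by simp
  show "AE x in bridge_weight_measure. x \<in> {0..1}"
    unfolding bridge_weight_measure_def
    by (subst AE_density) (auto simp: indicator_def)
qed

lemma eigenfunctions_dense:
  assumes g: "square_integrable bridge_measure g" and e: "0 < \<epsilon>"
  shows "\<exists>n c. (\<integral>x. (g x - (\<Sum>k=1..n. c k * poly (eigenfunction k) x))\<^sup>2 \<partial>bridge_measure) < \<epsilon>"
proof -
  interpret finite_unit_interval_measure bridge_weight_measure by (rule finite_bridge_weight_measure)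
  \<comment> \<open>the preimage of \<open>g\<close> under the isometry \<open>h \<mapsto> w h\<close>, extended by 0 to the real line\<close>
  define h where "h x = g x * indicator {0..1} x / (x * (1 - x))" for x
  have gm: "g \<in> borel_measurable unit_lebesgue"
    using g by (simp add: square_integrable_def measurable_bridge_measure)
  have [measurable]: "(\<lambda>x. g x * indicator {0..1} x) \<in> borel_measurable borel"
    using gm by (subst (asm) borel_measurable_restrict_space_iff) (auto simp: mult.commute)
  have hm [measurable]: "h \<in> borel_measurable borel" unfolding h_def by measurable
  have key: "x * (1 - x) * (h x - r)\<^sup>2 = (g x - x * (1 - x) * r)\<^sup>2 / (x * (1 - x))"
    if "x \<in> space unit_lebesgue" for x r
  proof -
    have "w * (a / w - r)\<^sup>2 = (a - w * r)\<^sup>2 / w" for w a :: real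
      by (cases "w = 0") (simp_all add: power2_eq_square field_simps)
    from this[of "x * (1 - x)" "g x"] show ?thesis
      using that by (simp add: h_def space_unit_lebesgue)
  qed
  have gp: "(\<lambda>x. (g x - x * (1 - x) * poly p x)\<^sup>2) \<in> borel_measurable unit_lebesgue" for p
    by (intro borel_measurable_power borel_measurable_diff gm borel_measurable_times
        borel_measurable_unit_lebesgueI) measurable
  have "square_integrable bridge_weight_measure h"
    unfolding square_integrable_def
  proof
    have "integrable bridge_weight_measure (\<lambda>x. (h x)\<^sup>2)
        \<longleftrightarrow> integrable unit_lebesgue (\<lambda>x. x * (1 - x) * (h x)\<^sup>2)"
      by (rule integral_bridge_weight_measure) measurable
    also have "\<dots> \<longleftrightarrow> integrable unit_lebesgue (\<lambda>x. (g x)\<^sup>2 / (x * (1 - x)))"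
      using key[of _ 0] by (intro Bochner_Integration.integrable_cong refl) simp
    also have "\<dots> \<longleftrightarrow> integrable bridge_measure (\<lambda>x. (g x)\<^sup>2)"
      by (rule integral_bridge_measure(2)[symmetric]) (rule borel_measurable_power[OF gm])
    finally show "integrable bridge_weight_measure (\<lambda>x. (h x)\<^sup>2)"
      using g by (simp add: square_integrable_def)
  qed measurable
  then obtain p where p: "(\<integral>x. (h x - poly p x)\<^sup>2 \<partial>bridge_weight_measure) < \<epsilon>"
    using polynomials_dense e by blast
  obtain c where c: "p = (\<Sum>k=1..Suc (degree p). smult (c k) (normed_eigenpoly k))"
    using normed_eigenpoly_span[of "Suc (degree p)" p] coeff_eq_0 Suc_le_eq by blast
  have sum: "(\<Sum>k=1..Suc (degree p). c k * poly (eigenfunction k) x) = x * (1 - x) * poly p x" for x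
  proof -
    have "poly p x = (\<Sum>k=1..Suc (degree p). c k * poly (normed_eigenpoly k) x)"
      using arg_cong[OF c, of "\<lambda>q. poly q x"] by (simp add: poly_sum del: sum.cl_ivl_Suc)
    then show ?thesis
      by (simp add: poly_eigenfunction sum_distrib_left mult_ac del: sum.cl_ivl_Suc)
  qed
  have "(\<integral>x. (g x - x * (1 - x) * poly p x)\<^sup>2 \<partial>bridge_measure)
     = (\<integral>x. (g x - x * (1 - x) * poly p x)\<^sup>2 / (x * (1 - x)) \<partial>unit_lebesgue)"
    by (rule integral_bridge_measure(1)[OF gp])
  also have "\<dots> = (\<integral>x. x * (1 - x) * (h x - poly p x)\<^sup>2 \<partial>unit_lebesgue)"
    by (intro Bochner_Integration.integral_cong refl) (rule key[symmetric])
  also have "\<dots> = (\<integral>x. (h x - poly p x)\<^sup>2 \<partial>bridge_weight_measure)"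
    by (rule integral_bridge_weight_measure(1)[symmetric]) measurable
  also have "\<dots> < \<epsilon>" by (rule p)
  finally show ?thesis unfolding sum[symmetric] by blast
qed

lemma orthonormal_basis_eigenfunction:
  "orthonormal_basis bridge_measure (\<lambda>k. poly (eigenfunction k))"
  using orthonormal_eigenfunction eigenfunctions_dense
  unfolding orthonormal_basis_def orthonormal_on_def by (auto simp: Ball_def)

section \<open>Second moments of the Brownian bridge\<close>

lemma (in prob_space) gaussian_rv_square_integrable:
  assumes "gaussian_rv M X"
  shows "square_integrable M X"
proof -
  have X [measurable]: "X \<in> borel_measurable M" using assms by (simp add: gaussian_rv_def)
  obtain m where "(AE \<omega> in M. X \<omega> = m) \<or> (\<exists>\<sigma>>0. distributed M lborel X (normal_density m \<sigma>))"
    using assms by (auto simp: gaussian_rv_def)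
  then have "integrable M (\<lambda>\<omega>. (X \<omega>)\<^sup>2)"
  proof
    assume "AE \<omega> in M. X \<omega> = m"
    then show ?thesis by (intro integrable_const_bound[of _ "m\<^sup>2"]) (auto elim: eventually_mono)
  next
    assume "\<exists>\<sigma>>0. distributed M lborel X (normal_density m \<sigma>)"
    then obtain \<sigma> where s: "0 < \<sigma>" "distributed M lborel X (normal_density m \<sigma>)" by blast
    have "integrable lborel (\<lambda>x. normal_density m \<sigma> x * (x - m)\<^sup>2
        + 2 * m * (normal_density m \<sigma> x * x) - m\<^sup>2 * normal_density m \<sigma> x)"
      using s(1) by (intro Bochner_Integration.integrable_add Bochner_Integration.integrable_diff
          integrable_mult_right integrable_normal_moment integrable_normal_moment_nz_1 integrable_normal_density)
    then have "integrable lborel (\<lambda>x. normal_density m \<sigma> x * x\<^sup>2)"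
      by (simp add: power2_eq_square algebra_simps)
    then show ?thesis
      using distributed_integrable[OF s(2), of "\<lambda>x. x\<^sup>2"] by simp
  qed
  then show ?thesis by (simp add: square_integrable_def)
qed

lemma (in prob_space) integrable_if_square_integrable:
  "square_integrable M X \<Longrightarrow> integrable M X"
  using square_integrable_mult[of M X "\<lambda>_. 1"] by (simp add: square_integrable_def)

text \<open>
  Jensen's inequality for the square, obtained as Bessel's inequality for the constant function 1.
\<close>

lemma (in prob_space) square_expectation_le:
  assumes X: "square_integrable M X"
  shows "(expectation X)\<^sup>2 \<le> expectation (\<lambda>\<omega>. (X \<omega>)\<^sup>2)"
  using Bessel_inequality[of "{0}" M "\<lambda>_ _. 1" X] X
  by (simp add: orthonormal_on_def square_integrable_def prob_space)

lemma emeasure_unit_lebesgue: "emeasure unit_lebesgue {0..1} = 1"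
  using unit_lebesgue.emeasure_space_1 unfolding space_unit_lebesgue .

text \<open>
  Rounding down to the next multiple of \<open>1 / n\<close>. Composed with a path it gives step functions, which
  serve twice: for joint measurability and as integrands of Riemann sums.
\<close>

definition grid :: "nat \<Rightarrow> real \<Rightarrow> real" where
  "grid n t = of_int \<lfloor>real n * t\<rfloor> / real n"

lemma grid_tendsto: "(\<lambda>n. grid n t) \<longlonglongrightarrow> t"
  unfolding grid_def
proof (rule tendsto_sandwich)
  show "\<forall>\<^sub>F n in sequentially. t - 1 / real n \<le> of_int \<lfloor>real n * t\<rfloor> / real n"
    using eventually_gt_at_top[of 0]
  proof eventually_elim
    case (elim n)
    have "real n * t - 1 \<le> of_int \<lfloor>real n * t\<rfloor>" by linarith
    then have "(real n * t - 1) / real n \<le> of_int \<lfloor>real n * t\<rfloor> / real n"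
      by (rule divide_right_mono) simp
    then show ?case using elim by (simp add: diff_divide_distrib)
  qed
  show "\<forall>\<^sub>F n in sequentially. of_int \<lfloor>real n * t\<rfloor> / real n \<le> t"
    using eventually_gt_at_top[of 0]
  proof eventually_elim
    case (elim n)
    have "of_int \<lfloor>real n * t\<rfloor> \<le> real n * t" by linarith
    then have "of_int \<lfloor>real n * t\<rfloor> / real n \<le> real n * t / real n"
      by (rule divide_right_mono) simp
    then show ?case using elim by simp
  qed
  show "(\<lambda>n. t - 1 / real n) \<longlonglongrightarrow> t"
    using tendsto_diff[OF tendsto_const[of t] lim_1_over_n] by simp
qed simp

locale brownian_bridge =
  fixes M :: "'a measure" and B :: "real \<Rightarrow> 'a \<Rightarrow> real"
  assumes bridge: "standard_brownian_bridge M B"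

sublocale brownian_bridge \<subseteq> prob_space M
  using bridge by (simp add: standard_brownian_bridge_def)

sublocale brownian_bridge \<subseteq> mu: pair_sigma_finite M bridge_measure ..

sublocale brownian_bridge \<subseteq> unit: pair_sigma_finite M unit_lebesgue ..

context brownian_bridge
begin

lemma gaussian_rv_sum: "finite T \<Longrightarrow> T \<subseteq> {0..1} \<Longrightarrow> gaussian_rv M (\<lambda>\<omega>. \<Sum>t\<in>T. c t * B t \<omega>)"
  using bridge by (auto simp: standard_brownian_bridge_def gaussian_process_def)

lemma gaussian_rv_value: "t \<in> {0..1} \<Longrightarrow> gaussian_rv M (B t)"
  using gaussian_rv_sum[of "{t}" "\<lambda>_. 1"] by simp

lemma value_measurable: "t \<in> {0..1} \<Longrightarrow> B t \<in> borel_measurable M"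
  using gaussian_rv_value by (auto simp: gaussian_rv_def)

lemma value_square_integrable: "t \<in> {0..1} \<Longrightarrow> square_integrable M (B t)"
  by (rule gaussian_rv_square_integrable[OF gaussian_rv_value])

lemma value_mean: "t \<in> {0..1} \<Longrightarrow> expectation (B t) = 0"
  using bridge by (auto simp: standard_brownian_bridge_def)

lemma value_covariance:
  assumes "s \<in> {0..1}" "t \<in> {0..1}"
  shows "expectation (\<lambda>\<omega>. B s \<omega> * B t \<omega>) = bridge_kernel s t"
proof -
  have "covariance M (B s) (B t) = min s t - s * t"
    using bridge assms by (simp add: standard_brownian_bridge_def)
  then show ?thesis using assms by (simp add: covariance_def value_mean bridge_kernel_def)
qed

lemma path_continuous: "\<omega> \<in> space M \<Longrightarrow> continuous_on {0..1} (\<lambda>t. B t \<omega>)"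
  using bridge by (auto simp: standard_brownian_bridge_def)

lemma path_measurable: "\<omega> \<in> space M \<Longrightarrow> (\<lambda>t. B t \<omega>) \<in> borel_measurable unit_lebesgue"
  by (rule continuous_on_measurable_unit_lebesgue[OF path_continuous])

text \<open>
  Continuity of the paths makes the process the pointwise limit of processes that are piecewise
  constant in time.
\<close>

lemma jointly_measurable_unit: "(\<lambda>(\<omega>, t). B t \<omega>) \<in> borel_measurable (M \<Otimes>\<^sub>M unit_lebesgue)"
proof (rule borel_measurable_LIMSEQ_real)
  \<comment> \<open>Clamping makes every grid value an admissible time, whatever integer is inserted for the floor.\<close>
  define c :: "real \<Rightarrow> real" where "c x = max 0 (min 1 x)" for x
  define F where "F n x = B (c (of_int \<lfloor>real n * snd x\<rfloor> / real n)) (fst x)" for n and x :: "'a \<times> real"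
  show "(\<lambda>n. F n x) \<longlonglongrightarrow> (case x of (\<omega>, t) \<Rightarrow> B t \<omega>)" if xs: "x \<in> space (M \<Otimes>\<^sub>M unit_lebesgue)" for x
  proof -
    obtain \<omega> t where x: "x = (\<omega>, t)" "\<omega> \<in> space M" "t \<in> {0..1}"
      using xs by (cases x) (auto simp: space_pair_measure space_unit_lebesgue)
    have "(\<lambda>n. c (of_int \<lfloor>real n * t\<rfloor> / real n)) \<longlonglongrightarrow> c t"
      unfolding c_def by (intro tendsto_intros grid_tendsto[unfolded grid_def])
    moreover have "c t = t" using x by (simp add: c_def)
    moreover have "c y \<in> {0..1}" for y by (simp add: c_def)
    ultimately have "(\<lambda>n. B (c (of_int \<lfloor>real n * t\<rfloor> / real n)) \<omega>) \<longlonglongrightarrow> B t \<omega>"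
      using x by (intro continuous_on_tendsto_compose[OF path_continuous[OF x(2)]]) auto
    then show ?thesis by (simp add: F_def x)
  qed
  show "F n \<in> borel_measurable (M \<Otimes>\<^sub>M unit_lebesgue)" for n
    unfolding F_def
  proof (rule measurable_compose_countable[where f = "\<lambda>i x. B (c (of_int i / real n)) (fst x)"
        and g = "\<lambda>x. \<lfloor>real n * snd x\<rfloor>"])
    show "(\<lambda>x. B (c (of_int i / real n)) (fst x)) \<in> borel_measurable (M \<Otimes>\<^sub>M unit_lebesgue)" for i :: int
      by (rule measurable_compose[OF measurable_fst value_measurable]) (simp add: c_def)
    have "(\<lambda>t::real. \<lfloor>real n * t\<rfloor>) \<in> measurable borel (count_space UNIV)" by measurable
    then have "(\<lambda>t. \<lfloor>real n * t\<rfloor>) \<in> measurable unit_lebesgue (count_space UNIV)"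
      by (intro measurable_restrict_space1) simp
    then show "(\<lambda>x. \<lfloor>real n * snd x\<rfloor>) \<in> measurable (M \<Otimes>\<^sub>M unit_lebesgue) (count_space UNIV)"
      by (rule measurable_compose[OF measurable_snd])
  qed
qed

lemma sets_pair_bridge: "sets (M \<Otimes>\<^sub>M bridge_measure) = sets (M \<Otimes>\<^sub>M unit_lebesgue)"
  by (intro sets_pair_measure_cong refl) (simp add: bridge_measure_def)

lemma jointly_measurable: "(\<lambda>(\<omega>, t). B t \<omega>) \<in> borel_measurable (M \<Otimes>\<^sub>M bridge_measure)"
  using jointly_measurable_unit by (simp cong: measurable_cong_sets add: sets_pair_bridge)

lemma nn_square_mean:
  assumes "s \<in> {0..1}"
  shows "(\<integral>\<^sup>+\<omega>. ennreal ((B s \<omega>)\<^sup>2) \<partial>M) = ennreal (s * (1 - s))"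
proof -
  have "(\<integral>\<^sup>+\<omega>. ennreal ((B s \<omega>)\<^sup>2) \<partial>M) = ennreal (expectation (\<lambda>\<omega>. (B s \<omega>)\<^sup>2))"
    using value_square_integrable[OF assms]
    by (intro nn_integral_eq_integral) (auto simp: square_integrable_def)
  also have "expectation (\<lambda>\<omega>. (B s \<omega>)\<^sup>2) = s * (1 - s)"
    using value_covariance[OF assms assms] by (simp add: bridge_kernel_def power2_eq_square algebra_simps)
  finally show ?thesis .
qed

lemma nn_integral_square_unit_finite:
  "(\<integral>\<^sup>+x. ennreal ((case x of (\<omega>, t) \<Rightarrow> B t \<omega>)\<^sup>2) \<partial>(M \<Otimes>\<^sub>M unit_lebesgue)) < \<infinity>"
proof -
  have "(\<integral>\<^sup>+x. ennreal ((case x of (\<omega>, t) \<Rightarrow> B t \<omega>)\<^sup>2) \<partial>(M \<Otimes>\<^sub>M unit_lebesgue))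
     = (\<integral>\<^sup>+t. (\<integral>\<^sup>+\<omega>. ennreal ((B t \<omega>)\<^sup>2) \<partial>M) \<partial>unit_lebesgue)"
    using unit.nn_integral_snd[of "\<lambda>x. ennreal ((case x of (\<omega>, t) \<Rightarrow> B t \<omega>)\<^sup>2)"] jointly_measurable_unit
    by simp
  also have "\<dots> \<le> (\<integral>\<^sup>+t. 1 \<partial>unit_lebesgue)"
  proof (rule nn_integral_mono)
    fix t assume t: "t \<in> space unit_lebesgue"
    then have "t * (1 - t) \<le> 1 * 1" by (intro mult_mono) (auto simp: space_unit_lebesgue)
    then show "(\<integral>\<^sup>+\<omega>. ennreal ((B t \<omega>)\<^sup>2) \<partial>M) \<le> 1"
      using t nn_square_mean[of t] by (simp add: space_unit_lebesgue)
  qed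
  also have "\<dots> < \<infinity>" by (simp add: emeasure_unit_lebesgue space_unit_lebesgue)
  finally show ?thesis .
qed

lemma square_integrable_joint_unit: "square_integrable (M \<Otimes>\<^sub>M unit_lebesgue) (\<lambda>(\<omega>, t). B t \<omega>)"
  unfolding square_integrable_def integrable_iff_bounded
  using nn_integral_square_unit_finite
  by (intro conjI borel_measurable_power jointly_measurable_unit) simp

text \<open>
  By Tonelli, since \<open>E[B\<^sub>t\<^sup>2] = t (1 - t)\<close> is exactly the inverse of the density of \<open>\<mu>\<close>. This is where
  the weight in the definition of \<open>\<mu>\<close> comes from.
\<close>

lemma nn_integral_square_mu:
  "(\<integral>\<^sup>+x. ennreal ((case x of (\<omega>, t) \<Rightarrow> B t \<omega>)\<^sup>2) \<partial>(M \<Otimes>\<^sub>M bridge_measure)) = 1"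
proof -
  have m: "(\<lambda>x. ennreal (x * (1 - x))) \<in> borel_measurable unit_lebesgue"
    by (intro measurable_compose[OF borel_measurable_unit_lebesgueI measurable_ennreal]) measurable
  have md: "(\<lambda>x. ennreal (1 / (x * (1 - x)))) \<in> borel_measurable unit_lebesgue"
    using bridge_density_measurable by simp
  have "(\<integral>\<^sup>+x. ennreal ((case x of (\<omega>, t) \<Rightarrow> B t \<omega>)\<^sup>2) \<partial>(M \<Otimes>\<^sub>M bridge_measure))
     = (\<integral>\<^sup>+t. (\<integral>\<^sup>+\<omega>. ennreal ((B t \<omega>)\<^sup>2) \<partial>M) \<partial>bridge_measure)"
    using mu.nn_integral_snd[of "\<lambda>x. ennreal ((case x of (\<omega>, t) \<Rightarrow> B t \<omega>)\<^sup>2)"] jointly_measurable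
    by simp
  also have "\<dots> = (\<integral>\<^sup>+t. ennreal (t * (1 - t)) \<partial>bridge_measure)"
    by (intro nn_integral_cong nn_square_mean) (simp add: space_bridge_measure)
  also have "\<dots> = (\<integral>\<^sup>+t. ennreal (1 / (t * (1 - t))) * ennreal (t * (1 - t)) \<partial>unit_lebesgue)"
    unfolding bridge_measure_def by (rule nn_integral_density[OF md m])
  also have "\<dots> = (\<integral>\<^sup>+t. 1 \<partial>unit_lebesgue)"
  proof (rule nn_integral_cong_AE)
    show "AE t in unit_lebesgue. ennreal (1 / (t * (1 - t))) * ennreal (t * (1 - t)) = 1"
      using AE_unit_lebesgue_interior
    proof eventually_elim
      case (elim t)
      then show ?case by (subst ennreal_mult[symmetric]) auto
    qed
  qed
  also have "\<dots> = 1" by (simp add: emeasure_unit_lebesgue space_unit_lebesgue)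
  finally show ?thesis .
qed

lemma square_integrable_joint: "square_integrable (M \<Otimes>\<^sub>M bridge_measure) (\<lambda>(\<omega>, t). B t \<omega>)"
  unfolding square_integrable_def integrable_iff_bounded
  by (intro conjI borel_measurable_power jointly_measurable) (simp add: nn_integral_square_mu)

lemma AE_path_square_integrable:
  "AE \<omega> in M. square_integrable bridge_measure (\<lambda>t. B t \<omega>)"
proof -
  have "AE \<omega> in M. integrable bridge_measure (\<lambda>t. (B t \<omega>)\<^sup>2)"
    using mu.AE_integrable_fst'[of "\<lambda>x. (case x of (\<omega>, t) \<Rightarrow> B t \<omega>)\<^sup>2"] square_integrable_joint
    by (simp add: square_integrable_def)
  moreover have "AE \<omega> in M. (\<lambda>t. B t \<omega>) \<in> borel_measurable bridge_measure"
    by (rule AE_I2) (simp add: measurable_bridge_measure path_measurable)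
  ultimately show ?thesis by eventually_elim (simp add: square_integrable_def)
qed

lemma integrable_path_norm: "integrable M (\<lambda>\<omega>. \<integral>t. (B t \<omega>)\<^sup>2 \<partial>bridge_measure)"
  using mu.integrable_fst'[of "\<lambda>x. (case x of (\<omega>, t) \<Rightarrow> B t \<omega>)\<^sup>2"] square_integrable_joint
  by (simp add: square_integrable_def)

lemma expectation_path_norm: "expectation (\<lambda>\<omega>. \<integral>t. (B t \<omega>)\<^sup>2 \<partial>bridge_measure) = 1"
proof -
  have i: "integrable (M \<Otimes>\<^sub>M bridge_measure) (\<lambda>x. (case x of (\<omega>, t) \<Rightarrow> B t \<omega>)\<^sup>2)"
    using square_integrable_joint by (simp add: square_integrable_def)
  have "expectation (\<lambda>\<omega>. \<integral>t. (B t \<omega>)\<^sup>2 \<partial>bridge_measure)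
     = (\<integral>x. (case x of (\<omega>, t) \<Rightarrow> B t \<omega>)\<^sup>2 \<partial>(M \<Otimes>\<^sub>M bridge_measure))"
    using mu.integral_fst'[OF i] by simp
  also have "\<dots> = 1"
    using nn_integral_eq_integral[OF i] nn_integral_square_mu
    by (simp add: integral_nonneg ennreal_eq_1)
  finally show ?thesis .
qed

definition weighted_integral :: "real poly \<Rightarrow> 'a \<Rightarrow> real" where
  "weighted_integral r \<omega> = (\<integral>t. B t \<omega> * poly r t \<partial>unit_lebesgue)"

text \<open>
  Together with \<open>square_integrable_joint_unit\<close> this provides the integrability that Fubini's theorem
  needs in \<open>expectation_weighted_integral_mult\<close>.
\<close>

lemma square_integrable_product:
  assumes Y: "square_integrable M Y"
  shows "square_integrable (M \<Otimes>\<^sub>M unit_lebesgue) (\<lambda>(\<omega>, t). Y \<omega> * poly r t)"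
proof -
  obtain C where C: "\<forall>t\<in>{0..1}. \<bar>poly r t\<bar> \<le> C" using poly_bounded_unit by blast
  have Ym: "Y \<in> borel_measurable M" using Y by (simp add: square_integrable_def)
  have Y1: "square_integrable (M \<Otimes>\<^sub>M unit_lebesgue) (\<lambda>x. Y (fst x))"
    unfolding square_integrable_def
  proof
    show "(\<lambda>x. Y (fst x)) \<in> borel_measurable (M \<Otimes>\<^sub>M unit_lebesgue)"
      by (rule measurable_compose[OF measurable_fst Ym])
    have "integrable (distr (M \<Otimes>\<^sub>M unit_lebesgue) M fst) (\<lambda>\<omega>. (Y \<omega>)\<^sup>2)"
      unfolding unit_lebesgue.distr_pair_fst using Y by (simp add: square_integrable_def)
    then show "integrable (M \<Otimes>\<^sub>M unit_lebesgue) (\<lambda>x. (Y (fst x))\<^sup>2)"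
      by (rule integrable_distr[OF measurable_fst])
  qed
  show ?thesis
  proof (rule square_integrable_bound[OF square_integrable_cmult[OF Y1, of C]])
    have "(\<lambda>x. Y (fst x) * poly r (snd x)) \<in> borel_measurable (M \<Otimes>\<^sub>M unit_lebesgue)"
      by (intro borel_measurable_times measurable_compose[OF measurable_fst Ym]
          measurable_compose[OF measurable_snd borel_measurable_unit_lebesgueI]) measurable
    then show "(\<lambda>(\<omega>, t). Y \<omega> * poly r t) \<in> borel_measurable (M \<Otimes>\<^sub>M unit_lebesgue)"
      by (simp add: case_prod_beta)
    show "AE x in M \<Otimes>\<^sub>M unit_lebesgue. \<bar>case x of (\<omega>, t) \<Rightarrow> Y \<omega> * poly r t\<bar> \<le> \<bar>C * Y (fst x)\<bar>"
    proof (rule AE_I2)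
      fix x assume "x \<in> space (M \<Otimes>\<^sub>M unit_lebesgue)"
      then have "\<bar>poly r (snd x)\<bar> \<le> \<bar>C\<bar>"
        using C by (auto simp: space_pair_measure space_unit_lebesgue intro: order_trans[OF _ abs_ge_self])
      then have "\<bar>Y (fst x)\<bar> * \<bar>poly r (snd x)\<bar> \<le> \<bar>Y (fst x)\<bar> * \<bar>C\<bar>"
        by (rule mult_left_mono) simp
      then show "\<bar>case x of (\<omega>, t) \<Rightarrow> Y \<omega> * poly r t\<bar> \<le> \<bar>C * Y (fst x)\<bar>"
        by (simp add: case_prod_beta abs_mult mult.commute)
    qed
  qed
qed

lemma expectation_weighted_integral_mult:
  assumes Y: "square_integrable M Y"
  shows "expectation (\<lambda>\<omega>. weighted_integral r \<omega> * Y \<omega>)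
    = (\<integral>t. expectation (\<lambda>\<omega>. B t \<omega> * Y \<omega>) * poly r t \<partial>unit_lebesgue)"
proof -
  have int: "integrable (M \<Otimes>\<^sub>M unit_lebesgue) (\<lambda>(\<omega>, t). B t \<omega> * (Y \<omega> * poly r t))"
    using square_integrable_mult[OF square_integrable_joint_unit square_integrable_product[OF Y, of r]]
    by (simp add: split_beta')
  have "expectation (\<lambda>\<omega>. weighted_integral r \<omega> * Y \<omega>)
      = expectation (\<lambda>\<omega>. \<integral>t. B t \<omega> * (Y \<omega> * poly r t) \<partial>unit_lebesgue)"
  proof (intro Bochner_Integration.integral_cong refl)
    fix \<omega>
    have "weighted_integral r \<omega> * Y \<omega> = (\<integral>t. (B t \<omega> * poly r t) * Y \<omega> \<partial>unit_lebesgue)"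
      unfolding weighted_integral_def by (rule integral_mult_left_zero[symmetric])
    then show "weighted_integral r \<omega> * Y \<omega> = (\<integral>t. B t \<omega> * (Y \<omega> * poly r t) \<partial>unit_lebesgue)"
      by (simp add: mult_ac)
  qed
  also have "\<dots> = (\<integral>t. expectation (\<lambda>\<omega>. B t \<omega> * (Y \<omega> * poly r t)) \<partial>unit_lebesgue)"
    using unit.Fubini_integral[OF int] by simp
  also have "\<dots> = (\<integral>t. expectation (\<lambda>\<omega>. B t \<omega> * Y \<omega>) * poly r t \<partial>unit_lebesgue)"
    by (simp flip: mult.assoc)
  finally show ?thesis .
qed

lemma weighted_integral_measurable: "weighted_integral r \<in> borel_measurable M"
proof -
  have "(\<lambda>x. (case x of (\<omega>, t) \<Rightarrow> B t \<omega>) * poly r (snd x)) \<in> borel_measurable (M \<Otimes>\<^sub>M unit_lebesgue)"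
    by (intro borel_measurable_times jointly_measurable_unit
        measurable_compose[OF measurable_snd borel_measurable_unit_lebesgueI]) measurable
  then have "(\<lambda>(\<omega>, t). B t \<omega> * poly r t) \<in> borel_measurable (M \<Otimes>\<^sub>M unit_lebesgue)"
    by (simp add: case_prod_beta)
  then show ?thesis
    unfolding weighted_integral_def by (rule unit_lebesgue.borel_measurable_lebesgue_integral)
qed

lemma weighted_integral_square_integrable: "square_integrable M (weighted_integral r)"
proof -
  obtain C where C: "\<forall>t\<in>{0..1}. \<bar>poly r t\<bar> \<le> C" using poly_bounded_unit by blast
  have i: "integrable M (\<lambda>\<omega>. \<integral>t. (B t \<omega>)\<^sup>2 \<partial>unit_lebesgue)"
    using unit.integrable_fst'[of "\<lambda>x. (case x of (\<omega>, t) \<Rightarrow> B t \<omega>)\<^sup>2"] square_integrable_joint_unit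
    by (simp add: square_integrable_def)
  have "integrable M (\<lambda>\<omega>. (weighted_integral r \<omega>)\<^sup>2)"
  proof (rule Bochner_Integration.integrable_bound)
    show "integrable M (\<lambda>\<omega>. C\<^sup>2 * (\<integral>t. (B t \<omega>)\<^sup>2 \<partial>unit_lebesgue))" using i by simp
    show "(\<lambda>\<omega>. (weighted_integral r \<omega>)\<^sup>2) \<in> borel_measurable M"
      by (rule borel_measurable_power[OF weighted_integral_measurable])
    have "(weighted_integral r \<omega>)\<^sup>2 \<le> C\<^sup>2 * (\<integral>t. (B t \<omega>)\<^sup>2 \<partial>unit_lebesgue)" if w: "\<omega> \<in> space M" for \<omega>
    proof -
      note c = path_continuous[OF w]
      have "(weighted_integral r \<omega>)\<^sup>2 \<le> (\<integral>t. (B t \<omega> * poly r t)\<^sup>2 \<partial>unit_lebesgue)"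
        unfolding weighted_integral_def
        by (rule unit_lebesgue.square_expectation_le)
           (auto simp: square_integrable_def intro!: continuous_on_measurable_unit_lebesgue
             continuous_on_integrable_unit_lebesgue continuous_intros c)
      also have "\<dots> \<le> (\<integral>t. C\<^sup>2 * (B t \<omega>)\<^sup>2 \<partial>unit_lebesgue)"
      proof (rule integral_mono)
        show "(B t \<omega> * poly r t)\<^sup>2 \<le> C\<^sup>2 * (B t \<omega>)\<^sup>2" if "t \<in> space unit_lebesgue" for t
        proof -
          have "\<bar>poly r t\<bar> \<le> \<bar>C\<bar>"
            using C that by (auto simp: space_unit_lebesgue intro: order_trans[OF _ abs_ge_self])
          then have "(poly r t)\<^sup>2 \<le> C\<^sup>2" by (simp add: abs_le_square_iff)
          then have "(B t \<omega>)\<^sup>2 * (poly r t)\<^sup>2 \<le> (B t \<omega>)\<^sup>2 * C\<^sup>2" by (rule mult_left_mono) simp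
          then show ?thesis by (simp add: power_mult_distrib mult.commute)
        qed
      qed (auto intro!: continuous_on_integrable_unit_lebesgue continuous_intros c)
      finally show ?thesis by simp
    qed
    then show "AE \<omega> in M. norm ((weighted_integral r \<omega>)\<^sup>2) \<le> norm (C\<^sup>2 * (\<integral>t. (B t \<omega>)\<^sup>2 \<partial>unit_lebesgue))"
      by (intro AE_I2) (auto intro: order_trans[OF _ abs_ge_self])
  qed
  then show ?thesis by (simp add: square_integrable_def weighted_integral_measurable)
qed

text \<open>
  The coefficient \<open>I\<^sub>k\<close> without the singular quotient \<open>e\<^sub>k(t) / (t (1 - t))\<close>; on every path it equals the
  \<open>poly_coeff\<close> and the \<open>mu_coeff\<close> of \<open>e\<^sub>k\<close>, see \<open>poly_coeff_eigenfunction\<close> and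
  \<open>mu_coeff_eigenfunction\<close>.
\<close>

definition bridge_coeff :: "nat \<Rightarrow> 'a \<Rightarrow> real" where
  "bridge_coeff k = weighted_integral (normed_eigenpoly k)"

lemma bridge_coeff_square_integrable: "square_integrable M (bridge_coeff k)"
  unfolding bridge_coeff_def by (rule weighted_integral_square_integrable)

lemma expectation_bridge_coeff: "expectation (bridge_coeff k) = 0"
proof -
  have "expectation (\<lambda>\<omega>. bridge_coeff k \<omega> * 1)
     = (\<integral>t. expectation (\<lambda>\<omega>. B t \<omega> * 1) * poly (normed_eigenpoly k) t \<partial>unit_lebesgue)"
    unfolding bridge_coeff_def
    by (rule expectation_weighted_integral_mult) (simp add: square_integrable_def)
  also have "\<dots> = (\<integral>t. 0 \<partial>unit_lebesgue)"
    by (intro Bochner_Integration.integral_cong refl) (simp add: value_mean space_unit_lebesgue)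
  finally show ?thesis by simp
qed

text \<open>
  Exchanging expectation and integral turns the left-hand side into the kernel applied to \<open>q\<^sub>k\<close>.
\<close>

lemma expectation_bridge_coeff_value:
  assumes k: "1 \<le> k" and t: "t \<in> {0..1}"
  shows "expectation (\<lambda>\<omega>. B t \<omega> * bridge_coeff k \<omega>) = eigenvalue k * poly (eigenfunction k) t"
proof -
  have "expectation (\<lambda>\<omega>. B t \<omega> * bridge_coeff k \<omega>) = expectation (\<lambda>\<omega>. bridge_coeff k \<omega> * B t \<omega>)"
    by (simp add: mult.commute)
  also have "\<dots> = (\<integral>s. expectation (\<lambda>\<omega>. B s \<omega> * B t \<omega>) * poly (normed_eigenpoly k) s \<partial>unit_lebesgue)"
    unfolding bridge_coeff_def by (rule expectation_weighted_integral_mult[OF value_square_integrable[OF t]])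
  also have "\<dots> = (\<integral>s. bridge_kernel s t * poly (normed_eigenpoly k) s \<partial>unit_lebesgue)"
    using t by (intro Bochner_Integration.integral_cong refl) (simp add: value_covariance space_unit_lebesgue)
  finally show ?thesis using normed_eigenpoly_kernel_integral[OF k t] by simp
qed

lemma expectation_bridge_coeff_mult:
  assumes i: "1 \<le> i" and j: "1 \<le> j"
  shows "expectation (\<lambda>\<omega>. bridge_coeff i \<omega> * bridge_coeff j \<omega>) = (if i = j then eigenvalue j else 0)"
proof -
  have "expectation (\<lambda>\<omega>. bridge_coeff i \<omega> * bridge_coeff j \<omega>)
    = (\<integral>s. expectation (\<lambda>\<omega>. B s \<omega> * bridge_coeff j \<omega>) * poly (normed_eigenpoly i) s \<partial>unit_lebesgue)"
    unfolding bridge_coeff_def[of i]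
    by (rule expectation_weighted_integral_mult[OF bridge_coeff_square_integrable])
  also have "\<dots> = (\<integral>s. eigenvalue j * (poly (eigenfunction j) s * poly (normed_eigenpoly i) s) \<partial>unit_lebesgue)"
    using j by (intro Bochner_Integration.integral_cong refl)
      (simp add: expectation_bridge_coeff_value space_unit_lebesgue)
  also have "\<dots> = (if i = j then eigenvalue j else 0)"
    using integral_eigenfunction_normed_eigenpoly[OF j i] by simp
  finally show ?thesis .
qed

end

section \<open>Characteristic functions: normal laws and independence\<close>

context prob_space
begin

lemma integrable_bounded_complex:
  fixes W :: "'a \<Rightarrow> complex"
  assumes "W \<in> borel_measurable M" "\<And>\<omega>. norm (W \<omega>) \<le> C"
  shows "integrable M W"
  by (rule integrable_const_bound[of _ C]) (use assms in auto)

lemma char_centered_normal: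
  assumes s: "0 < \<sigma>" and D: "distributed M lborel X (normal_density 0 \<sigma>)"
  shows "(CLINT \<omega>|M. iexp (u * X \<omega>)) = exp (- (\<sigma>\<^sup>2 * u\<^sup>2) / 2)"
proof -
  have Z: "distributed M lborel (\<lambda>\<omega>. X \<omega> / \<sigma>) std_normal_density"
    using D normal_standard_normal_convert[OF s, of X 0] by simp
  then have m: "(\<lambda>\<omega>. X \<omega> / \<sigma>) \<in> borel_measurable M" by (simp add: distributed_def)
  have "distr M lborel (\<lambda>\<omega>. X \<omega> / \<sigma>) = std_normal_distribution"
    using Z by (simp add: distributed_def)
  then have "char (distr M lborel (\<lambda>\<omega>. X \<omega> / \<sigma>)) (u * \<sigma>) = exp (- ((u * \<sigma>)\<^sup>2) / 2)"
    by (simp add: char_std_normal_distribution)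
  moreover have "char (distr M lborel (\<lambda>\<omega>. X \<omega> / \<sigma>)) (u * \<sigma>) = (CLINT \<omega>|M. iexp (u * X \<omega>))"
    unfolding char_def using s m by (subst integral_distr) (auto simp: mult.assoc)
  ultimately show ?thesis by (simp add: power_mult_distrib mult.commute)
qed

lemma char_centered_gaussian_rv:
  assumes X: "gaussian_rv M X" and mean: "expectation X = 0"
  shows "(CLINT \<omega>|M. iexp (u * X \<omega>)) = exp (- (expectation (\<lambda>\<omega>. (X \<omega>)\<^sup>2) * u\<^sup>2) / 2)"
proof -
  obtain m where m: "(AE \<omega> in M. X \<omega> = m) \<or> (\<exists>\<sigma>>0. distributed M lborel X (normal_density m \<sigma>))"
    using X by (auto simp: gaussian_rv_def)
  have Xm [measurable]: "X \<in> borel_measurable M" using X by (simp add: gaussian_rv_def)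
  show ?thesis using m
  proof
    assume ae: "AE \<omega> in M. X \<omega> = m"
    have "expectation X = expectation (\<lambda>_. m)" by (rule integral_cong_AE) (use ae in auto)
    then have m0: "m = 0" using mean by (simp add: prob_space)
    have "expectation (\<lambda>\<omega>. (X \<omega>)\<^sup>2) = expectation (\<lambda>_. 0)"
      by (rule integral_cong_AE) (use ae m0 in auto)
    moreover have "(CLINT \<omega>|M. iexp (u * X \<omega>)) = (CLINT \<omega>|M. 1)"
      by (rule integral_cong_AE) (use ae m0 in auto)
    ultimately show ?thesis by (simp add: prob_space)
  next
    assume "\<exists>\<sigma>>0. distributed M lborel X (normal_density m \<sigma>)"
    then obtain \<sigma> where s: "0 < \<sigma>" "distributed M lborel X (normal_density m \<sigma>)" by blast
    have "m = 0" using normal_distributed_expectation[OF s] mean by simp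
    moreover have "expectation (\<lambda>\<omega>. (X \<omega>)\<^sup>2) = \<sigma>\<^sup>2"
      using normal_distributed_variance[OF s] mean by simp
    ultimately show ?thesis using char_centered_normal[OF s(1), of X u] s(2) by simp
  qed
qed

lemma centered_normal_if_char:
  assumes s: "0 < \<sigma>" and X [measurable]: "X \<in> borel_measurable M"
    and ch: "\<And>u. (CLINT \<omega>|M. iexp (u * X \<omega>)) = exp (- (\<sigma>\<^sup>2 * u\<^sup>2) / 2)"
  shows "distributed M lborel X (normal_density 0 \<sigma>)"
proof -
  have "distr M borel (\<lambda>\<omega>. X \<omega> / \<sigma>) = std_normal_distribution"
  proof (rule Levy_uniqueness)
    show "real_distribution (distr M borel (\<lambda>\<omega>. X \<omega> / \<sigma>))" by (rule real_distribution_distr) simp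
    show "real_distribution std_normal_distribution" by (rule real_dist_normal_dist)
    show "char (distr M borel (\<lambda>\<omega>. X \<omega> / \<sigma>)) = char std_normal_distribution"
    proof
      fix u
      have "char (distr M borel (\<lambda>\<omega>. X \<omega> / \<sigma>)) u = (CLINT \<omega>|M. iexp ((u / \<sigma>) * X \<omega>))"
        unfolding char_def by (subst integral_distr) auto
      also have "\<dots> = exp (- (\<sigma>\<^sup>2 * (u / \<sigma>)\<^sup>2) / 2)" by (rule ch)
      also have "\<dots> = char std_normal_distribution u"
        using s by (simp add: char_std_normal_distribution power_divide)
      finally show "char (distr M borel (\<lambda>\<omega>. X \<omega> / \<sigma>)) u = char std_normal_distribution u" .
    qed
  qed
  then have "distr M lborel (\<lambda>\<omega>. X \<omega> / \<sigma>) = std_normal_distribution"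
    by (simp cong: distr_cong)
  then have "distributed M lborel (\<lambda>\<omega>. X \<omega> / \<sigma>) std_normal_density"
    by (simp add: distributed_def)
  then show ?thesis using normal_standard_normal_convert[OF s, of X 0] by simp
qed

text \<open>
  If \<open>W\<close> were positive, the claim would say that the law of \<open>X\<close> is unchanged under the measure with
  density proportional to \<open>W\<close>. Adding the constant \<open>C + 1\<close> reduces the general case to this one,
  and uniqueness of characteristic functions identifies the two laws.
\<close>

lemma weighted_char_uniqueness_real:
  fixes W :: "'a \<Rightarrow> real"
  assumes W [measurable]: "W \<in> borel_measurable M" and C: "\<And>\<omega>. \<bar>W \<omega>\<bar> \<le> C"
    and X [measurable]: "X \<in> borel_measurable M" and A [measurable]: "A \<in> sets borel"
    and ch: "\<And>u. (CLINT \<omega>|M. of_real (W \<omega>) * iexp (u * X \<omega>)) = of_real c * (CLINT \<omega>|M. iexp (u * X \<omega>))"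
  shows "expectation (\<lambda>\<omega>. W \<omega> * indicator A (X \<omega>)) = c * prob (X -` A \<inter> space M)"
proof -
  have iW: "integrable M W" by (rule integrable_const_bound[of _ C]) (use C in auto)
  have c: "c = expectation W"
    using ch[of 0] by (simp add: prob_space)
  have C0: "0 \<le> C" using order_trans[OF abs_ge_zero C] .
  have "\<bar>c\<bar> \<le> C"
  proof -
    have "\<bar>c\<bar> \<le> expectation (\<lambda>\<omega>. \<bar>W \<omega>\<bar>)" unfolding c by (rule integral_abs_bound)
    also have "\<dots> \<le> expectation (\<lambda>_. C)" by (rule integral_mono) (use iW C in auto)
    finally show ?thesis by (simp add: prob_space)
  qed
  then have d: "0 < c + (C + 1)" by linarith
  \<comment> \<open>The summand 1 keeps the denominator positive even when \<open>c = - C\<close>.\<close>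
  define f where "f \<omega> = (W \<omega> + (C + 1)) / (c + (C + 1))" for \<omega>
  have f0: "0 \<le> f \<omega>" for \<omega>
  proof -
    have "0 \<le> W \<omega> + (C + 1)" using C[of \<omega>] by linarith
    then show ?thesis using d by (simp add: f_def)
  qed
  have fm [measurable]: "f \<in> borel_measurable M" unfolding f_def by measurable
  have if_: "integrable M f" unfolding f_def using iW by simp
  have Ef: "expectation f = 1"
    unfolding f_def using iW d by (simp add: prob_space flip: c)
  have pf: "prob_space (density M f)"
  proof (rule prob_spaceI)
    have "emeasure (density M f) (space (density M f)) = (\<integral>\<^sup>+\<omega>. ennreal (f \<omega>) \<partial>M)"
      by (simp add: emeasure_density cong: nn_integral_cong)
    also have "\<dots> = 1" using nn_integral_eq_integral[OF if_] f0 Ef by simp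
    finally show "emeasure (density M f) (space (density M f)) = 1" .
  qed
  have Xf: "X \<in> borel_measurable (density M f)" by simp
  have "distr (density M f) borel X = distr M borel X"
  proof (rule Levy_uniqueness)
    show "real_distribution (distr (density M f) borel X)"
      by (rule prob_space.real_distribution_distr[OF pf Xf])
    show "real_distribution (distr M borel X)" by (rule real_distribution_distr[OF X])
    show "char (distr (density M f) borel X) = char (distr M borel X)"
    proof
      fix u
      define e where "e \<omega> = iexp (u * X \<omega>)" for \<omega>
      have em [measurable]: "e \<in> borel_measurable M" unfolding e_def by measurable
      have e1: "norm (e \<omega>) = 1" for \<omega> unfolding e_def by (rule norm_exp_i_times)
      have ie: "integrable M e" by (rule integrable_bounded_complex[OF em, of 1]) (simp add: e1)
      have iwe: "integrable M (\<lambda>\<omega>. of_real (W \<omega>) * e \<omega>)"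
        by (rule integrable_bounded_complex[of _ C]) (use C in \<open>auto simp: norm_mult e1\<close>)
      have "char (distr (density M f) borel X) u = (CLINT \<omega>|M. f \<omega> *\<^sub>R e \<omega>)"
        unfolding char_def e_def using f0 by (subst integral_distr[OF Xf]) (auto simp: integral_density)
      also have "\<dots> = (CLINT \<omega>|M. (of_real (W \<omega>) * e \<omega> + of_real (C + 1) * e \<omega>) / of_real (c + (C + 1)))"
        by (intro Bochner_Integration.integral_cong refl)
           (simp add: f_def scaleR_conv_of_real algebra_simps)
      also have "\<dots> = ((CLINT \<omega>|M. of_real (W \<omega>) * e \<omega>) + of_real (C + 1) * (CLINT \<omega>|M. e \<omega>)) / of_real (c + (C + 1))"
        using ie iwe by simp
      also have "\<dots> = (of_real c * (CLINT \<omega>|M. e \<omega>) + of_real (C + 1) * (CLINT \<omega>|M. e \<omega>)) / of_real (c + (C + 1))"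
        unfolding e_def ch ..
      also have "\<dots> = (CLINT \<omega>|M. e \<omega>)"
      proof -
        have "(of_real c * z + of_real (C + 1) * z) / of_real (c + (C + 1)) = z" for z :: complex
        proof -
          have "complex_of_real c * z + of_real (C + 1) * z = of_real (c + (C + 1)) * z"
            by (simp add: algebra_simps)
          then show ?thesis using d by (metis less_irrefl nonzero_mult_div_cancel_left of_real_eq_0_iff)
        qed
        then show ?thesis .
      qed
      also have "\<dots> = char (distr M borel X) u"
        unfolding char_def e_def by (subst integral_distr) auto
      finally show "char (distr (density M f) borel X) u = char (distr M borel X) u" .
    qed
  qed
  then have eq: "(\<integral>x. (indicator A x :: real) \<partial>distr (density M f) borel X) = (\<integral>x. indicator A x \<partial>distr M borel X)"
    by (rule arg_cong)
  have ef: "(\<integral>x. indicator A x \<partial>distr (density M f) borel X) = expectation (\<lambda>\<omega>. f \<omega> * indicator A (X \<omega>))"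
    using f0 by (subst integral_distr[OF Xf]) (auto simp: integral_density)
  have pA: "(\<integral>x. indicator A x \<partial>distr M borel X) = prob (X -` A \<inter> space M)"
    by (simp add: measure_distr)
  have iA: "expectation (\<lambda>\<omega>. indicator A (X \<omega>)) = prob (X -` A \<inter> space M)"
    using pA by (subst (asm) integral_distr) auto
  have sp: "expectation (\<lambda>\<omega>. f \<omega> * indicator A (X \<omega>))
     = (expectation (\<lambda>\<omega>. W \<omega> * indicator A (X \<omega>)) + (C + 1) * expectation (\<lambda>\<omega>. indicator A (X \<omega>))) / (c + (C + 1))"
  proof -
    have "integrable M (\<lambda>\<omega>. W \<omega> * indicator A (X \<omega>))"
      by (rule integrable_const_bound[of _ C]) (use C C0 in \<open>auto simp: indicator_def\<close>)
    moreover have "integrable M (\<lambda>\<omega>. indicator A (X \<omega>) :: real)"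
      by (rule integrable_const_bound[of _ 1]) (auto simp: indicator_def)
    ultimately show ?thesis
      by (subst integral_mult_right_zero[symmetric], subst Bochner_Integration.integral_add[symmetric])
         (auto simp: f_def algebra_simps simp flip: integral_divide_zero)
  qed
  have "(expectation (\<lambda>\<omega>. W \<omega> * indicator A (X \<omega>)) + (C + 1) * prob (X -` A \<inter> space M))
     / (c + (C + 1)) = prob (X -` A \<inter> space M)"
    using eq unfolding ef pA sp iA .
  then show ?thesis using d by (simp add: field_simps)
qed

text \<open>
  The hypothesis passes to the conjugate of \<open>W\<close> (replace \<open>u\<close> by \<open>- u\<close> and conjugate), hence to its
  real and imaginary parts.
\<close>

lemma weighted_char_uniqueness:
  fixes W :: "'a \<Rightarrow> complex"
  assumes W [measurable]: "W \<in> borel_measurable M" and C: "\<And>\<omega>. norm (W \<omega>) \<le> C"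
    and X [measurable]: "X \<in> borel_measurable M" and A [measurable]: "A \<in> sets borel"
    and ch: "\<And>u. (CLINT \<omega>|M. W \<omega> * iexp (u * X \<omega>)) = c * (CLINT \<omega>|M. iexp (u * X \<omega>))"
  shows "(CLINT \<omega>|M. W \<omega> * indicator A (X \<omega>)) = c * prob (X -` A \<inter> space M)"
proof -
  have C0: "0 \<le> C" using order_trans[OF norm_ge_zero C] .
  define e where "e u \<omega> = iexp (u * X \<omega>)" for u \<omega>
  have em [measurable]: "e u \<in> borel_measurable M" for u unfolding e_def by measurable
  have e1: "norm (e u \<omega>) = 1" for u \<omega> unfolding e_def by (rule norm_exp_i_times)
  have cnj_e: "cnj (e u \<omega>) = e (- u) \<omega>" for u \<omega> unfolding e_def by (simp add: exp_cnj)
  have cm [measurable]: "(\<lambda>\<omega>. cnj (W \<omega>)) \<in> borel_measurable M"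
    by (rule measurable_compose[OF W borel_measurable_continuous_onI]) (intro continuous_intros)
  have iwe: "integrable M (\<lambda>\<omega>. W \<omega> * e u \<omega>)" for u
    by (rule integrable_bounded_complex[of _ C]) (use C in \<open>auto simp: norm_mult e1\<close>)
  have iwe': "integrable M (\<lambda>\<omega>. cnj (W \<omega>) * e u \<omega>)" for u
    by (rule integrable_bounded_complex[of _ C]) (use C in \<open>auto simp: norm_mult e1\<close>)
  have iwA: "integrable M (\<lambda>\<omega>. W \<omega> * indicator A (X \<omega>))"
    by (rule integrable_bounded_complex[of _ C]) (use C C0 in \<open>auto simp: norm_mult indicator_def\<close>)
  have che: "(CLINT \<omega>|M. W \<omega> * e u \<omega>) = c * (CLINT \<omega>|M. e u \<omega>)" for u
    unfolding e_def by (rule ch)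
  have cnj_ch: "(CLINT \<omega>|M. cnj (W \<omega>) * e u \<omega>) = cnj c * (CLINT \<omega>|M. e u \<omega>)" for u
  proof -
    have "(CLINT \<omega>|M. cnj (W \<omega>) * e u \<omega>) = (CLINT \<omega>|M. cnj (W \<omega> * e (- u) \<omega>))"
      by (simp add: cnj_e)
    also have "\<dots> = cnj (c * (CLINT \<omega>|M. e (- u) \<omega>))"
      by (simp only: Bochner_Integration.integral_cnj che complex_cnj_cancel_iff)
    also have "\<dots> = cnj c * (CLINT \<omega>|M. cnj (e (- u) \<omega>))"
      by (simp only: complex_cnj_mult Bochner_Integration.integral_cnj)
    finally show ?thesis by (simp add: cnj_e)
  qed
  have "expectation (\<lambda>\<omega>. Re (W \<omega>) * indicator A (X \<omega>)) = Re c * prob (X -` A \<inter> space M)"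
  proof (rule weighted_char_uniqueness_real[where C = C])
    show "\<bar>Re (W \<omega>)\<bar> \<le> C" for \<omega> using abs_Re_le_cmod C order_trans by blast
    fix u
    have re: "of_real (Re z) * v = (z * v + cnj z * v) / 2" for z v
      by (simp add: complex_add_cnj flip: distrib_right)
    have "(CLINT \<omega>|M. of_real (Re (W \<omega>)) * e u \<omega>) = (CLINT \<omega>|M. (W \<omega> * e u \<omega> + cnj (W \<omega>) * e u \<omega>) / 2)"
      unfolding re ..
    also have "\<dots> = (c * (CLINT \<omega>|M. e u \<omega>) + cnj c * (CLINT \<omega>|M. e u \<omega>)) / 2"
      using iwe iwe' by (simp add: che cnj_ch)
    also have "\<dots> = of_real (Re c) * (CLINT \<omega>|M. e u \<omega>)" unfolding re ..
    finally show "(CLINT \<omega>|M. of_real (Re (W \<omega>)) * iexp (u * X \<omega>))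
      = of_real (Re c) * (CLINT \<omega>|M. iexp (u * X \<omega>))" unfolding e_def .
  qed measurable
  moreover have "expectation (\<lambda>\<omega>. Im (W \<omega>) * indicator A (X \<omega>)) = Im c * prob (X -` A \<inter> space M)"
  proof (rule weighted_char_uniqueness_real[where C = C])
    show "\<bar>Im (W \<omega>)\<bar> \<le> C" for \<omega> using abs_Im_le_cmod C order_trans by blast
    fix u
    have im: "of_real (Im z) * v = (z * v - cnj z * v) / (2 * \<i>)" for z v
    proof -
      have "z * v - cnj z * v = (2 * \<i>) * (of_real (Im z) * v)"
        unfolding left_diff_distrib[symmetric] complex_diff_cnj by simp
      then show ?thesis by (simp only: nonzero_mult_div_cancel_left) simp
    qed
    have "(CLINT \<omega>|M. of_real (Im (W \<omega>)) * e u \<omega>) = (CLINT \<omega>|M. (W \<omega> * e u \<omega> - cnj (W \<omega>) * e u \<omega>) / (2 * \<i>))"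
      unfolding im ..
    also have "\<dots> = (c * (CLINT \<omega>|M. e u \<omega>) - cnj c * (CLINT \<omega>|M. e u \<omega>)) / (2 * \<i>)"
      using iwe iwe' by (simp add: che cnj_ch)
    also have "\<dots> = of_real (Im c) * (CLINT \<omega>|M. e u \<omega>)" unfolding im ..
    finally show "(CLINT \<omega>|M. of_real (Im (W \<omega>)) * iexp (u * X \<omega>))
      = of_real (Im c) * (CLINT \<omega>|M. iexp (u * X \<omega>))" unfolding e_def .
  qed measurable
  moreover have "Re (CLINT \<omega>|M. W \<omega> * indicator A (X \<omega>)) = expectation (\<lambda>\<omega>. Re (W \<omega>) * indicator A (X \<omega>))"
    unfolding integral_Re[OF iwA, symmetric]
    by (intro Bochner_Integration.integral_cong refl) (simp add: indicator_def)
  moreover have "Im (CLINT \<omega>|M. W \<omega> * indicator A (X \<omega>)) = expectation (\<lambda>\<omega>. Im (W \<omega>) * indicator A (X \<omega>))"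
    unfolding integral_Im[OF iwA, symmetric]
    by (intro Bochner_Integration.integral_cong refl) (simp add: indicator_def)
  ultimately show ?thesis by (simp add: complex_eq_iff)
qed

text \<open>
  Joint laws are compared through one-dimensional characteristic functions only. Exponentials are
  replaced by indicators one variable at a time: given that the product formula holds for indicators of the
  variables in \<open>J\<close> and exponentials of the others, \<open>weighted_char_uniqueness\<close> with the remaining factors as
  the weight converts one more exponential into an indicator.
\<close>

lemma indep_vars_if_char_product:
  fixes X :: "'i \<Rightarrow> 'a \<Rightarrow> real"
  assumes X: "\<And>k. k \<in> I \<Longrightarrow> X k \<in> borel_measurable M"
    and ch: "\<And>L a. finite L \<Longrightarrow> L \<subseteq> I \<Longrightarrow>
      (CLINT \<omega>|M. iexp (\<Sum>k\<in>L. a k * X k \<omega>)) = (\<Prod>k\<in>L. CLINT \<omega>|M. iexp (a k * X k \<omega>))"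
  shows "indep_vars (\<lambda>_. borel) X I"
proof -
  have mixed: "(CLINT \<omega>|M. (\<Prod>k\<in>J. indicator (A k) (X k \<omega>)) * iexp (\<Sum>k\<in>L. a k * X k \<omega>))
      = of_real (\<Prod>k\<in>J. prob (X k -` A k \<inter> space M)) * (\<Prod>k\<in>L. CLINT \<omega>|M. iexp (a k * X k \<omega>))"
    if "finite J" "finite L" "J \<subseteq> I" "L \<subseteq> I" "J \<inter> L = {}" "\<And>k. k \<in> J \<Longrightarrow> A k \<in> sets borel"
    for J L A a
    using that
  proof (induction J arbitrary: L a rule: finite_induct)
    case empty
    then show ?case using ch by simp
  next
    case (insert j J)
    define W where "W \<omega> = (\<Prod>k\<in>J. indicator (A k) (X k \<omega>)) * iexp (\<Sum>k\<in>L. a k * X k \<omega>)" for \<omega>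
    define c where "c = of_real (\<Prod>k\<in>J. prob (X k -` A k \<inter> space M)) * (\<Prod>k\<in>L. CLINT \<omega>|M. iexp (a k * X k \<omega>))"
    have Xj [measurable]: "X j \<in> borel_measurable M" using X insert.prems by auto
    have Xk [measurable]: "X k \<in> borel_measurable M" if "k \<in> J \<union> L" for k
      using X that insert.prems by auto
    have Ak [measurable]: "A k \<in> sets borel" if "k \<in> J" for k using insert.prems that by auto
    have "(CLINT \<omega>|M. W \<omega> * indicator (A j) (X j \<omega>)) = c * prob (X j -` A j \<inter> space M)"
    proof (rule weighted_char_uniqueness[where C = 1])
      have "(\<lambda>\<omega>. indicator (A k) (X k \<omega>) :: complex) \<in> borel_measurable M" if "k \<in> J" for k
        by (rule measurable_compose[OF Xk borel_measurable_indicator[OF Ak]]) (use that in auto)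
      moreover have "(\<lambda>\<omega>. \<Sum>k\<in>L. a k * X k \<omega>) \<in> borel_measurable M"
        by (intro borel_measurable_sum borel_measurable_times borel_measurable_const Xk) auto
      ultimately show "W \<in> borel_measurable M"
        unfolding W_def by (intro borel_measurable_times borel_measurable_prod) auto
      show "norm (W \<omega>) \<le> 1" for \<omega>
        unfolding W_def norm_mult norm_exp_i_times prod_norm[symmetric]
        by (simp add: prod_le_1 indicator_def)
      show "A j \<in> sets borel" using insert.prems by auto
      fix u
      have jL: "j \<notin> L" "finite L" using insert.prems by auto
      \<comment> \<open>Multiplying the weight by \<open>iexp (u X\<^sub>j)\<close> just adds \<open>j\<close> to the index set of the exponential.\<close>
      have sj: "(\<Sum>k\<in>insert j L. (a(j := u)) k * X k \<omega>) = u * X j \<omega> + (\<Sum>k\<in>L. a k * X k \<omega>)" for \<omega>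
        using jL by (auto intro!: sum.cong)
      have pj: "(\<Prod>k\<in>insert j L. CLINT \<omega>|M. iexp ((a(j := u)) k * X k \<omega>))
          = (CLINT \<omega>|M. iexp (u * X j \<omega>)) * (\<Prod>k\<in>L. CLINT \<omega>|M. iexp (a k * X k \<omega>))"
        using jL by (auto intro!: prod.cong)
      have "W \<omega> * iexp (u * X j \<omega>) = (\<Prod>k\<in>J. indicator (A k) (X k \<omega>)) *
           iexp (\<Sum>k\<in>insert j L. (a(j := u)) k * X k \<omega>)" for \<omega>
        unfolding sj W_def by (simp add: distrib_left exp_add)
      then have "(CLINT \<omega>|M. W \<omega> * iexp (u * X j \<omega>)) = (CLINT \<omega>|M. (\<Prod>k\<in>J. indicator (A k) (X k \<omega>)) *
           iexp (\<Sum>k\<in>insert j L. (a(j := u)) k * X k \<omega>))"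
        by (simp only:)
      also have "\<dots> = of_real (\<Prod>k\<in>J. prob (X k -` A k \<inter> space M)) *
           (\<Prod>k\<in>insert j L. CLINT \<omega>|M. iexp ((a(j := u)) k * X k \<omega>))"
        by (rule insert.IH) (use insert.prems insert.hyps in auto)
      also have "\<dots> = c * (CLINT \<omega>|M. iexp (u * X j \<omega>))" unfolding pj by (simp add: c_def)
      finally show "(CLINT \<omega>|M. W \<omega> * iexp (u * X j \<omega>)) = c * (CLINT \<omega>|M. iexp (u * X j \<omega>))" .
    qed (rule Xj)
    then show ?case using insert.hyps by (simp add: W_def c_def mult_ac)
  qed
  have prod: "prob (\<Inter>j\<in>J. X j -` A j \<inter> space M) = (\<Prod>j\<in>J. prob (X j -` A j \<inter> space M))"
    if J: "finite J" "J \<subseteq> I" "J \<noteq> {}" and A: "\<And>j. j \<in> J \<Longrightarrow> A j \<in> sets borel" for J A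
  proof -
    have "complex_of_real (\<Prod>j\<in>J. prob (X j -` A j \<inter> space M)) = (CLINT \<omega>|M. (\<Prod>k\<in>J. indicator (A k) (X k \<omega>)))"
      using mixed[of J "{}" A] J A by simp
    also have "\<dots> = (CLINT \<omega>|M. of_real (indicator (\<Inter>j\<in>J. X j -` A j \<inter> space M) \<omega>))"
    proof (intro Bochner_Integration.integral_cong refl)
      fix \<omega> assume w: "\<omega> \<in> space M"
      show "(\<Prod>k\<in>J. indicator (A k) (X k \<omega>)) = complex_of_real (indicator (\<Inter>j\<in>J. X j -` A j \<inter> space M) \<omega>)"
      proof (cases "\<forall>k\<in>J. X k \<omega> \<in> A k")
        case True
        then show ?thesis using w by (simp add: indicator_def)
      next
        case False
        then obtain k where k: "k \<in> J" "X k \<omega> \<notin> A k" by blast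
        then have "(\<Prod>k\<in>J. indicator (A k) (X k \<omega>) :: complex) = 0"
          using J by (intro prod_zero bexI[of _ k]) simp_all
        moreover have "\<omega> \<notin> (\<Inter>j\<in>J. X j -` A j \<inter> space M)" using k by blast
        ultimately show ?thesis by simp
      qed
    qed
    also have "\<dots> = of_real (prob (\<Inter>j\<in>J. X j -` A j \<inter> space M))"
    proof -
      have "(\<Inter>j\<in>J. X j -` A j \<inter> space M) \<in> sets M"
        using J A X by (intro sets.finite_INT) (auto intro!: measurable_sets)
      then show ?thesis
        unfolding integral_complex_of_real by simp
    qed
    finally show ?thesis by (simp only: of_real_eq_iff)
  qed
  show ?thesis unfolding indep_vars_def2
  proof (intro conjI ballI indep_setsI)
    fix A J
    assume J: "J \<noteq> {}" "J \<subseteq> I" "finite J" and "\<forall>j\<in>J. A j \<in> {X j -` S \<inter> space M |S. S \<in> sets borel}"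
    then obtain S where S: "\<And>j. j \<in> J \<Longrightarrow> A j = X j -` S j \<inter> space M \<and> S j \<in> sets borel"
      by (auto simp: Ball_def) metis
    have "prob (\<Inter>j\<in>J. A j) = prob (\<Inter>j\<in>J. X j -` S j \<inter> space M)" using S by (intro arg_cong[where f = prob]) auto
    also have "\<dots> = (\<Prod>j\<in>J. prob (X j -` S j \<inter> space M))" by (rule prod) (use J S in auto)
    finally show "prob (\<Inter>j\<in>J. A j) = (\<Prod>j\<in>J. prob (A j))" using S by simp
  qed (auto intro!: X measurable_sets[OF X])
qed

end

section \<open>Riemann sums on the unit interval\<close>

lemma grid_mem: "t \<in> {0..1} \<Longrightarrow> grid n t \<in> {0..1}"
proof (cases "n = 0")
  case False
  assume t: "t \<in> {0..1}"
  have "of_int \<lfloor>real n * t\<rfloor> \<le> real n * t" by linarith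
  also have "\<dots> \<le> real n * 1" using t by (intro mult_left_mono) auto
  finally have "of_int \<lfloor>real n * t\<rfloor> \<le> real n" by simp
  moreover have "0 \<le> \<lfloor>real n * t\<rfloor>" using t by simp
  ultimately show ?thesis using False by (simp add: grid_def)
qed (simp add: grid_def)

lemma grid_point: "j < n \<Longrightarrow> real j / real n \<in> {0..1}"
  by (auto simp: divide_le_eq_1)

lemma measurable_grid: "(\<lambda>t. g (grid n t)) \<in> borel_measurable unit_lebesgue"
proof (rule borel_measurable_unit_lebesgueI)
  have "(\<lambda>t::real. \<lfloor>real n * t\<rfloor>) \<in> measurable borel (count_space UNIV)" by measurable
  then have "(\<lambda>t. (\<lambda>i. g (of_int i / real n)) \<lfloor>real n * t\<rfloor>) \<in> borel_measurable borel"
    by (rule measurable_compose) simp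
  then show "(\<lambda>t. g (grid n t)) \<in> borel_measurable borel" by (simp add: grid_def)
qed

lemma integral_grid:
  fixes g :: "real \<Rightarrow> real"
  assumes n: "0 < n"
  shows "(\<integral>t. g (grid n t) \<partial>unit_lebesgue) = (\<Sum>j<n. g (real j / real n)) / real n"
proof -
  define I where "I j = {real j / real n..<(real j + 1) / real n}" for j
  have "(\<integral>t. g (grid n t) \<partial>unit_lebesgue) = (\<integral>t. g (grid n t) * indicator {0..1} t \<partial>lborel)"
    by (rule integral_unit_lebesgue)
  also have "\<dots> = (\<integral>t. (\<Sum>j<n. g (real j / real n) * indicator (I j) t) \<partial>lborel)"
  proof (rule integral_cong_AE)
    have "(\<lambda>t. g (grid n t) * indicator {0..1} t) \<in> borel_measurable lborel
      \<longleftrightarrow> (\<lambda>t. g (grid n t)) \<in> borel_measurable unit_lebesgue"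
      by (subst borel_measurable_restrict_space_iff) (auto simp: mult.commute)
    then show "(\<lambda>t. g (grid n t) * indicator {0..1} t) \<in> borel_measurable lborel"
      using measurable_grid by blast
    show "(\<lambda>t. \<Sum>j<n. g (real j / real n) * indicator (I j) t) \<in> borel_measurable lborel"
      unfolding I_def by measurable
    show "AE t in lborel. g (grid n t) * indicator {0..1} t = (\<Sum>j<n. g (real j / real n) * indicator (I j) t)"
      using AE_lborel_singleton[of "1::real"]
    proof eventually_elim
      case (elim t)
      have I: "t \<in> I j \<longleftrightarrow> \<lfloor>real n * t\<rfloor> = int j" for j
        using n unfolding I_def floor_eq_iff by (auto simp: field_simps)
      show ?case
      proof (cases "t \<in> {0..<1}")
        case True
        define j where "j = nat \<lfloor>real n * t\<rfloor>"
        have j: "\<lfloor>real n * t\<rfloor> = int j" using True by (simp add: j_def)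
        have "real n * t < real n * 1" using True n by (intro mult_strict_left_mono) auto
        then have "j < n" using j by linarith
        have "(\<Sum>j<n. g (real j / real n) * indicator (I j) t) = (\<Sum>i<n. if i = j then g (real i / real n) else 0)"
          using I j by (intro sum.cong) (auto simp: indicator_def)
        also have "\<dots> = g (grid n t)" using \<open>j < n\<close> by (simp add: grid_def j)
        finally show ?thesis using True by simp
      next
        case False
        then have t: "t \<notin> {0..1}" using elim by auto
        have "t \<notin> I j" if "j < n" for j
        proof
          assume "t \<in> I j"
          then have "0 \<le> t" "t < (real j + 1) / real n"
            unfolding I_def by (auto intro: order_trans[rotated])
          moreover have "(real j + 1) / real n \<le> 1" using that by simp
          ultimately show False using t by auto
        qed
        then show ?thesis using t by simp
      qed
    qed
  qed
  also have "\<dots> = (\<Sum>j<n. g (real j / real n) * (1 / real n))"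
  proof -
    have "measure lborel (I j) = 1 / real n" for j
      using n unfolding I_def by (subst measure_lborel_Ico) (auto simp: divide_right_mono diff_divide_distrib[symmetric])
    moreover have "integrable lborel (\<lambda>t. indicator (I j) t :: real)" for j
      unfolding I_def by (auto simp: integrable_indicator_iff emeasure_lborel_Ico divide_right_mono)
    ultimately show ?thesis
      by (subst Bochner_Integration.integral_sum) simp_all
  qed
  finally show ?thesis by (simp add: sum_divide_distrib)
qed

lemma Riemann_sum_tendsto:
  fixes g :: "real \<Rightarrow> real"
  assumes g: "continuous_on {0..1} g"
  shows "(\<lambda>n. \<integral>t. g (grid n t) \<partial>unit_lebesgue) \<longlonglongrightarrow> (\<integral>t. g t \<partial>unit_lebesgue)"
proof -
  have "bounded (g ` {0..1})"
    by (rule compact_imp_bounded[OF compact_continuous_image[OF g]]) simp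
  then obtain C where C: "\<forall>y\<in>g ` {0..1}. norm y \<le> C" unfolding bounded_iff by blast
  show ?thesis
  proof (rule integral_dominated_convergence[where w = "\<lambda>_. C"])
    show "AE t in unit_lebesgue. (\<lambda>n. g (grid n t)) \<longlonglongrightarrow> g t"
      by (intro AE_I2 continuous_on_tendsto_compose[OF g grid_tendsto])
         (auto simp: space_unit_lebesgue intro!: always_eventually grid_mem[simplified])
    show "AE t in unit_lebesgue. norm (g (grid n t)) \<le> C" for n
      using C grid_mem by (intro AE_I2) (auto simp: space_unit_lebesgue)
  qed (auto intro: measurable_grid continuous_on_measurable_unit_lebesgue[OF g])
qed

text \<open>
  The inner limit is dominated convergence for fixed \<open>s\<close>, the outer one is dominated convergence for
  the inner integrals, which inherit the bound of the kernel.
\<close>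

lemma Riemann_sum_tendsto_2:
  fixes F :: "real \<Rightarrow> real \<Rightarrow> real"
  assumes F: "continuous_on ({0..1} \<times> {0..1}) (\<lambda>x. F (fst x) (snd x))"
  shows "(\<lambda>n. \<integral>s. (\<integral>t. F (grid n s) (grid n t) \<partial>unit_lebesgue) \<partial>unit_lebesgue)
    \<longlonglongrightarrow> (\<integral>s. (\<integral>t. F s t \<partial>unit_lebesgue) \<partial>unit_lebesgue)"
proof -
  have "bounded ((\<lambda>x. F (fst x) (snd x)) ` ({0..1} \<times> {0..1}))"
    by (rule compact_imp_bounded[OF compact_continuous_image[OF F]]) (simp add: compact_Times)
  then obtain C where "\<forall>y\<in>(\<lambda>x. F (fst x) (snd x)) ` ({0..1} \<times> {0..1}). norm y \<le> C"
    unfolding bounded_iff by blast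
  then have C: "norm (F s t) \<le> C" if "s \<in> {0..1}" "t \<in> {0..1}" for s t
    using that by fastforce
  have lim: "(\<lambda>n. F (grid n s) (grid n t)) \<longlonglongrightarrow> F s t" if "s \<in> {0..1}" "t \<in> {0..1}" for s t
    using continuous_on_tendsto_compose[OF F tendsto_Pair[OF grid_tendsto grid_tendsto], of s t] that grid_mem
    by (simp add: always_eventually)
  have inner: "(\<lambda>n. \<integral>t. F (grid n s) (grid n t) \<partial>unit_lebesgue) \<longlonglongrightarrow> (\<integral>t. F s t \<partial>unit_lebesgue)"
    if s: "s \<in> {0..1}" for s
  proof (rule integral_dominated_convergence[where w = "\<lambda>_. C"])
    show "(\<lambda>t. F s t) \<in> borel_measurable unit_lebesgue"
    proof (rule continuous_on_measurable_unit_lebesgue)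
      have cont: "continuous_on {0..1} (\<lambda>t. (s, t))" by (intro continuous_intros)
      have sub: "(\<lambda>t. (s, t)) ` {0..1} \<subseteq> {0..1} \<times> {0..1}" using s by auto
      show "continuous_on {0..1} (\<lambda>t. F s t)"
        using continuous_on_compose2[OF F cont sub] by simp
    qed
    show "AE t in unit_lebesgue. (\<lambda>n. F (grid n s) (grid n t)) \<longlonglongrightarrow> F s t"
      using lim s by (intro AE_I2) (simp add: space_unit_lebesgue)
    show "AE t in unit_lebesgue. norm (F (grid n s) (grid n t)) \<le> C" for n
      using C grid_mem s by (intro AE_I2) (simp add: space_unit_lebesgue)
  qed (auto intro: measurable_grid)
  show ?thesis
  proof (rule integral_dominated_convergence[where w = "\<lambda>_. C"])
    have m: "(\<lambda>s. \<integral>t. F (grid n s) (grid n t) \<partial>unit_lebesgue) \<in> borel_measurable unit_lebesgue" for n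
      by (rule measurable_grid)
    then show "(\<lambda>s. \<integral>t. F (grid n s) (grid n t) \<partial>unit_lebesgue) \<in> borel_measurable unit_lebesgue" for n .
    show "(\<lambda>s. \<integral>t. F s t \<partial>unit_lebesgue) \<in> borel_measurable unit_lebesgue"
      by (rule borel_measurable_LIMSEQ_real[OF inner m]) (simp add: space_unit_lebesgue)
    show "AE s in unit_lebesgue. (\<lambda>n. \<integral>t. F (grid n s) (grid n t) \<partial>unit_lebesgue) \<longlonglongrightarrow> (\<integral>t. F s t \<partial>unit_lebesgue)"
      using inner by (intro AE_I2) (simp add: space_unit_lebesgue)
    show "AE s in unit_lebesgue. norm (\<integral>t. F (grid n s) (grid n t) \<partial>unit_lebesgue) \<le> C" for n
    proof (rule AE_I2)
      fix s assume s: "s \<in> space unit_lebesgue"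
      have b: "norm (F (grid n s) (grid n t)) \<le> C" if "t \<in> space unit_lebesgue" for t
        using C grid_mem s that by (simp add: space_unit_lebesgue)
      have i: "integrable unit_lebesgue (\<lambda>t. F (grid n s) (grid n t))"
        by (rule unit_lebesgue.integrable_const_bound[of _ C]) (use b in \<open>auto intro: measurable_grid AE_I2\<close>)
      have "norm (\<integral>t. F (grid n s) (grid n t) \<partial>unit_lebesgue) \<le> (\<integral>t. norm (F (grid n s) (grid n t)) \<partial>unit_lebesgue)"
        by (rule integral_norm_bound)
      also have "\<dots> \<le> (\<integral>t. C \<partial>unit_lebesgue)"
        by (rule integral_mono) (use b i in auto)
      also have "\<dots> = C" by (simp add: unit_lebesgue.prob_space[unfolded space_unit_lebesgue] space_unit_lebesgue)
      finally show "norm (\<integral>t. F (grid n s) (grid n t) \<partial>unit_lebesgue) \<le> C" .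
    qed
  qed simp
qed

section \<open>The coefficients are independent Gaussian variables\<close>

context brownian_bridge
begin

definition Riemann_approx :: "real poly \<Rightarrow> nat \<Rightarrow> 'a \<Rightarrow> real" where
  "Riemann_approx r n \<omega> = (\<integral>t. B (grid n t) \<omega> * poly r (grid n t) \<partial>unit_lebesgue)"

lemma Riemann_approx_sum:
  assumes "0 < n"
  shows "Riemann_approx r n \<omega> = (\<Sum>j<n. B (real j / real n) \<omega> * poly r (real j / real n)) / real n"
  unfolding Riemann_approx_def by (rule integral_grid[OF assms])

lemma Riemann_approx_gaussian:
  assumes n: "0 < n"
  shows "gaussian_rv M (Riemann_approx r n)"
proof -
  define T where "T = (\<lambda>j. real j / real n) ` {..<n}"
  have inj: "inj_on (\<lambda>j. real j / real n) {..<n}" using n by (auto simp: inj_on_def)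
  have "gaussian_rv M (\<lambda>\<omega>. \<Sum>t\<in>T. (poly r t / real n) * B t \<omega>)"
    by (rule gaussian_rv_sum) (auto simp: T_def divide_le_eq_1)
  also have "(\<lambda>\<omega>. \<Sum>t\<in>T. (poly r t / real n) * B t \<omega>) = Riemann_approx r n"
    unfolding T_def sum.reindex[OF inj] Riemann_approx_sum[OF n]
    by (auto simp: sum_divide_distrib mult_ac intro!: ext sum.cong)
  finally show ?thesis .
qed

lemma Riemann_approx_tendsto:
  assumes "\<omega> \<in> space M"
  shows "(\<lambda>n. Riemann_approx r n \<omega>) \<longlonglongrightarrow> weighted_integral r \<omega>"
  unfolding Riemann_approx_def weighted_integral_def
  by (rule Riemann_sum_tendsto) (intro continuous_intros path_continuous assms)

lemma Riemann_approx_mean: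
  assumes n: "0 < n"
  shows "expectation (Riemann_approx r n) = 0"
proof -
  have i: "integrable M (B (real j / real n))" if "j < n" for j
    by (rule integrable_if_square_integrable[OF value_square_integrable[OF grid_point[OF that]]])
  have "expectation (\<lambda>\<omega>. (\<Sum>j<n. B (real j / real n) \<omega> * poly r (real j / real n)) / real n)
    = (\<Sum>j<n. expectation (B (real j / real n)) * poly r (real j / real n)) / real n"
    using i by (simp add: Bochner_Integration.integral_sum)
  also have "\<dots> = 0" using value_mean[OF grid_point] by simp
  finally show ?thesis by (simp add: Riemann_approx_sum[OF n, abs_def])
qed

lemma Riemann_approx_square:
  assumes n: "0 < n"
  shows "expectation (\<lambda>\<omega>. (Riemann_approx r n \<omega>)\<^sup>2)
    = (\<integral>s. (\<integral>t. bridge_kernel (grid n t) (grid n s) * poly r (grid n t) * poly r (grid n s) \<partial>unit_lebesgue) \<partial>unit_lebesgue)"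
proof -
  define p where "p j = real j / real n" for j
  have p: "p j \<in> {0..1}" if "j < n" for j using grid_point[OF that] by (simp add: p_def)
  have i: "integrable M (\<lambda>\<omega>. B (p j) \<omega> * B (p i) \<omega>)" if "j < n" "i < n" for i j
    by (rule square_integrable_mult) (auto intro!: value_square_integrable p that)
  have "expectation (\<lambda>\<omega>. (Riemann_approx r n \<omega>)\<^sup>2)
     = expectation (\<lambda>\<omega>. (\<Sum>i<n. \<Sum>j<n. B (p j) \<omega> * B (p i) \<omega> * (poly r (p j) * poly r (p i))) / (real n)\<^sup>2)"
    unfolding Riemann_approx_sum[OF n] p_def power_divide power2_eq_square[of "sum _ _"] sum_product
    by (simp add: mult_ac)
  also have "\<dots> = (\<Sum>i<n. \<Sum>j<n. bridge_kernel (p j) (p i) * (poly r (p j) * poly r (p i))) / (real n)\<^sup>2"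
  proof -
    have "expectation (\<lambda>\<omega>. \<Sum>i<n. \<Sum>j<n. B (p j) \<omega> * B (p i) \<omega> * (poly r (p j) * poly r (p i)))
      = (\<Sum>i<n. expectation (\<lambda>\<omega>. \<Sum>j<n. B (p j) \<omega> * B (p i) \<omega> * (poly r (p j) * poly r (p i))))"
      by (rule Bochner_Integration.integral_sum)
         (intro Bochner_Integration.integrable_sum integrable_mult_left i, auto)
    also have "\<dots> = (\<Sum>i<n. \<Sum>j<n. expectation (\<lambda>\<omega>. B (p j) \<omega> * B (p i) \<omega> * (poly r (p j) * poly r (p i))))"
      by (intro sum.cong refl Bochner_Integration.integral_sum)
         (intro integrable_mult_left i, auto)
    also have "\<dots> = (\<Sum>i<n. \<Sum>j<n. bridge_kernel (p j) (p i) * (poly r (p j) * poly r (p i)))"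
      using p by (intro sum.cong refl) (simp add: value_covariance)
    finally show ?thesis by simp
  qed
  also have "\<dots> = (\<Sum>i<n. (\<Sum>j<n. bridge_kernel (p j) (p i) * poly r (p j) * poly r (p i)) / real n) / real n"
    by (simp add: power2_eq_square sum_divide_distrib mult_ac)
  also have "\<dots> = (\<integral>s. (\<integral>t. bridge_kernel (grid n t) (grid n s) * poly r (grid n t) * poly r (grid n s) \<partial>unit_lebesgue) \<partial>unit_lebesgue)"
    unfolding p_def by (subst integral_grid[OF n], subst integral_grid[OF n]) simp
  finally show ?thesis .
qed

text \<open>
  The right-hand side is the limit of the variances in \<open>Riemann_approx_square\<close>, so the limit law has
  the variance that the integral itself has.
\<close>

lemma expectation_weighted_integral_square:
  "expectation (\<lambda>\<omega>. (weighted_integral r \<omega>)\<^sup>2)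
    = (\<integral>s. (\<integral>t. bridge_kernel t s * poly r t * poly r s \<partial>unit_lebesgue) \<partial>unit_lebesgue)"
proof -
  have "expectation (\<lambda>\<omega>. B s \<omega> * weighted_integral r \<omega>) = (\<integral>t. bridge_kernel t s * poly r t \<partial>unit_lebesgue)"
    if s: "s \<in> {0..1}" for s
  proof -
    have "expectation (\<lambda>\<omega>. B s \<omega> * weighted_integral r \<omega>) = expectation (\<lambda>\<omega>. weighted_integral r \<omega> * B s \<omega>)"
      by (simp add: mult.commute)
    also have "\<dots> = (\<integral>t. expectation (\<lambda>\<omega>. B t \<omega> * B s \<omega>) * poly r t \<partial>unit_lebesgue)"
      by (rule expectation_weighted_integral_mult[OF value_square_integrable[OF s]])
    also have "\<dots> = (\<integral>t. bridge_kernel t s * poly r t \<partial>unit_lebesgue)"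
      using s by (intro Bochner_Integration.integral_cong refl) (simp add: value_covariance space_unit_lebesgue)
    finally show ?thesis .
  qed
  then have "(\<integral>s. expectation (\<lambda>\<omega>. B s \<omega> * weighted_integral r \<omega>) * poly r s \<partial>unit_lebesgue)
     = (\<integral>s. (\<integral>t. bridge_kernel t s * poly r t \<partial>unit_lebesgue) * poly r s \<partial>unit_lebesgue)"
    by (intro Bochner_Integration.integral_cong refl) (simp add: space_unit_lebesgue)
  then show ?thesis
    unfolding power2_eq_square expectation_weighted_integral_mult[OF weighted_integral_square_integrable]
    by simp
qed

text \<open>
  The Riemann sums are centered Gaussian, so they satisfy the identity. Since they converge on every
  path and their variances converge, both sides pass to the limit.
\<close>

lemma char_weighted_integral:
  "(CLINT \<omega>|M. iexp (u * weighted_integral r \<omega>))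
    = exp (- (expectation (\<lambda>\<omega>. (weighted_integral r \<omega>)\<^sup>2) * u\<^sup>2) / 2)"
proof -
  \<comment> \<open>The successor avoids the degenerate sum with \<open>n = 0\<close>.\<close>
  let ?R = "\<lambda>n. Riemann_approx r (Suc n)"
  let ?V = "expectation (\<lambda>\<omega>. (weighted_integral r \<omega>)\<^sup>2)"
  have R [measurable]: "?R n \<in> borel_measurable M" for n
    using Riemann_approx_gaussian[of "Suc n"] by (simp add: gaussian_rv_def)
  have W [measurable]: "weighted_integral r \<in> borel_measurable M" by (rule weighted_integral_measurable)
  have "(\<lambda>n. CLINT \<omega>|M. iexp (u * ?R n \<omega>)) \<longlonglongrightarrow> (CLINT \<omega>|M. iexp (u * weighted_integral r \<omega>))"
  proof (rule integral_dominated_convergence[where w = "\<lambda>_. 1"])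
    show "AE \<omega> in M. (\<lambda>n. iexp (u * ?R n \<omega>)) \<longlonglongrightarrow> iexp (u * weighted_integral r \<omega>)"
      by (intro AE_I2 tendsto_intros LIMSEQ_Suc Riemann_approx_tendsto)
    show "AE \<omega> in M. norm (iexp (u * ?R n \<omega>)) \<le> 1" for n
      by (intro AE_I2) (simp only: norm_exp_i_times order_refl)
  qed auto
  moreover have "(\<lambda>n. expectation (\<lambda>\<omega>. (?R n \<omega>)\<^sup>2)) \<longlonglongrightarrow> ?V"
  proof -
    have "continuous_on ({0..1} \<times> {0..1})
        (\<lambda>x. bridge_kernel (snd x) (fst x) * poly r (snd x) * poly r (fst x))"
      unfolding bridge_kernel_def by (intro continuous_intros)
    from LIMSEQ_Suc[OF Riemann_sum_tendsto_2[OF this]] show ?thesis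
      by (simp add: Riemann_approx_square expectation_weighted_integral_square)
  qed
  then have "(\<lambda>n. complex_of_real (exp (- (expectation (\<lambda>\<omega>. (?R n \<omega>)\<^sup>2) * u\<^sup>2) / 2)))
      \<longlonglongrightarrow> complex_of_real (exp (- (?V * u\<^sup>2) / 2))"
    by (intro tendsto_intros) auto
  moreover have "(CLINT \<omega>|M. iexp (u * ?R n \<omega>)) = exp (- (expectation (\<lambda>\<omega>. (?R n \<omega>)\<^sup>2) * u\<^sup>2) / 2)" for n
    by (rule char_centered_gaussian_rv) (auto intro: Riemann_approx_gaussian Riemann_approx_mean)
  ultimately show ?thesis by (simp only:) (rule LIMSEQ_unique)
qed

lemma weighted_integral_sum:
  assumes L: "finite L" and w: "\<omega> \<in> space M"
  shows "weighted_integral (\<Sum>k\<in>L. smult (a k) (normed_eigenpoly k)) \<omega> = (\<Sum>k\<in>L. a k * bridge_coeff k \<omega>)"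
proof -
  have i: "integrable unit_lebesgue (\<lambda>t. B t \<omega> * poly r t)" for r
    by (intro continuous_on_integrable_unit_lebesgue continuous_intros path_continuous w)
  have "weighted_integral (\<Sum>k\<in>L. smult (a k) (normed_eigenpoly k)) \<omega>
      = (\<integral>t. (\<Sum>k\<in>L. a k * (B t \<omega> * poly (normed_eigenpoly k) t)) \<partial>unit_lebesgue)"
    unfolding weighted_integral_def
    by (intro Bochner_Integration.integral_cong refl) (simp add: poly_sum sum_distrib_left mult_ac)
  also have "\<dots> = (\<Sum>k\<in>L. a k * bridge_coeff k \<omega>)"
    using i by (simp add: bridge_coeff_def weighted_integral_def)
  finally show ?thesis .
qed

lemma expectation_coeff_sum_square:
  assumes L: "finite L" "L \<subseteq> {1..}"
  shows "expectation (\<lambda>\<omega>. (\<Sum>k\<in>L. a k * bridge_coeff k \<omega>)\<^sup>2) = (\<Sum>k\<in>L. (a k)\<^sup>2 * eigenvalue k)"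
proof -
  have i: "integrable M (\<lambda>\<omega>. bridge_coeff i \<omega> * bridge_coeff j \<omega>)" for i j
    by (rule square_integrable_mult[OF bridge_coeff_square_integrable bridge_coeff_square_integrable])
  have "expectation (\<lambda>\<omega>. (\<Sum>k\<in>L. a k * bridge_coeff k \<omega>)\<^sup>2)
    = expectation (\<lambda>\<omega>. \<Sum>i\<in>L. \<Sum>j\<in>L. a i * a j * (bridge_coeff i \<omega> * bridge_coeff j \<omega>))"
    by (simp add: power2_eq_square sum_product mult_ac)
  also have "\<dots> = (\<Sum>i\<in>L. \<Sum>j\<in>L. a i * a j * expectation (\<lambda>\<omega>. bridge_coeff i \<omega> * bridge_coeff j \<omega>))"
    using i by simp
  also have "\<dots> = (\<Sum>i\<in>L. \<Sum>j\<in>L. if i = j then a i * a j * eigenvalue j else 0)"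
    by (intro sum.cong refl, subst expectation_bridge_coeff_mult) (use L in auto)
  also have "\<dots> = (\<Sum>k\<in>L. (a k)\<^sup>2 * eigenvalue k)"
    using L by (simp add: power2_eq_square)
  finally show ?thesis .
qed

text \<open>
  A linear combination of coefficients is again the integral of \<open>B\<close> against a polynomial, and its
  variance is diagonal in the coefficients.
\<close>

lemma char_coeff_sum:
  assumes L: "finite L" "L \<subseteq> {1..}"
  shows "(CLINT \<omega>|M. iexp (\<Sum>k\<in>L. a k * bridge_coeff k \<omega>)) = exp (- (\<Sum>k\<in>L. (a k)\<^sup>2 * eigenvalue k) / 2)"
proof -
  let ?r = "\<Sum>k\<in>L. smult (a k) (normed_eigenpoly k)"
  have eq: "weighted_integral ?r \<omega> = (\<Sum>k\<in>L. a k * bridge_coeff k \<omega>)" if "\<omega> \<in> space M" for \<omega>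
    by (rule weighted_integral_sum[OF L(1) that])
  have "(CLINT \<omega>|M. iexp (\<Sum>k\<in>L. a k * bridge_coeff k \<omega>)) = (CLINT \<omega>|M. iexp (1 * weighted_integral ?r \<omega>))"
    by (intro Bochner_Integration.integral_cong refl) (simp only: eq mult_1)
  also have "\<dots> = exp (- (expectation (\<lambda>\<omega>. (weighted_integral ?r \<omega>)\<^sup>2) * 1\<^sup>2) / 2)"
    by (rule char_weighted_integral)
  also have "expectation (\<lambda>\<omega>. (weighted_integral ?r \<omega>)\<^sup>2) = expectation (\<lambda>\<omega>. (\<Sum>k\<in>L. a k * bridge_coeff k \<omega>)\<^sup>2)"
    by (intro Bochner_Integration.integral_cong refl) (simp only: eq)
  finally show ?thesis by (simp add: expectation_coeff_sum_square[OF L])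
qed

lemma char_coeff:
  assumes "1 \<le> k"
  shows "(CLINT \<omega>|M. iexp (u * bridge_coeff k \<omega>)) = exp (- (eigenvalue k * u\<^sup>2) / 2)"
  using char_coeff_sum[of "{k}" "\<lambda>_. u"] assms by (simp add: mult.commute)

lemma indep_bridge_coeff: "indep_vars (\<lambda>_. borel) bridge_coeff {1..}"
proof (rule indep_vars_if_char_product)
  show "bridge_coeff k \<in> borel_measurable M" for k
    using bridge_coeff_square_integrable by (simp add: square_integrable_def)
  fix L :: "nat set" and a :: "nat \<Rightarrow> real"
  assume L: "finite L" "L \<subseteq> {1..}"
  have "(\<Prod>k\<in>L. CLINT \<omega>|M. iexp (a k * bridge_coeff k \<omega>))
      = (\<Prod>k\<in>L. complex_of_real (exp (- (eigenvalue k * (a k)\<^sup>2) / 2)))"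
    using L by (intro prod.cong refl char_coeff) auto
  also have "\<dots> = complex_of_real (exp (\<Sum>k\<in>L. - (eigenvalue k * (a k)\<^sup>2) / 2))"
    unfolding exp_sum[OF L(1)] by simp
  also have "\<dots> = (CLINT \<omega>|M. iexp (\<Sum>k\<in>L. a k * bridge_coeff k \<omega>))"
    unfolding char_coeff_sum[OF L] by (simp add: sum_negf sum_divide_distrib mult.commute)
  finally show "(CLINT \<omega>|M. iexp (\<Sum>k\<in>L. a k * bridge_coeff k \<omega>))
      = (\<Prod>k\<in>L. CLINT \<omega>|M. iexp (a k * bridge_coeff k \<omega>))" by (rule sym)
qed

lemma gaussian_bridge_coeff:
  assumes k: "1 \<le> k"
  shows "gaussian_rv M (bridge_coeff k)"
proof -
  have pos: "0 < sqrt (eigenvalue k)" using eigenvalue_pos[OF k] by simp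
  have m: "bridge_coeff k \<in> borel_measurable M"
    using bridge_coeff_square_integrable by (simp add: square_integrable_def)
  have "distributed M lborel (bridge_coeff k) (normal_density 0 (sqrt (eigenvalue k)))"
    by (rule centered_normal_if_char[OF pos m])
       (use char_coeff[OF k] eigenvalue_pos[OF k] in simp)
  then show ?thesis using pos m unfolding gaussian_rv_def by blast
qed

end

section \<open>Pointwise convergence of the series\<close>

context brownian_bridge
begin

text \<open>
  The hypothesis on \<open>y\<close> says that the sum is the orthogonal projection of \<open>Y\<close> onto the span of the
  coefficients, so this is the theorem of Pythagoras. It is applied to \<open>Y = B\<^sub>t\<close> and to
  increments \<open>Y = B\<^sub>t - B\<^sub>s\<close>.
\<close>

lemma expectation_remainder_square:
  assumes Y: "square_integrable M Y" and L: "finite L" "L \<subseteq> {1..}"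
    and y: "\<And>k. k \<in> L \<Longrightarrow> expectation (\<lambda>\<omega>. Y \<omega> * bridge_coeff k \<omega>) = eigenvalue k * y k"
  shows "expectation (\<lambda>\<omega>. (Y \<omega> - (\<Sum>k\<in>L. y k * bridge_coeff k \<omega>))\<^sup>2)
    = expectation (\<lambda>\<omega>. (Y \<omega>)\<^sup>2) - (\<Sum>k\<in>L. eigenvalue k * (y k)\<^sup>2)"
proof -
  have S: "square_integrable M (\<lambda>\<omega>. \<Sum>k\<in>L. y k * bridge_coeff k \<omega>)"
    by (intro square_integrable_sum square_integrable_cmult bridge_coeff_square_integrable)
  have YS: "expectation (\<lambda>\<omega>. Y \<omega> * (\<Sum>k\<in>L. y k * bridge_coeff k \<omega>)) = (\<Sum>k\<in>L. eigenvalue k * (y k)\<^sup>2)"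
  proof -
    have i: "integrable M (\<lambda>\<omega>. Y \<omega> * bridge_coeff k \<omega>)" for k
      by (rule square_integrable_mult[OF Y bridge_coeff_square_integrable])
    have "expectation (\<lambda>\<omega>. Y \<omega> * (\<Sum>k\<in>L. y k * bridge_coeff k \<omega>))
       = expectation (\<lambda>\<omega>. \<Sum>k\<in>L. y k * (Y \<omega> * bridge_coeff k \<omega>))"
      by (simp add: sum_distrib_left mult_ac)
    also have "\<dots> = (\<Sum>k\<in>L. y k * expectation (\<lambda>\<omega>. Y \<omega> * bridge_coeff k \<omega>))"
      using i by simp
    also have "\<dots> = (\<Sum>k\<in>L. eigenvalue k * (y k)\<^sup>2)"
      by (intro sum.cong refl) (simp add: y power2_eq_square)
    finally show ?thesis .
  qed
  have "expectation (\<lambda>\<omega>. (Y \<omega> - (\<Sum>k\<in>L. y k * bridge_coeff k \<omega>))\<^sup>2)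
    = expectation (\<lambda>\<omega>. (Y \<omega>)\<^sup>2 - 2 * (Y \<omega> * (\<Sum>k\<in>L. y k * bridge_coeff k \<omega>)) + (\<Sum>k\<in>L. y k * bridge_coeff k \<omega>)\<^sup>2)"
    by (simp add: power2_diff mult.assoc algebra_simps)
  also have "\<dots> = expectation (\<lambda>\<omega>. (Y \<omega>)\<^sup>2) - 2 * expectation (\<lambda>\<omega>. Y \<omega> * (\<Sum>k\<in>L. y k * bridge_coeff k \<omega>))
      + expectation (\<lambda>\<omega>. (\<Sum>k\<in>L. y k * bridge_coeff k \<omega>)\<^sup>2)"
  proof -
    note i = Y[unfolded square_integrable_def, THEN conjunct2] S[unfolded square_integrable_def, THEN conjunct2]
      square_integrable_mult[OF Y S]
    show ?thesis
      by (simp only: Bochner_Integration.integral_add Bochner_Integration.integral_diff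
          integrable_mult_right Bochner_Integration.integrable_diff integral_mult_right_zero i)
  qed
  finally show ?thesis
    unfolding YS expectation_coeff_sum_square[OF L] by (simp add: mult.commute)
qed

definition remainder :: "nat \<Rightarrow> real \<Rightarrow> 'a \<Rightarrow> real" where
  "remainder N t \<omega> = B t \<omega> - (\<Sum>k=1..N. poly (eigenfunction k) t * bridge_coeff k \<omega>)"

definition mean_square_error :: "nat \<Rightarrow> real \<Rightarrow> real" where
  "mean_square_error N t = t * (1 - t) - (\<Sum>k=1..N. eigenvalue k * (poly (eigenfunction k) t)\<^sup>2)"

lemma remainder_square_integrable: "t \<in> {0..1} \<Longrightarrow> square_integrable M (remainder N t)"
  unfolding remainder_def
  by (intro square_integrable_diff square_integrable_sum square_integrable_cmult
      bridge_coeff_square_integrable value_square_integrable)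

lemma expectation_remainder:
  assumes t: "t \<in> {0..1}"
  shows "expectation (\<lambda>\<omega>. (remainder N t \<omega>)\<^sup>2) = mean_square_error N t"
proof -
  have "expectation (\<lambda>\<omega>. (remainder N t \<omega>)\<^sup>2)
     = expectation (\<lambda>\<omega>. (B t \<omega>)\<^sup>2) - (\<Sum>k=1..N. eigenvalue k * (poly (eigenfunction k) t)\<^sup>2)"
    unfolding remainder_def
    by (rule expectation_remainder_square[OF value_square_integrable[OF t]])
       (use t in \<open>auto intro: expectation_bridge_coeff_value\<close>)
  also have "expectation (\<lambda>\<omega>. (B t \<omega>)\<^sup>2) = t * (1 - t)"
    using value_covariance[OF t t] by (simp add: bridge_kernel_def power2_eq_square algebra_simps)
  finally show ?thesis by (simp add: mean_square_error_def)
qed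

lemma mean_square_error_nonneg: "t \<in> {0..1} \<Longrightarrow> 0 \<le> mean_square_error N t"
  unfolding expectation_remainder[symmetric] by (rule Bochner_Integration.integral_nonneg) simp

text \<open>
  The increment of the remainder is the remainder of the increment of \<open>B\<close>, so its second moment is at
  most \<open>E[(B\<^sub>t - B\<^sub>s)\<^sup>2] = \<bar>t - s\<bar> - (t - s)\<^sup>2\<close>, uniformly in \<open>N\<close>.
\<close>

lemma mean_square_error_increment:
  assumes s: "s \<in> {0..1}" and t: "t \<in> {0..1}"
  shows "mean_square_error N t \<le> 2 * mean_square_error N s + 2 * \<bar>t - s\<bar>"
proof -
  let ?y = "\<lambda>k. poly (eigenfunction k) t - poly (eigenfunction k) s"
  have D: "square_integrable M (\<lambda>\<omega>. B t \<omega> - B s \<omega>)"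
    by (intro square_integrable_diff value_square_integrable s t)
  have rd: "remainder N t \<omega> - remainder N s \<omega> = (B t \<omega> - B s \<omega>) - (\<Sum>k=1..N. ?y k * bridge_coeff k \<omega>)" for \<omega>
    by (simp add: remainder_def left_diff_distrib sum_subtractf)
  have "expectation (\<lambda>\<omega>. (remainder N t \<omega> - remainder N s \<omega>)\<^sup>2)
     = expectation (\<lambda>\<omega>. (B t \<omega> - B s \<omega>)\<^sup>2) - (\<Sum>k=1..N. eigenvalue k * (?y k)\<^sup>2)"
    unfolding rd
  proof (rule expectation_remainder_square[OF D])
    fix k assume "k \<in> {1..N}"
    then have k: "1 \<le> k" by simp
    have i: "integrable M (\<lambda>\<omega>. B r \<omega> * bridge_coeff k \<omega>)" if "r \<in> {0..1}" for r
      by (rule square_integrable_mult[OF value_square_integrable[OF that] bridge_coeff_square_integrable])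
    show "expectation (\<lambda>\<omega>. (B t \<omega> - B s \<omega>) * bridge_coeff k \<omega>) = eigenvalue k * ?y k"
      using i[OF s] i[OF t] expectation_bridge_coeff_value[OF k s] expectation_bridge_coeff_value[OF k t]
      by (simp add: left_diff_distrib right_diff_distrib)
  qed auto
  also have "\<dots> \<le> expectation (\<lambda>\<omega>. (B t \<omega> - B s \<omega>)\<^sup>2)"
  proof -
    have "0 \<le> (\<Sum>k=1..N. eigenvalue k * (?y k)\<^sup>2)"
      by (rule sum_nonneg) (simp add: eigenvalue_pos less_imp_le)
    then show ?thesis by simp
  qed
  also have "\<dots> = expectation (\<lambda>\<omega>. B t \<omega> * B t \<omega> - 2 * (B s \<omega> * B t \<omega>) + B s \<omega> * B s \<omega>)"
    by (simp add: power2_eq_square algebra_simps)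
  also have "\<dots> = bridge_kernel t t - 2 * bridge_kernel s t + bridge_kernel s s"
  proof -
    have i: "integrable M (\<lambda>\<omega>. B r \<omega> * B r' \<omega>)" if "r \<in> {0..1}" "r' \<in> {0..1}" for r r'
      by (intro square_integrable_mult value_square_integrable that)
    show ?thesis using i[OF t t] i[OF s t] i[OF s s] s t by (simp add: value_covariance)
  qed
  also have "\<dots> = \<bar>t - s\<bar> - (t - s)\<^sup>2"
    by (auto simp: bridge_kernel_def min_def abs_if power2_eq_square algebra_simps)
  also have "\<dots> \<le> \<bar>t - s\<bar>" by simp
  finally have inc: "expectation (\<lambda>\<omega>. (remainder N t \<omega> - remainder N s \<omega>)\<^sup>2) \<le> \<bar>t - s\<bar>" .
  have "mean_square_error N t = expectation (\<lambda>\<omega>. (remainder N s \<omega> + (remainder N t \<omega> - remainder N s \<omega>))\<^sup>2)"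
    by (simp add: expectation_remainder[OF t])
  also have "\<dots> \<le> 2 * expectation (\<lambda>\<omega>. (remainder N s \<omega>)\<^sup>2)
      + 2 * expectation (\<lambda>\<omega>. (remainder N t \<omega> - remainder N s \<omega>)\<^sup>2)"
    by (intro square_integral_add_le square_integrable_diff remainder_square_integrable s t)
  finally show ?thesis using inc by (simp add: expectation_remainder[OF s])
qed

lemma continuous_on_mean_square_error: "continuous_on A (mean_square_error N)"
  unfolding mean_square_error_def[abs_def] by (intro continuous_intros)

text \<open>
  Dividing the error by \<open>t (1 - t)\<close> only increases it, and the quotient integrates to
  \<open>1 - \<Sum>\<^bsub>k\<le>N\<^esub> \<lambda>\<^sub>k\<close>.
\<close>

lemma integral_mean_square_error_le: "(\<integral>t. mean_square_error N t \<partial>unit_lebesgue) \<le> 1 / (real N + 1)"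
proof -
  \<comment> \<open>the mean square error divided by \<open>t (1 - t)\<close>, as a continuous function up to the boundary\<close>
  define \<rho> where "\<rho> t = 1 - (\<Sum>k=1..N. eigenvalue k * (poly (eigenfunction k) t * poly (normed_eigenpoly k) t))" for t
  have m: "mean_square_error N t = t * (1 - t) * \<rho> t" for t
  proof -
    have "eigenvalue k * (poly (eigenfunction k) t)\<^sup>2
      = t * (1 - t) * (eigenvalue k * (poly (eigenfunction k) t * poly (normed_eigenpoly k) t))" for k
      by (simp add: poly_eigenfunction power2_eq_square mult_ac)
    then have "(\<Sum>k=1..N. eigenvalue k * (poly (eigenfunction k) t)\<^sup>2)
      = t * (1 - t) * (\<Sum>k=1..N. eigenvalue k * (poly (eigenfunction k) t * poly (normed_eigenpoly k) t))"
      unfolding sum_distrib_left by (rule sum.cong[OF refl])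
    moreover have "w - w * S = w * (1 - S)" for w S :: real by (simp add: right_diff_distrib)
    ultimately show ?thesis unfolding mean_square_error_def \<rho>_def by (simp only:)
  qed
  have i: "integrable unit_lebesgue (\<lambda>t. poly (eigenfunction k) t * poly (normed_eigenpoly k) t)" for k
    by (intro continuous_on_integrable_unit_lebesgue continuous_intros)
  have "(\<integral>t. mean_square_error N t \<partial>unit_lebesgue) \<le> (\<integral>t. \<rho> t \<partial>unit_lebesgue)"
  proof (rule integral_mono_AE)
    show "integrable unit_lebesgue (mean_square_error N)"
      by (rule continuous_on_integrable_unit_lebesgue[OF continuous_on_mean_square_error])
    show "integrable unit_lebesgue \<rho>"
      unfolding \<rho>_def[abs_def] by (intro continuous_on_integrable_unit_lebesgue continuous_intros)
    show "AE t in unit_lebesgue. mean_square_error N t \<le> \<rho> t"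
      using AE_unit_lebesgue_interior
    proof eventually_elim
      case (elim t)
      then have w: "0 < t * (1 - t)" by simp
      have "0 \<le> t * (1 - t) * \<rho> t" using mean_square_error_nonneg[of t N] elim m by simp
      then have "0 \<le> \<rho> t" using w by (simp add: zero_le_mult_iff)
      moreover have "t * (1 - t) \<le> 1 * 1" using elim by (intro mult_mono) auto
      ultimately have "t * (1 - t) * \<rho> t \<le> 1 * \<rho> t" by (intro mult_right_mono) auto
      then show ?case using m by simp
    qed
  qed
  also have "\<dots> = 1 - (\<Sum>k=1..N. eigenvalue k)"
    using i integral_eigenfunction_normed_eigenpoly
    by (simp add: \<rho>_def unit_lebesgue.prob_space[unfolded space_unit_lebesgue] space_unit_lebesgue)
  also have "\<dots> = 1 / (real N + 1)" unfolding sum_eigenvalue by simp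
  finally show ?thesis .
qed

text \<open>
  Averaging \<open>mean_square_error_increment\<close> over an interval of length \<open>d\<close> around \<open>t\<close> bounds the error
  by \<open>2 / (d (N + 1)) + 2 d\<close>; the choice \<open>d = 1 / sqrt (N + 1)\<close> balances the two terms.
\<close>

lemma mean_square_error_bound:
  assumes t: "t \<in> {0..1}"
  shows "mean_square_error N t \<le> 4 / sqrt (real N + 1)"
proof -
  define d where "d = 1 / sqrt (real N + 1)"
  have d: "0 < d" "d \<le> 1" by (auto simp: d_def)
  have dd: "d * d = 1 / (real N + 1)" by (simp add: d_def)
  \<comment> \<open>the interval \<open>[a, a + d]\<close> contains \<open>t\<close> and stays inside \<open>[0, 1]\<close>\<close>
  define a where "a = t * (1 - d)"
  have a: "0 \<le> a" "a \<le> t" "t \<le> a + d" "a + d \<le> 1"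
  proof -
    show "0 \<le> a" using t d by (simp add: a_def)
    show "a \<le> t" using t d mult_left_mono[of "1 - d" 1 t] by (simp add: a_def)
    have "0 \<le> (1 - t) * d" using t d by simp
    then show "t \<le> a + d" by (simp add: a_def algebra_simps)
    have "0 \<le> (1 - t) * (1 - d)" using t d by simp
    then show "a + d \<le> 1" by (simp add: a_def algebra_simps)
  qed
  define J where "J = {a..a + d}"
  have Jm: "(\<lambda>s. indicator J s :: real) \<in> borel_measurable unit_lebesgue"
    unfolding J_def by (intro borel_measurable_unit_lebesgueI) measurable
  have Ji: "integrable unit_lebesgue (\<lambda>s. indicator J s :: real)"
    by (rule unit_lebesgue.integrable_const_bound[OF _ Jm, of 1]) (simp add: indicator_def)
  have Jd: "(\<integral>s. indicator J s \<partial>unit_lebesgue) = d"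
  proof -
    have "(\<integral>s. indicator J s * indicator {0..1} s \<partial>lborel) = (\<integral>s. indicator J s \<partial>lborel :: real)"
      using a by (intro Bochner_Integration.integral_cong refl) (auto simp: J_def indicator_def)
    then show ?thesis using d unfolding integral_unit_lebesgue by (simp add: J_def)
  qed
  have mi: "integrable unit_lebesgue (mean_square_error N)"
    by (rule continuous_on_integrable_unit_lebesgue[OF continuous_on_mean_square_error])
  have "d * mean_square_error N t = (\<integral>s. mean_square_error N t * indicator J s \<partial>unit_lebesgue)"
    using Ji Jd by simp
  also have "\<dots> \<le> (\<integral>s. 2 * mean_square_error N s + 2 * d * indicator J s \<partial>unit_lebesgue)"
  proof (rule integral_mono)
    fix s assume "s \<in> space unit_lebesgue"
    then have s: "s \<in> {0..1}" by (simp add: space_unit_lebesgue)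
    show "mean_square_error N t * indicator J s \<le> 2 * mean_square_error N s + 2 * d * indicator J s"
    proof (cases "s \<in> J")
      case True
      then have "\<bar>t - s\<bar> \<le> d" using a by (auto simp: J_def)
      then show ?thesis using mean_square_error_increment[OF s t, of N] True by simp
    qed (simp add: mean_square_error_nonneg[OF s])
  qed (use Ji mi in auto)
  also have "\<dots> = 2 * (\<integral>s. mean_square_error N s \<partial>unit_lebesgue) + 2 * d * d"
    using Ji mi Jd by simp
  also have "\<dots> \<le> d * (4 * d)"
    using integral_mean_square_error_le[of N] dd by simp
  finally have "mean_square_error N t \<le> 4 * d" using d by simp
  then show ?thesis by (simp add: d_def)
qed

lemma bridge_series_converges:
  assumes t: "t \<in> {0..1}"
  shows "(\<lambda>N. \<integral>\<^sup>+\<omega>. ennreal (((\<Sum>k=1..N. bridge_coeff k \<omega> * poly (eigenfunction k) t) - B t \<omega>)\<^sup>2) \<partial>M) \<longlonglongrightarrow> 0"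
proof -
  have eq: "(\<integral>\<^sup>+\<omega>. ennreal (((\<Sum>k=1..N. bridge_coeff k \<omega> * poly (eigenfunction k) t) - B t \<omega>)\<^sup>2) \<partial>M)
     = ennreal (mean_square_error N t)" for N
  proof -
    have "(\<integral>\<^sup>+\<omega>. ennreal (((\<Sum>k=1..N. bridge_coeff k \<omega> * poly (eigenfunction k) t) - B t \<omega>)\<^sup>2) \<partial>M)
       = (\<integral>\<^sup>+\<omega>. ennreal ((remainder N t \<omega>)\<^sup>2) \<partial>M)"
      by (simp add: remainder_def power2_commute mult.commute)
    also have "\<dots> = ennreal (expectation (\<lambda>\<omega>. (remainder N t \<omega>)\<^sup>2))"
      using remainder_square_integrable[OF t] by (intro nn_integral_eq_integral) (auto simp: square_integrable_def)
    finally show ?thesis by (simp add: expectation_remainder[OF t])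
  qed
  have "(\<lambda>N. 4 / sqrt (real N + 1)) \<longlonglongrightarrow> 0" by real_asymp
  then have "(\<lambda>N. mean_square_error N t) \<longlonglongrightarrow> 0"
    by (rule tendsto_sandwich[OF _ _ tendsto_const, rotated 2])
       (auto simp: mean_square_error_nonneg[OF t] mean_square_error_bound[OF t])
  then show ?thesis unfolding eq using tendsto_ennrealI by fastforce
qed

end

section \<open>Optimality of the eigenfunctions\<close>

text \<open>
  The combinatorial core of Ky Fan's maximum principle. Comparing with the level \<open>l n\<close>, the bound
  \<open>a\<^sub>j l\<^sub>j \<le> l\<^sub>n a\<^sub>j + max 0 (l\<^sub>j - l\<^sub>n)\<close> uses \<open>a\<^sub>j \<le> 1\<close>; the first terms add up to at most \<open>n l\<^sub>n\<close> and the
  second ones vanish for \<open>j \<ge> n\<close>.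
\<close>

lemma weighted_sum_le_leading_sum:
  fixes a l :: "nat \<Rightarrow> real"
  assumes n: "1 \<le> n" and a: "\<And>j. 0 \<le> a j" "\<And>j. 1 \<le> j \<Longrightarrow> a j \<le> 1" "(\<Sum>j=1..N. a j) \<le> real n"
    and l: "\<And>j. 1 \<le> j \<Longrightarrow> 0 \<le> l j" "\<And>i j. 1 \<le> i \<Longrightarrow> i \<le> j \<Longrightarrow> l j \<le> l i"
  shows "(\<Sum>j=1..N. a j * l j) \<le> (\<Sum>j=1..n. l j)"
proof -
  have "(\<Sum>j=1..N. a j * l j) \<le> (\<Sum>j=1..N. l n * a j + max 0 (l j - l n))"
  proof (rule sum_mono)
    fix j assume "j \<in> {1..N}"
    then have "a j \<le> 1" using a by simp
    then have "a j * (l j - l n) \<le> max 0 (l j - l n)"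
      using a(1)[of j] by (cases "0 \<le> l j - l n")
        (auto simp: mult_le_cancel_right1 mult_nonneg_nonpos intro: order_trans[OF mult_right_mono])
    then show "a j * l j \<le> l n * a j + max 0 (l j - l n)" by (simp add: algebra_simps)
  qed
  also have "\<dots> = l n * (\<Sum>j=1..N. a j) + (\<Sum>j=1..N. max 0 (l j - l n))"
    by (simp add: sum.distrib sum_distrib_left)
  also have "l n * (\<Sum>j=1..N. a j) \<le> l n * real n" using a l n by (intro mult_left_mono) auto
  also have "(\<Sum>j=1..N. max 0 (l j - l n)) \<le> (\<Sum>j\<in>{1..N} \<union> {1..n}. max 0 (l j - l n))"
    by (rule sum_mono2) auto
  also have "\<dots> = (\<Sum>j=1..n. max 0 (l j - l n))"
    by (rule sum.mono_neutral_right) (use l n in auto)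
  also have "\<dots> = (\<Sum>j=1..n. l j - l n)"
    by (intro sum.cong refl) (use l in \<open>auto simp: max_def\<close>)
  finally show ?thesis by (simp add: sum_subtractf mult.commute)
qed

text \<open>
  With \<open>d\<close> small this keeps the main term \<open>x\<^sup>2\<close> nearly intact, at the price of a large multiple of a
  remainder that tends to 0.
\<close>

lemma weighted_square_le:
  fixes x y d :: real assumes "0 < d"
  shows "(x + y)\<^sup>2 \<le> (1 + d) * x\<^sup>2 + (1 + 1 / d) * y\<^sup>2"
proof -
  have "(1 + d) * x\<^sup>2 + (1 + 1 / d) * y\<^sup>2 - (x + y)\<^sup>2 = (d * x - y)\<^sup>2 / d"
    using assms by (simp add: power2_eq_square field_simps)
  moreover have "0 \<le> (d * x - y)\<^sup>2 / d" using assms by simp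
  ultimately show ?thesis by linarith
qed

context brownian_bridge
begin

lemma poly_coeff_eigenfunction:
  assumes w: "\<omega> \<in> space M"
  shows "poly_coeff B (eigenfunction k) \<omega> = bridge_coeff k \<omega>"
proof -
  have "poly_coeff B (eigenfunction k) \<omega>
     = (\<integral>t. B t \<omega> * (poly (eigenfunction k) t / (t * (1 - t))) \<partial>unit_lebesgue)"
    unfolding poly_coeff_def integral_unit_lebesgue set_lebesgue_integral_def by (simp add: mult.commute)
  also have "\<dots> = bridge_coeff k \<omega>"
    unfolding bridge_coeff_def weighted_integral_def
  proof (rule integral_cong_AE)
    have "(\<lambda>t. B t \<omega> * poly (eigenfunction k) t * (1 / (t * (1 - t)))) \<in> borel_measurable unit_lebesgue"
      by (intro borel_measurable_times bridge_density_measurable path_measurable[OF w]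
          borel_measurable_unit_lebesgueI borel_measurable_poly)
    then show "(\<lambda>t. B t \<omega> * (poly (eigenfunction k) t / (t * (1 - t)))) \<in> borel_measurable unit_lebesgue"
      by simp
    show "(\<lambda>t. B t \<omega> * poly (normed_eigenpoly k) t) \<in> borel_measurable unit_lebesgue"
      by (intro borel_measurable_times path_measurable[OF w] borel_measurable_unit_lebesgueI borel_measurable_poly)
    show "AE t in unit_lebesgue. B t \<omega> * (poly (eigenfunction k) t / (t * (1 - t))) = B t \<omega> * poly (normed_eigenpoly k) t"
      using AE_unit_lebesgue_interior by eventually_elim (simp add: poly_eigenfunction)
  qed
  finally show ?thesis .
qed

lemma mu_coeff_eigenfunction:
  assumes w: "\<omega> \<in> space M"
  shows "mu_coeff B (poly (eigenfunction k)) \<omega> = bridge_coeff k \<omega>"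
proof -
  have "mu_coeff B (poly (eigenfunction k)) \<omega>
     = (\<integral>t. t * (1 - t) * (B t \<omega> * poly (normed_eigenpoly k) t) \<partial>bridge_measure)"
    by (simp add: mu_coeff_def poly_eigenfunction mult_ac)
  also have "\<dots> = bridge_coeff k \<omega>"
    unfolding bridge_coeff_def weighted_integral_def
    by (intro integral_bridge_measure_weight(1) borel_measurable_times path_measurable[OF w]
        borel_measurable_unit_lebesgueI borel_measurable_poly)
  finally show ?thesis .
qed

lemma measurable_snd_bridge:
  "f \<in> borel_measurable bridge_measure \<Longrightarrow> (\<lambda>x. f (snd x)) \<in> borel_measurable (M \<Otimes>\<^sub>M bridge_measure)"
  by (rule measurable_compose[OF measurable_snd])

lemma mu_coeff_measurable:
  assumes "f \<in> borel_measurable bridge_measure"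
  shows "mu_coeff B f \<in> borel_measurable M"
proof -
  have "(\<lambda>x. (case x of (\<omega>, t) \<Rightarrow> B t \<omega>) * f (snd x)) \<in> borel_measurable (M \<Otimes>\<^sub>M bridge_measure)"
    by (intro borel_measurable_times jointly_measurable measurable_snd_bridge assms)
  then have "(\<lambda>(\<omega>, t). B t \<omega> * f t) \<in> borel_measurable (M \<Otimes>\<^sub>M bridge_measure)"
    by (simp add: case_prod_beta)
  then show ?thesis
    unfolding mu_coeff_def by (rule bridge_measure.borel_measurable_lebesgue_integral)
qed

lemma mu_coeff_square_integrable:
  assumes f: "orthonormal_on bridge_measure I f" and k: "k \<in> I"
  shows "square_integrable M (mu_coeff B (f k))"
proof -
  have fk: "square_integrable bridge_measure (f k)" using f k by (simp add: orthonormal_on_def)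
  have m: "mu_coeff B (f k) \<in> borel_measurable M"
    using fk by (intro mu_coeff_measurable) (simp add: square_integrable_def)
  have "integrable M (\<lambda>\<omega>. (mu_coeff B (f k) \<omega>)\<^sup>2)"
  proof (rule Bochner_Integration.integrable_bound[OF integrable_path_norm])
    show "(\<lambda>\<omega>. (mu_coeff B (f k) \<omega>)\<^sup>2) \<in> borel_measurable M" by (rule borel_measurable_power[OF m])
    show "AE \<omega> in M. norm ((mu_coeff B (f k) \<omega>)\<^sup>2) \<le> norm (\<integral>t. (B t \<omega>)\<^sup>2 \<partial>bridge_measure)"
      using AE_path_square_integrable
    proof eventually_elim
      case (elim \<omega>)
      have "(\<Sum>j\<in>{k}. (\<integral>t. B t \<omega> * f j t \<partial>bridge_measure)\<^sup>2) \<le> (\<integral>t. (B t \<omega>)\<^sup>2 \<partial>bridge_measure)"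
        by (rule Bessel_inequality[OF _ _ elim]) (use f k in \<open>auto simp: orthonormal_on_def\<close>)
      then show ?case by (simp add: mu_coeff_def)
    qed
  qed
  then show ?thesis using m by (simp add: square_integrable_def)
qed

text \<open>
  Almost every path lies in \<open>L\<^sup>2(\<mu>)\<close>, where Bessel's identity gives the squared distance to the span of
  the \<open>f\<^sub>k\<close>; then take expectations. The variables \<open>J\<close> are a parameter since the coefficients of the
  eigenfunctions come as \<open>poly_coeff\<close>, \<open>bridge_coeff\<close> or \<open>mu_coeff\<close>, which agree only on the space
  of the probability measure.
\<close>

lemma truncation_error:
  assumes I: "finite I" and f: "orthonormal_on bridge_measure I f"
    and J: "\<forall>k\<in>I. \<forall>\<omega>\<in>space M. J k \<omega> = mu_coeff B (f k) \<omega>"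
  shows "square_mu_integrable M (\<lambda>s \<omega>. B s \<omega> - (\<Sum>k\<in>I. J k \<omega> * f k s))" (is ?sq)
    and "integrable M (\<lambda>\<omega>. \<integral>s. (B s \<omega> - (\<Sum>k\<in>I. J k \<omega> * f k s))\<^sup>2 \<partial>bridge_measure)" (is ?int)
    and "expectation (\<lambda>\<omega>. \<integral>s. (B s \<omega> - (\<Sum>k\<in>I. J k \<omega> * f k s))\<^sup>2 \<partial>bridge_measure)
      = 1 - (\<Sum>k\<in>I. expectation (\<lambda>\<omega>. (mu_coeff B (f k) \<omega>)\<^sup>2))" (is ?exp)
proof -
  let ?E = "\<lambda>s \<omega>. B s \<omega> - (\<Sum>k\<in>I. J k \<omega> * f k s)"
  let ?D = "\<lambda>\<omega>. (\<integral>s. (B s \<omega>)\<^sup>2 \<partial>bridge_measure) - (\<Sum>k\<in>I. (mu_coeff B (f k) \<omega>)\<^sup>2)"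
  have fk: "square_integrable bridge_measure (f k)" if "k \<in> I" for k
    using f that by (simp add: orthonormal_on_def)
  have Jm: "J k \<in> borel_measurable M" if k: "k \<in> I" for k
  proof -
    have "mu_coeff B (f k) \<in> borel_measurable M"
      using fk[OF k] by (intro mu_coeff_measurable) (simp add: square_integrable_def)
    then show ?thesis using J k by (simp cong: measurable_cong)
  qed
  have jm: "(\<lambda>(\<omega>, s). ?E s \<omega>) \<in> borel_measurable (M \<Otimes>\<^sub>M bridge_measure)"
  proof -
    have "(\<lambda>x. (case x of (\<omega>, s) \<Rightarrow> B s \<omega>) - (\<Sum>k\<in>I. J k (fst x) * f k (snd x)))
       \<in> borel_measurable (M \<Otimes>\<^sub>M bridge_measure)"
      using fk
      by (intro borel_measurable_diff jointly_measurable borel_measurable_sum borel_measurable_times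
          measurable_snd_bridge measurable_compose[OF measurable_fst Jm]) (auto simp: square_integrable_def)
    then show ?thesis by (simp add: case_prod_beta)
  qed
  have path: "square_integrable bridge_measure (\<lambda>s. ?E s \<omega>)"
    if "square_integrable bridge_measure (\<lambda>s. B s \<omega>)" for \<omega>
    by (intro square_integrable_diff square_integrable_sum square_integrable_cmult that fk)
  have ae: "AE \<omega> in M. (\<integral>s. (?E s \<omega>)\<^sup>2 \<partial>bridge_measure) = ?D \<omega>"
    using AE_path_square_integrable AE_space
  proof eventually_elim
    case (elim \<omega>)
    show ?case
      using Bessel_identity[OF I f elim(1)] J elim(2) by (simp add: mu_coeff_def)
  qed
  have iJ: "integrable M (\<lambda>\<omega>. (mu_coeff B (f k) \<omega>)\<^sup>2)" if "k \<in> I" for k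
    using mu_coeff_square_integrable[OF f that] by (simp add: square_integrable_def)
  have iD: "integrable M ?D" using integrable_path_norm iJ by auto
  have Em: "(\<lambda>\<omega>. \<integral>s. (?E s \<omega>)\<^sup>2 \<partial>bridge_measure) \<in> borel_measurable M"
  proof -
    have "(\<lambda>x. (case x of (\<omega>, s) \<Rightarrow> ?E s \<omega>)\<^sup>2) \<in> borel_measurable (M \<Otimes>\<^sub>M bridge_measure)"
      by (rule borel_measurable_power[OF jm])
    then have "(\<lambda>(\<omega>, s). (?E s \<omega>)\<^sup>2) \<in> borel_measurable (M \<Otimes>\<^sub>M bridge_measure)"
      by (simp add: case_prod_beta)
    then show ?thesis by (rule bridge_measure.borel_measurable_lebesgue_integral)
  qed
  show ?int
    using integrable_cong_AE[OF Em borel_measurable_integrable[OF iD] ae] iD by simp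
  have "expectation (\<lambda>\<omega>. \<integral>s. (?E s \<omega>)\<^sup>2 \<partial>bridge_measure) = expectation ?D"
    by (rule integral_cong_AE[OF Em borel_measurable_integrable[OF iD] ae])
  also have "\<dots> = 1 - (\<Sum>k\<in>I. expectation (\<lambda>\<omega>. (mu_coeff B (f k) \<omega>)\<^sup>2))"
    using integrable_path_norm iJ expectation_path_norm by simp
  finally show ?exp .
  have "(\<integral>\<^sup>+\<omega>. (\<integral>\<^sup>+s. ennreal ((?E s \<omega>)\<^sup>2) \<partial>bridge_measure) \<partial>M)
     = (\<integral>\<^sup>+\<omega>. ennreal (\<integral>s. (?E s \<omega>)\<^sup>2 \<partial>bridge_measure) \<partial>M)"
  proof (rule nn_integral_cong_AE)
    show "AE \<omega> in M. (\<integral>\<^sup>+s. ennreal ((?E s \<omega>)\<^sup>2) \<partial>bridge_measure) = ennreal (\<integral>s. (?E s \<omega>)\<^sup>2 \<partial>bridge_measure)"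
      using AE_path_square_integrable
    proof eventually_elim
      case (elim \<omega>)
      show ?case using path[OF elim]
        by (intro nn_integral_eq_integral) (auto simp: square_integrable_def)
    qed
  qed
  also have "\<dots> = ennreal (expectation (\<lambda>\<omega>. \<integral>s. (?E s \<omega>)\<^sup>2 \<partial>bridge_measure))"
    by (rule nn_integral_eq_integral[OF \<open>?int\<close>]) (simp add: Bochner_Integration.integral_nonneg)
  also have "\<dots> < \<infinity>" by simp
  finally show ?sq using jm by (simp add: square_mu_integrable_def)
qed

lemma square_mu_integrable_bridge: "square_mu_integrable M B"
  using truncation_error(1)[of "{}" "\<lambda>_ _. 0" "\<lambda>_ _. 0"] by (simp add: orthonormal_on_def)

lemma expectation_mu_coeff_eigenfunction:
  assumes "1 \<le> k"
  shows "expectation (\<lambda>\<omega>. (mu_coeff B (poly (eigenfunction k)) \<omega>)\<^sup>2) = eigenvalue k"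
proof -
  have "expectation (\<lambda>\<omega>. (mu_coeff B (poly (eigenfunction k)) \<omega>)\<^sup>2)
     = expectation (\<lambda>\<omega>. bridge_coeff k \<omega> * bridge_coeff k \<omega>)"
    by (intro Bochner_Integration.integral_cong refl) (simp add: mu_coeff_eigenfunction power2_eq_square)
  then show ?thesis using expectation_bridge_coeff_mult[OF assms assms] by simp
qed

text \<open>
  Split the path into its first \<open>N\<close> terms and the remainder. The first part contributes the quadratic
  form \<open>\<Sum> \<lambda>\<^sub>j \<langle>f\<^sub>k, e\<^sub>j\<rangle>\<^sup>2\<close>, the second at most its mean squared norm \<open>1 / (N + 1)\<close>.
\<close>

lemma expectation_mu_coeff_square_le:
  assumes f: "orthonormal_on bridge_measure I f" and k: "k \<in> I" and d: "0 < d"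
  shows "expectation (\<lambda>\<omega>. (mu_coeff B (f k) \<omega>)\<^sup>2)
    \<le> (1 + d) * (\<Sum>j=1..N. (\<integral>x. f k x * poly (eigenfunction j) x \<partial>bridge_measure)\<^sup>2 * eigenvalue j)
      + (1 + 1 / d) * (1 / (real N + 1))"
proof -
  define c where "c j = (\<integral>x. f k x * poly (eigenfunction j) x \<partial>bridge_measure)" for j
  let ?R = "\<lambda>s \<omega>. B s \<omega> - (\<Sum>j=1..N. bridge_coeff j \<omega> * poly (eigenfunction j) s)"
  have e: "orthonormal_on bridge_measure {1..N} (\<lambda>j. poly (eigenfunction j))"
    using orthonormal_eigenfunction by (simp add: orthonormal_on_def)
  have es: "square_integrable bridge_measure (poly (eigenfunction j))" if "1 \<le> j" for j
    using orthonormal_eigenfunction that by (simp add: orthonormal_on_def)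
  have fk: "square_integrable bridge_measure (f k)" using f k by (simp add: orthonormal_on_def)
  have "\<forall>j\<in>{1..N}. \<forall>\<omega>\<in>space M. bridge_coeff j \<omega> = mu_coeff B (poly (eigenfunction j)) \<omega>"
    by (simp add: mu_coeff_eigenfunction)
  note trunc = truncation_error[OF finite_atLeastAtMost e this]
  have ER: "expectation (\<lambda>\<omega>. \<integral>s. (?R s \<omega>)\<^sup>2 \<partial>bridge_measure) = 1 / (real N + 1)"
  proof -
    have "(\<Sum>j=1..N. expectation (\<lambda>\<omega>. (mu_coeff B (poly (eigenfunction j)) \<omega>)\<^sup>2)) = (\<Sum>j=1..N. eigenvalue j)"
      by (intro sum.cong refl expectation_mu_coeff_eigenfunction) simp
    then show ?thesis using trunc(3) unfolding sum_eigenvalue by simp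
  qed
  have IS: "integrable M (\<lambda>\<omega>. (\<Sum>j=1..N. c j * bridge_coeff j \<omega>)\<^sup>2)"
    using square_integrable_sum[of "{1..N}" M "\<lambda>j \<omega>. c j * bridge_coeff j \<omega>"]
      square_integrable_cmult[OF bridge_coeff_square_integrable] by (simp add: square_integrable_def)
  have "expectation (\<lambda>\<omega>. (mu_coeff B (f k) \<omega>)\<^sup>2)
     \<le> expectation (\<lambda>\<omega>. (1 + d) * (\<Sum>j=1..N. c j * bridge_coeff j \<omega>)\<^sup>2
         + (1 + 1 / d) * (\<integral>s. (?R s \<omega>)\<^sup>2 \<partial>bridge_measure))"
  proof (rule integral_mono_AE)
    show "integrable M (\<lambda>\<omega>. (mu_coeff B (f k) \<omega>)\<^sup>2)"
      using mu_coeff_square_integrable[OF f k] by (simp add: square_integrable_def)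
    show "integrable M (\<lambda>\<omega>. (1 + d) * (\<Sum>j=1..N. c j * bridge_coeff j \<omega>)\<^sup>2
         + (1 + 1 / d) * (\<integral>s. (?R s \<omega>)\<^sup>2 \<partial>bridge_measure))"
      using IS trunc(2) by (intro Bochner_Integration.integrable_add integrable_mult_right) auto
    show "AE \<omega> in M. (mu_coeff B (f k) \<omega>)\<^sup>2 \<le> (1 + d) * (\<Sum>j=1..N. c j * bridge_coeff j \<omega>)\<^sup>2
         + (1 + 1 / d) * (\<integral>s. (?R s \<omega>)\<^sup>2 \<partial>bridge_measure)"
      using AE_path_square_integrable
    proof eventually_elim
      case (elim \<omega>)
      define y where "y = (\<integral>s. ?R s \<omega> * f k s \<partial>bridge_measure)"
      have R: "square_integrable bridge_measure (\<lambda>s. ?R s \<omega>)"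
        by (intro square_integrable_diff square_integrable_sum square_integrable_cmult elim es) simp
      have iR: "integrable bridge_measure (\<lambda>s. ?R s \<omega> * f k s)" by (rule square_integrable_mult[OF R fk])
      have ie: "integrable bridge_measure (\<lambda>s. f k s * poly (eigenfunction j) s)" if "1 \<le> j" for j
        by (rule square_integrable_mult[OF fk es[OF that]])
      have "mu_coeff B (f k) \<omega> = (\<integral>s. (\<Sum>j=1..N. bridge_coeff j \<omega> * (f k s * poly (eigenfunction j) s)) + ?R s \<omega> * f k s \<partial>bridge_measure)"
        unfolding mu_coeff_def
        by (intro Bochner_Integration.integral_cong refl) (simp add: algebra_simps sum_distrib_left sum_distrib_right)
      also have "\<dots> = (\<integral>s. (\<Sum>j=1..N. bridge_coeff j \<omega> * (f k s * poly (eigenfunction j) s)) \<partial>bridge_measure) + y"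
        unfolding y_def using ie iR
        by (intro Bochner_Integration.integral_add Bochner_Integration.integrable_sum integrable_mult_right) auto
      also have "(\<integral>s. (\<Sum>j=1..N. bridge_coeff j \<omega> * (f k s * poly (eigenfunction j) s)) \<partial>bridge_measure)
          = (\<Sum>j=1..N. c j * bridge_coeff j \<omega>)"
        using ie by (subst Bochner_Integration.integral_sum) (auto simp: c_def mult.commute intro!: sum.cong)
      finally have "(mu_coeff B (f k) \<omega>)\<^sup>2 \<le> (1 + d) * (\<Sum>j=1..N. c j * bridge_coeff j \<omega>)\<^sup>2 + (1 + 1 / d) * y\<^sup>2"
        using weighted_square_le[OF d] by simp
      moreover have "(\<Sum>j\<in>{k}. (\<integral>s. ?R s \<omega> * f j s \<partial>bridge_measure)\<^sup>2) \<le> (\<integral>s. (?R s \<omega>)\<^sup>2 \<partial>bridge_measure)"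
        by (rule Bessel_inequality[OF _ _ R]) (use f k in \<open>auto simp: orthonormal_on_def\<close>)
      then have "(1 + 1 / d) * y\<^sup>2 \<le> (1 + 1 / d) * (\<integral>s. (?R s \<omega>)\<^sup>2 \<partial>bridge_measure)"
        using d by (intro mult_left_mono) (auto simp: y_def)
      ultimately show ?case by linarith
    qed
  qed
  also have "\<dots> = (1 + d) * expectation (\<lambda>\<omega>. (\<Sum>j=1..N. c j * bridge_coeff j \<omega>)\<^sup>2)
      + (1 + 1 / d) * expectation (\<lambda>\<omega>. \<integral>s. (?R s \<omega>)\<^sup>2 \<partial>bridge_measure)"
    using IS trunc(2) by (subst Bochner_Integration.integral_add) auto
  also have "expectation (\<lambda>\<omega>. (\<Sum>j=1..N. c j * bridge_coeff j \<omega>)\<^sup>2) = (\<Sum>j=1..N. (c j)\<^sup>2 * eigenvalue j)"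
    by (rule expectation_coeff_sum_square) auto
  finally show ?thesis unfolding ER c_def .
qed

text \<open>
  The weights \<open>a\<^sub>j = \<Sum>\<^bsub>k\<le>n\<^esub> \<langle>f\<^sub>k, e\<^sub>j\<rangle>\<^sup>2\<close> are at most 1 by Bessel's inequality for the \<open>f\<^sub>k\<close>, and their sum is
  at most \<open>n\<close> by Bessel's inequality for the \<open>e\<^sub>j\<close>. Let \<open>N\<close> tend to infinity, then \<open>d\<close> to 0.
\<close>

lemma sum_expectation_mu_coeff_square_le:
  assumes f: "orthonormal_on bridge_measure {1..n} f" and n: "1 \<le> n"
  shows "(\<Sum>k=1..n. expectation (\<lambda>\<omega>. (mu_coeff B (f k) \<omega>)\<^sup>2)) \<le> (\<Sum>k=1..n. eigenvalue k)"
    (is "?S \<le> ?L")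
proof -
  define c where "c k j = (\<integral>x. f k x * poly (eigenfunction j) x \<partial>bridge_measure)" for k j
  have fk: "square_integrable bridge_measure (f k)" "(\<integral>x. (f k x)\<^sup>2 \<partial>bridge_measure) = 1" if "k \<in> {1..n}" for k
    using f that by (auto simp: orthonormal_on_def power2_eq_square)
  have e: "square_integrable bridge_measure (poly (eigenfunction j))"
      "(\<integral>x. (poly (eigenfunction j) x)\<^sup>2 \<partial>bridge_measure) = 1" if "1 \<le> j" for j
    using orthonormal_eigenfunction that by (auto simp: orthonormal_on_def power2_eq_square)
  have mass: "(\<Sum>j=1..N. (\<Sum>k=1..n. (c k j)\<^sup>2) * eigenvalue j) \<le> ?L" for N
  proof (rule weighted_sum_le_leading_sum[OF n])
    show "0 \<le> (\<Sum>k=1..n. (c k j)\<^sup>2)" for j by (rule sum_nonneg) simp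
    show "(\<Sum>k=1..n. (c k j)\<^sup>2) \<le> 1" if "1 \<le> j" for j
      using Bessel_inequality[OF _ f e(1)[OF that]] e(2)[OF that] by (simp add: c_def mult.commute)
    have "(\<Sum>j=1..N. (c k j)\<^sup>2) \<le> 1" if "k \<in> {1..n}" for k
      using Bessel_inequality[of "{1..N}" bridge_measure "\<lambda>j. poly (eigenfunction j)", OF _ _ fk(1)[OF that]]
        fk(2)[OF that] orthonormal_eigenfunction by (simp add: c_def orthonormal_on_def)
    then have "(\<Sum>k=1..n. \<Sum>j=1..N. (c k j)\<^sup>2) \<le> (\<Sum>k=1..n. 1)" by (rule sum_mono)
    then show "(\<Sum>j=1..N. \<Sum>k=1..n. (c k j)\<^sup>2) \<le> real n" by (subst sum.swap) simp
  qed (auto intro: eigenvalue_antimono less_imp_le[OF eigenvalue_pos])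
  have bound: "?S \<le> (1 + d) * ?L + real n * (1 + 1 / d) * (1 / (real N + 1))" if d: "0 < d" for d N
  proof -
    have "?S \<le> (\<Sum>k=1..n. (1 + d) * (\<Sum>j=1..N. (c k j)\<^sup>2 * eigenvalue j) + (1 + 1 / d) * (1 / (real N + 1)))"
      unfolding c_def by (intro sum_mono expectation_mu_coeff_square_le[OF f _ d])
    also have "\<dots> = (1 + d) * (\<Sum>k=1..n. \<Sum>j=1..N. (c k j)\<^sup>2 * eigenvalue j)
        + real n * (1 + 1 / d) * (1 / (real N + 1))"
      by (simp add: sum.distrib flip: sum_distrib_left)
    also have "(\<Sum>k=1..n. \<Sum>j=1..N. (c k j)\<^sup>2 * eigenvalue j)
        = (\<Sum>j=1..N. (\<Sum>k=1..n. (c k j)\<^sup>2) * eigenvalue j)"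
      by (subst sum.swap) (simp add: sum_distrib_right)
    also have "(1 + d) * \<dots> \<le> (1 + d) * ?L" using d by (intro mult_left_mono mass) auto
    finally show ?thesis by simp
  qed
  have lim: "?S \<le> (1 + d) * ?L" if d: "0 < d" for d
  proof (rule LIMSEQ_le_const)
    have "(\<lambda>N. real n * (1 + 1 / d) * (1 / (real N + 1))) \<longlonglongrightarrow> 0" by real_asymp
    from tendsto_add[OF tendsto_const[of "(1 + d) * ?L"] this]
    show "(\<lambda>N. (1 + d) * ?L + real n * (1 + 1 / d) * (1 / (real N + 1))) \<longlonglongrightarrow> (1 + d) * ?L" by simp
  qed (use bound[OF d] in blast)
  show ?thesis
  proof (rule LIMSEQ_le_const)
    have "(\<lambda>m. (1 + 1 / (real m + 1)) * x) \<longlonglongrightarrow> x" for x by real_asymp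
    then show "(\<lambda>m. (1 + 1 / (real m + 1)) * ?L) \<longlonglongrightarrow> ?L" .
    show "\<exists>N. \<forall>m\<ge>N. ?S \<le> (1 + 1 / (real m + 1)) * ?L"
      by (intro exI[of _ 0] allI impI lim) simp
  qed
qed

end

theorem theorem2p2:
  fixes M :: "'a measure" and B :: "real \<Rightarrow> 'a \<Rightarrow> real"
  assumes "standard_brownian_bridge M B"
  shows "\<exists>e :: nat \<Rightarrow> real poly.
    (\<forall>k\<ge>1. degree (e k) = k + 1) \<and>
    (\<forall>i\<ge>1. \<forall>j\<ge>1. (\<integral>x. poly (e i) x * poly (e j) x \<partial>bridge_measure) = (if i = j then 1 else 0)) \<and>
    (\<forall>t\<in>{0..1}. converges_in_L2 M
        (\<lambda>N \<omega>. \<Sum>k=1..N. poly_coeff B (e k) \<omega> * poly (e k) t) (B t)) \<and>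
    prob_space.indep_vars M (\<lambda>_. borel) (\<lambda>k. poly_coeff B (e k)) {1..} \<and>
    (\<forall>k\<ge>1. gaussian_rv M (poly_coeff B (e k)) \<and>
        prob_space.expectation M (poly_coeff B (e k)) = 0 \<and>
        prob_space.variance M (poly_coeff B (e k)) = 1 / (real k * (real k + 1))) \<and>
    orthonormal_basis bridge_measure (\<lambda>k. poly (e k)) \<and>
    square_mu_integrable M B \<and>
    (\<forall>f. orthonormal_basis bridge_measure f \<longrightarrow> (\<forall>n\<ge>1.
        square_mu_integrable M
          (\<lambda>s \<omega>. B s \<omega> - (\<Sum>k=1..n. poly_coeff B (e k) \<omega> * poly (e k) s)) \<and>
        square_mu_integrable M
          (\<lambda>s \<omega>. B s \<omega> - (\<Sum>k=1..n. mu_coeff B (f k) \<omega> * f k s)) \<and>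
        mu_norm M (\<lambda>s \<omega>. B s \<omega> - (\<Sum>k=1..n. poly_coeff B (e k) \<omega> * poly (e k) s))
          \<le> mu_norm M (\<lambda>s \<omega>. B s \<omega> - (\<Sum>k=1..n. mu_coeff B (f k) \<omega> * f k s))))"
proof -
  interpret brownian_bridge M B by (rule brownian_bridge.intro[OF assms])
  let ?e = eigenfunction
  have pc: "poly_coeff B (?e k) \<omega> = bridge_coeff k \<omega>" if "\<omega> \<in> space M" for k \<omega>
    by (rule poly_coeff_eigenfunction[OF that])
  have pm: "poly_coeff B (?e k) \<omega> = mu_coeff B (poly (?e k)) \<omega>" if "\<omega> \<in> space M" for k \<omega>
    using that by (simp add: pc mu_coeff_eigenfunction)
  have basis: "orthonormal_basis bridge_measure (\<lambda>k. poly (?e k))"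
    by (rule orthonormal_basis_eigenfunction)
  have law: "gaussian_rv M (poly_coeff B (?e k)) \<and> expectation (poly_coeff B (?e k)) = 0 \<and>
      variance (poly_coeff B (?e k)) = 1 / (real k * (real k + 1))" if k: "1 \<le> k" for k
  proof -
    have E: "expectation (poly_coeff B (?e k)) = 0"
      using expectation_bridge_coeff[of k] by (simp add: pc cong: Bochner_Integration.integral_cong)
    have "variance (poly_coeff B (?e k)) = expectation (\<lambda>\<omega>. bridge_coeff k \<omega> * bridge_coeff k \<omega>)"
      unfolding E by (intro Bochner_Integration.integral_cong refl) (simp add: pc power2_eq_square)
    also have "\<dots> = 1 / (real k * (real k + 1))"
      using expectation_bridge_coeff_mult[OF k k] by (simp add: eigenvalue_def)
    finally have V: "variance (poly_coeff B (?e k)) = 1 / (real k * (real k + 1))" .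
    have "gaussian_rv M (poly_coeff B (?e k)) \<longleftrightarrow> gaussian_rv M (bridge_coeff k)"
      unfolding gaussian_rv_def distributed_def
      by (simp add: pc cong: measurable_cong distr_cong AE_cong)
    then show ?thesis using E V gaussian_bridge_coeff[OF k] by simp
  qed
  have conv: "converges_in_L2 M (\<lambda>N \<omega>. \<Sum>k=1..N. poly_coeff B (?e k) \<omega> * poly (?e k) t) (B t)"
    if "t \<in> {0..1}" for t
    unfolding converges_in_L2_def using bridge_series_converges[OF that]
    by (simp add: pc cong: nn_integral_cong)
  have indep: "indep_vars (\<lambda>_. borel) (\<lambda>k. poly_coeff B (?e k)) {1..}"
  proof -
    have "poly_coeff B (?e k) -` A \<inter> space M = bridge_coeff k -` A \<inter> space M" for k A
      by (auto simp: pc)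
    moreover have "random_variable borel (poly_coeff B (?e k)) \<longleftrightarrow> random_variable borel (bridge_coeff k)" for k
      by (simp add: pc cong: measurable_cong)
    ultimately show ?thesis using indep_bridge_coeff unfolding indep_vars_def2 by (simp only:) blast
  qed
  have opt: "square_mu_integrable M (\<lambda>s \<omega>. B s \<omega> - (\<Sum>k=1..n. poly_coeff B (?e k) \<omega> * poly (?e k) s)) \<and>
      square_mu_integrable M (\<lambda>s \<omega>. B s \<omega> - (\<Sum>k=1..n. mu_coeff B (f k) \<omega> * f k s)) \<and>
      mu_norm M (\<lambda>s \<omega>. B s \<omega> - (\<Sum>k=1..n. poly_coeff B (?e k) \<omega> * poly (?e k) s))
        \<le> mu_norm M (\<lambda>s \<omega>. B s \<omega> - (\<Sum>k=1..n. mu_coeff B (f k) \<omega> * f k s))"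
    if f: "orthonormal_basis bridge_measure f" and n: "1 \<le> n" for f n
  proof -
    have f': "orthonormal_on bridge_measure {1..n} f"
      by (rule orthonormal_basis_imp_orthonormal_on[OF f]) auto
    have e': "orthonormal_on bridge_measure {1..n} (\<lambda>k. poly (?e k))"
      by (rule orthonormal_basis_imp_orthonormal_on[OF basis]) auto
    have "\<forall>k\<in>{1..n}. \<forall>\<omega>\<in>space M. poly_coeff B (?e k) \<omega> = mu_coeff B (poly (?e k)) \<omega>"
      using pm by blast
    note te = truncation_error[OF finite_atLeastAtMost e' this]
    have "\<forall>k\<in>{1..n}. \<forall>\<omega>\<in>space M. mu_coeff B (f k) \<omega> = mu_coeff B (f k) \<omega>" by simp
    note tf = truncation_error[OF finite_atLeastAtMost f' this]
    have "(\<Sum>k=1..n. expectation (\<lambda>\<omega>. (mu_coeff B (poly (?e k)) \<omega>)\<^sup>2)) = (\<Sum>k=1..n. eigenvalue k)"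
      by (intro sum.cong refl expectation_mu_coeff_eigenfunction) simp
    then have "mu_norm M (\<lambda>s \<omega>. B s \<omega> - (\<Sum>k=1..n. poly_coeff B (?e k) \<omega> * poly (?e k) s))
        \<le> mu_norm M (\<lambda>s \<omega>. B s \<omega> - (\<Sum>k=1..n. mu_coeff B (f k) \<omega> * f k s))"
      unfolding mu_norm_def te(3) tf(3)
      using sum_expectation_mu_coeff_square_le[OF f' n] by simp
    then show ?thesis using te(1) tf(1) by blast
  qed
  have degree: "\<forall>k\<ge>1. degree (?e k) = k + 1"
    using degree_eigenfunction by blast
  have orthonormal: "\<forall>i\<ge>1. \<forall>j\<ge>1.
      (\<integral>x. poly (?e i) x * poly (?e j) x \<partial>bridge_measure) = (if i = j then 1 else 0)"
    using basis unfolding orthonormal_basis_def by blast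
  have "\<forall>t\<in>{0..1}. converges_in_L2 M (\<lambda>N \<omega>. \<Sum>k=1..N. poly_coeff B (?e k) \<omega> * poly (?e k) t) (B t)"
    using conv by blast
  moreover have "\<forall>k\<ge>1. gaussian_rv M (poly_coeff B (?e k)) \<and> expectation (poly_coeff B (?e k)) = 0 \<and>
      variance (poly_coeff B (?e k)) = 1 / (real k * (real k + 1))"
    using law by blast
  ultimately show ?thesis
    using opt by (intro exI[of _ ?e] conjI degree orthonormal indep basis square_mu_integrable_bridge) blast+
qed

end
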